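(* Assume the setting and Assumptions A1--A5 described in the context. Then there exists a constant $C_v$ depending only on $\{\gamma_0,\lambda,\eta,s,C_X,C_Y(\cdot)\}$ such that $$\mathbb{E}\,(\mathrm{LO}-\mathrm{OO})^2\le \frac{C_v}{n}.$$
   Context: Setting. The data set is $\mathcal{D}=\{(y_i,\mathbf{x}_i)\}_{i=1}^n$ with $\mathbf{x}_i\in\mathbb{R}^p$, $y_i\in\mathbb{R}$, the pairs being i.i.d. draws from a joint distribution $q(y\mid \mathbf{x}^\top\boldsymbol{\beta}^* )\,p(\mathbf{x})$, where $\boldsymbol{\beta}^*\in\mathbf{\Theta}\subset\mathbb{R}^p$ is the true parameter. $\ell(y,z)$ is a non-negative convex loss function, $r$ a non-negative convex regularizer, and $\lambda>0$ a tuning parameter. Define $$\hat{\boldsymbol{\beta}}=\operatorname*{argmin}_{\boldsymbol{\beta}\in\mathbf{\Theta}}\sum_{j=1}^n\ell(y_j,\mathbf{x}_j^\top\boldsymbol{\beta})+\lambda r(\boldsymbol{\beta}),\qquad \hat{\boldsymbol{\beta}}_{/i}=\operatorname*{argmin}_{\boldsymbol{\beta}\in\mathbf{\Theta}}\sum_{j\ne i}\ell(y_j,\mathbf{x}_j^\top\boldsymbol{\beta})+\lambda r(\boldsymbol{\beta}),\quad 1\le i\le n.$$ For a function $\phi(y,z)$ measuring the difference between $y$ and $z$, let $$\mathrm{OO}=\mathbb{E}[\phi(y_0,\mathbf{x}_0^\top\hat{\boldsymbol{\beta}})\mid\mathcal{D}],\qquad \mathrm{LO}=\frac1n\sum_{i=1}^n\phi(y_i,\mathbf{x}_i^\top\hat{\boldsymbol{\beta}}_{/i}),$$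 where $(y_0,\mathbf{x}_0)$ has the same distribution as $(y_1,\mathbf{x}_1)$ and is independent of $\mathcal{D}$. Write $\dot\ell(y,z)=\partial_z\ell(y,z)$ and $\dot\phi(y,z)=\partial_z\phi(y,z)$. Assumptions. A1: $\mathbf{\Theta}\subset\mathbb{R}^p$ is a closed convex set. A2: Both $n$ and $p$ are large, while $n/p\equiv\gamma_0\in(0,\infty)$. A3: $\mathbf{x}_1,\dots,\mathbf{x}_n$ are i.i.d. $N(0,\mathbf{\Sigma})$ in $\mathbb{R}^p$, and there are constants $0<c_X\le C_X$ such that $p^{-1}c_X\le\sigma_{\min}(\mathbf{\Sigma})\le\sigma_{\max}(\mathbf{\Sigma})\le p^{-1}C_X$ (minimum and maximum singular values). A4: $r(\boldsymbol{\beta})=(1-\eta)r_0(\boldsymbol{\beta})+\eta\,\boldsymbol{\beta}^\top\boldsymbol{\beta}$, where $\eta\in(0,1)$ and $r_0$ is non-negative, convex and Lipschitz continuous. A5: $\ell(y,z)$ and $\phi(y,z)$ are non-negative, convex and continuously differentiable with respect to $z$, and there are constants $s,C>0$ with $$\max\{|\ell(y,z)|,|\dot\ell(y,z)|,|\phi(y,z)|,|\dot\phi(y,z)|\}\le C(1+|y|^s+|z|^s)\quad\text{for all }(y,z).$$ Moreover, for every $m>0$ there is a constant $C_Y(m)$ depending only on $m$ such that $\mathbb{E}|y_i|^m\le C_Y(m)$ for all $n\ge1$ and $1\le i\le n$.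
   Formalization: C_v may also depend on the growth constant C of A5 and on a number κ such that r(β) ≤ κp for some β in Θ (κ=0 if 0 ∈ Θ and r_0(0)=0). Without these no uniform constant exists: take Θ={b}, ℓ=0, r_0=0, y=0, φ=z² with b arbitrarily large. *)

theory Defs
  imports
    "HOL-Probability.Probability"
    "HOL-Analysis.Abstract_Euclidean_Space"
    "Jordan_Normal_Form.Char_Poly"
begin

text \<open>
  The dimension \<open>p\<close> varies with the sample size, so \<open>\<real>\<^sup>p\<close> cannot be a type. It is the carrier of the
  library's \<^const>\<open>Euclidean_space\<close>, i.e. the functions \<open>nat \<Rightarrow> real\<close> that vanish from index \<open>p\<close> on;
  \<open>borel\<close> on \<open>nat \<Rightarrow> real\<close> (product topology) traces the usual Borel sets on this closed subset.
\<close>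

abbreviation Rn :: "nat \<Rightarrow> (nat \<Rightarrow> real) set" where
  "Rn p \<equiv> topspace (Euclidean_space p)"

definition dotp :: "nat \<Rightarrow> (nat \<Rightarrow> real) \<Rightarrow> (nat \<Rightarrow> real) \<Rightarrow> real" where
  "dotp p u v = (\<Sum>i<p. u i * v i)"

definition segment_point :: "real \<Rightarrow> (nat \<Rightarrow> real) \<Rightarrow> (nat \<Rightarrow> real) \<Rightarrow> nat \<Rightarrow> real" where
  "segment_point t u v = (\<lambda>i. (1 - t) * u i + t * v i)"

definition convex_Rn :: "(nat \<Rightarrow> real) set \<Rightarrow> bool" where
  "convex_Rn S \<longleftrightarrow> (\<forall>u\<in>S. \<forall>v\<in>S. \<forall>t\<in>{0..1}. segment_point t u v \<in> S)"

definition convex_fun_Rn :: "nat \<Rightarrow> ((nat \<Rightarrow> real) \<Rightarrow> real) \<Rightarrow> bool" where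
  "convex_fun_Rn p f \<longleftrightarrow>
     (\<forall>u\<in>Rn p. \<forall>v\<in>Rn p. \<forall>t\<in>{0..1}. f (segment_point t u v) \<le> (1 - t) * f u + t * f v)"

definition lipschitz_fun_Rn :: "nat \<Rightarrow> ((nat \<Rightarrow> real) \<Rightarrow> real) \<Rightarrow> bool" where
  "lipschitz_fun_Rn p f \<longleftrightarrow>
     (\<exists>L. \<forall>u\<in>Rn p. \<forall>v\<in>Rn p. \<bar>f u - f v\<bar> \<le> L * L2_set (\<lambda>i. u i - v i) {..<p})"

definition singular_values :: "real mat \<Rightarrow> real set" where
  "singular_values A = {\<sigma>. 0 \<le> \<sigma> \<and> eigenvalue (transpose_mat A * A) (\<sigma>\<^sup>2)}"

definition sigma_min :: "real mat \<Rightarrow> real" where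
  "sigma_min A = Min (singular_values A)"

definition sigma_max :: "real mat \<Rightarrow> real" where
  "sigma_max A = Max (singular_values A)"

definition quad_form :: "nat \<Rightarrow> real mat \<Rightarrow> (nat \<Rightarrow> real) \<Rightarrow> real" where
  "quad_form p S t = (\<Sum>i<p. \<Sum>j<p. t i * S $$ (i, j) * t j)"

text \<open>
  \<open>gaussian_law p S P\<close>: \<open>P\<close> is the law \<open>N(0, S)\<close> on \<open>\<real>\<^sup>p\<close>, i.e. \<open>S\<close> is symmetric positive semidefinite
  and for every \<open>t\<close> the linear functional \<open>x \<mapsto> t\<^sup>T x\<close> is distributed as \<open>sqrt (t\<^sup>T S t) Z\<close> with \<open>Z\<close>
  standard normal (so that \<open>t\<^sup>T S t = 0\<close> is the point mass at 0).
\<close>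

definition gaussian_law :: "nat \<Rightarrow> real mat \<Rightarrow> (nat \<Rightarrow> real) measure \<Rightarrow> bool" where
  "gaussian_law p S P \<longleftrightarrow>
     S \<in> carrier_mat p p \<and> transpose_mat S = S \<and>
     prob_space P \<and> sets P = sets borel \<and> (AE x in P. x \<in> Rn p) \<and>
     (\<forall>t\<in>Rn p. 0 \<le> quad_form p S t \<and>
        distr P borel (dotp p t) =
        distr std_normal_distribution borel (\<lambda>z. sqrt (quad_form p S t) * z))"

text \<open>
  The quantity \<open>(min\<^bsub>\<Theta>\<^esub> r) / p\<close> enters error bounds: it vanishes if \<open>0 \<in> \<Theta>\<close> and \<open>r0 0 = 0\<close>, but without any
  control on it a bound uniform in \<open>\<Theta>\<close> and \<open>r0\<close> is impossible. For \<open>\<Theta> = {b}\<close>, \<open>l = 0\<close> and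
  \<open>\<phi> y z = z\<^sup>2\<close> all estimators equal \<open>b\<close>, and the mean squared difference between leave-one-out
  estimate and out-of-sample error is \<open>2 (b\<^sup>T S b)\<^sup>2 / n\<close>, with \<open>b\<close> arbitrarily large.
\<close>

definition enet_reg :: "nat \<Rightarrow> real \<Rightarrow> ((nat \<Rightarrow> real) \<Rightarrow> real) \<Rightarrow> (nat \<Rightarrow> real) \<Rightarrow> real" where
  "enet_reg p \<eta> r0 b = (1 - \<eta>) * r0 b + \<eta> * dotp p b b"

text \<open>
  The index set \<open>J\<close> lists the observations used in the fit: \<open>{1..n}\<close> for the full estimator and
  \<open>{1..n} - {i}\<close> for the leave-one-out ones.
\<close>

definition estimator ::
  "nat \<Rightarrow> (nat \<Rightarrow> real) set \<Rightarrow> (real \<Rightarrow> real \<Rightarrow> real) \<Rightarrow> real \<Rightarrow> ((nat \<Rightarrow> real) \<Rightarrow> real) \<Rightarrow>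
   nat set \<Rightarrow> (nat \<Rightarrow> real) \<Rightarrow> (nat \<Rightarrow> nat \<Rightarrow> real) \<Rightarrow> nat \<Rightarrow> real" where
  "estimator p \<Theta> l lam r J y x =
     arg_min_on (\<lambda>b. (\<Sum>j\<in>J. l (y j) (dotp p (x j) b)) + lam * r b) \<Theta>"

text \<open>
  Below, \<open>Y i\<close> and \<open>X i\<close> are random variables on the probability space \<open>M\<close>; the data set consists of
  the pairs with index \<open>1, \<dots>, n\<close>, and index \<open>0\<close> is the new observation.
\<close>

definition LO_est ::
  "nat \<Rightarrow> nat \<Rightarrow> (nat \<Rightarrow> real) set \<Rightarrow> (real \<Rightarrow> real \<Rightarrow> real) \<Rightarrow> real \<Rightarrow> ((nat \<Rightarrow> real) \<Rightarrow> real) \<Rightarrow>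
   (real \<Rightarrow> real \<Rightarrow> real) \<Rightarrow> (nat \<Rightarrow> 'w \<Rightarrow> real) \<Rightarrow> (nat \<Rightarrow> 'w \<Rightarrow> nat \<Rightarrow> real) \<Rightarrow> 'w \<Rightarrow> real" where
  "LO_est n p \<Theta> l lam r \<phi> Y X \<omega> =
     (1 / real n) * (\<Sum>i\<in>{1..n}. \<phi> (Y i \<omega>) (dotp p (X i \<omega>)
        (estimator p \<Theta> l lam r ({1..n} - {i}) (\<lambda>j. Y j \<omega>) (\<lambda>j. X j \<omega>))))"

definition new_error ::
  "nat \<Rightarrow> nat \<Rightarrow> (nat \<Rightarrow> real) set \<Rightarrow> (real \<Rightarrow> real \<Rightarrow> real) \<Rightarrow> real \<Rightarrow> ((nat \<Rightarrow> real) \<Rightarrow> real) \<Rightarrow>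
   (real \<Rightarrow> real \<Rightarrow> real) \<Rightarrow> (nat \<Rightarrow> 'w \<Rightarrow> real) \<Rightarrow> (nat \<Rightarrow> 'w \<Rightarrow> nat \<Rightarrow> real) \<Rightarrow> 'w \<Rightarrow> real" where
  "new_error n p \<Theta> l lam r \<phi> Y X \<omega> =
     \<phi> (Y 0 \<omega>) (dotp p (X 0 \<omega>)
        (estimator p \<Theta> l lam r {1..n} (\<lambda>j. Y j \<omega>) (\<lambda>j. X j \<omega>)))"

definition data_algebra ::
  "'w measure \<Rightarrow> nat \<Rightarrow> (nat \<Rightarrow> 'w \<Rightarrow> real) \<Rightarrow> (nat \<Rightarrow> 'w \<Rightarrow> nat \<Rightarrow> real) \<Rightarrow> 'w measure" where
  "data_algebra M n Y X =
     vimage_algebra (space M) (\<lambda>\<omega>. \<lambda>i\<in>{1..n}. (Y i \<omega>, X i \<omega>)) (Pi\<^sub>M {1..n} (\<lambda>_. borel))"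

definition OO_err ::
  "'w measure \<Rightarrow> nat \<Rightarrow> nat \<Rightarrow> (nat \<Rightarrow> real) set \<Rightarrow> (real \<Rightarrow> real \<Rightarrow> real) \<Rightarrow> real \<Rightarrow>
   ((nat \<Rightarrow> real) \<Rightarrow> real) \<Rightarrow> (real \<Rightarrow> real \<Rightarrow> real) \<Rightarrow> (nat \<Rightarrow> 'w \<Rightarrow> real) \<Rightarrow>
   (nat \<Rightarrow> 'w \<Rightarrow> nat \<Rightarrow> real) \<Rightarrow> 'w \<Rightarrow> real" where
  "OO_err M n p \<Theta> l lam r \<phi> Y X =
     real_cond_exp M (data_algebra M n Y X) (new_error n p \<Theta> l lam r \<phi> Y X)"

text \<open>
  The pairs \<open>(Y i, X i)\<close>, \<open>0 \<le> i \<le> n\<close>, are i.i.d. draws from \<open>q(y | x\<^sup>T b) P(dx)\<close>. The conditional law \<open>q\<close>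
  is a Markov kernel, so no density of the response is required.
\<close>

definition iid_sample ::
  "'w measure \<Rightarrow> nat \<Rightarrow> nat \<Rightarrow> (real \<Rightarrow> real measure) \<Rightarrow> (nat \<Rightarrow> real) \<Rightarrow> (nat \<Rightarrow> real) measure \<Rightarrow>
   (nat \<Rightarrow> 'w \<Rightarrow> real) \<Rightarrow> (nat \<Rightarrow> 'w \<Rightarrow> nat \<Rightarrow> real) \<Rightarrow> bool" where
  "iid_sample M n p q b P Y X \<longleftrightarrow>
     prob_space M \<and>
     q \<in> borel \<rightarrow>\<^sub>M prob_algebra borel \<and>
     (\<forall>i\<in>{0..n}. \<forall>\<omega>\<in>space M. X i \<omega> \<in> Rn p) \<and>
     prob_space.indep_vars M (\<lambda>_. borel) (\<lambda>i \<omega>. (Y i \<omega>, X i \<omega>)) {0..n} \<and>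
     (\<forall>i\<in>{0..n}. distr M borel (\<lambda>\<omega>. (Y i \<omega>, X i \<omega>)) =
        P \<bind> (\<lambda>x. distr (q (dotp p x b)) borel (\<lambda>y. (y, x))))"

text \<open>
  Measurability of the loss in the response is implicit in writing expectations of it; joint
  measurability follows from continuity in the second argument.
\<close>

definition smooth_convex_loss :: "(real \<Rightarrow> real \<Rightarrow> real) \<Rightarrow> bool" where
  "smooth_convex_loss l \<longleftrightarrow>
     (\<forall>z. (\<lambda>y. l y z) \<in> borel_measurable borel) \<and>
     (\<forall>y z. 0 \<le> l y z) \<and>
     (\<forall>y. convex_on UNIV (l y) \<and> l y C1_differentiable_on UNIV)"

end

theory Submission
  imports Defs "Jordan_Normal_Form.Spectral_Radius"
begin

text \<open>
  Write \<open>b\<^sub>J\<close> for the estimator fitted on the observations in \<open>J\<close>, \<open>V\<^sub>i = \<phi>(y\<^sub>i, x\<^sub>i\<^sup>T b\<^bsub>-i\<^esub>)\<close>,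
  \<open>R(b)\<close> for the out-of-sample risk of a fixed \<open>b\<close>, and \<open>W\<^sub>i = V\<^sub>i - R(b\<^bsub>-i\<^esub>)\<close>. Since \<open>OO = R(b)\<close> almost
  surely, \<open>LO - OO\<close> is the average of the \<open>W\<^sub>i\<close> plus the average of \<open>R(b\<^bsub>-i\<^esub>) - R(b)\<close>.
  Strong convexity gives \<open>|b\<^sub>J - b\<^bsub>J-i\<^esub>| \<le> |l'(y\<^sub>i, x\<^sub>i\<^sup>T b\<^bsub>J-i\<^esub>)| |x\<^sub>i| / (2 \<lambda> \<eta>)\<close>, which has bounded moments;
  as the covariance is of order \<open>1/p\<close>, a fresh Gaussian \<open>x\<close> sees this difference only at scale \<open>1/sqrt p\<close>, so
  deleting one observation changes prediction errors and risks by \<open>O(1/n)\<close> in mean square. This settles the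
  second average. For the first one, the off-diagonal terms are small because \<open>W\<^sub>i\<close> has mean zero
  given all observations but the \<open>i\<close>th: if \<open>W\<^sub>i'\<close> and \<open>W\<^sub>j'\<close> are computed without both \<open>i\<close> and \<open>j\<close>, then
  \<open>E W\<^sub>i W\<^sub>j = E (W\<^sub>i - W\<^sub>i') (W\<^sub>j - W\<^sub>j') = O(1/n)\<close>.
\<close>

subsection \<open>Minimisers of strongly convex functions\<close>

text \<open>The scaling shapes everything: \<open>|b|\<close> is of order \<open>sqrt p\<close> and
  \<open>|x|\<close> of order one, so \<open>x\<^sup>T b\<close> is of order one for a fit that
  ignores \<open>x\<close>. The size of \<open>b\<close> is controlled by comparison with one point
  of \<Theta> whose penalty is at most \<open>\<kappa> p\<close>. Bounding
  \<open>x\<^sup>T d\<close> for a difference \<open>d\<close> of fits by Cauchy-Schwarz would lose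
  a factor \<open>sqrt p\<close>, so prediction differences are estimated at an observation outside
  both fits, by conditioning on \<open>d\<close>. Conditioning means Fubini's theorem here, which is
  why the minimiser has to be measurable although \<open>arg_min_on\<close> is a mere choice.
  Moments of all orders are carried along because the growth bounds are polynomial and multiply
  dependent factors. In the mean square of the first average there are n diagonal terms of order one
  and about n^2 others, so the latter must be of order 1/n. Replacing only one of
  \<open>W\<^sub>i\<close>, \<open>W\<^sub>j\<close> by its difference would give 1/sqrt n; the
  product of two differences gives 1/n.\<close>

abbreviation nrm :: "nat \<Rightarrow> (nat \<Rightarrow> real) \<Rightarrow> real" where
  "nrm p u \<equiv> L2_set u {..<p}"

abbreviation diff_Rn :: "(nat \<Rightarrow> real) \<Rightarrow> (nat \<Rightarrow> real) \<Rightarrow> nat \<Rightarrow> real" where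
  "diff_Rn u v \<equiv> (\<lambda>i. u i - v i)"

lemma Rn_iff: "u \<in> Rn p \<longleftrightarrow> (\<forall>i\<ge>p. u i = 0)"
  by (simp add: topspace_Euclidean_space)

lemma dotp_self: "dotp p u u = (nrm p u)\<^sup>2"
  by (simp add: dotp_def L2_set_def sum_nonneg power2_eq_square)

lemma abs_dotp_le: "\<bar>dotp p u v\<bar> \<le> nrm p u * nrm p v"
proof -
  have "\<bar>dotp p u v\<bar> \<le> (\<Sum>i<p. \<bar>u i\<bar> * \<bar>v i\<bar>)"
    unfolding dotp_def by (rule order_trans[OF sum_abs]) (simp add: abs_mult)
  then show ?thesis using L2_set_mult_ineq[of u v "{..<p}"] by linarith
qed

lemma dotp_commute: "dotp p u v = dotp p v u"
  by (simp add: dotp_def mult.commute)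

lemma dotp_diff_right: "dotp p x (diff_Rn u v) = dotp p x u - dotp p x v"
  by (simp add: dotp_def right_diff_distrib sum_subtractf)

lemma dotp_scale_right: "dotp p x (\<lambda>i. c * u i) = c * dotp p x u"
  by (simp add: dotp_def sum_distrib_left mult_ac)

lemma nrm_scale: "nrm p (\<lambda>i. c * u i) = \<bar>c\<bar> * nrm p u"
  by (simp add: L2_set_def power_mult_distrib real_sqrt_mult flip: sum_distrib_left)

lemma dotp_segment: "dotp p x (segment_point t u v) = (1 - t) * dotp p x u + t * dotp p x v"
  by (simp add: dotp_def segment_point_def distrib_left sum.distrib sum_distrib_left mult_ac)

lemma tendsto_coordinatewise_iff:
  fixes a :: "'c \<Rightarrow> nat \<Rightarrow> real"
  shows "(a \<longlongrightarrow> b) F \<longleftrightarrow> (\<forall>i. ((\<lambda>k. a k i) \<longlongrightarrow> b i) F)"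
  using limitin_componentwise[of "\<lambda>_::nat. euclidean :: real topology" UNIV a b F]
  by (simp add: euclidean_product_topology limitin_canonical_iff extensional_UNIV)

lemma nrm_tendsto:
  assumes "\<And>i. (\<lambda>k. a k i) \<longlonglongrightarrow> b i"
  shows "(\<lambda>k. nrm p (a k)) \<longlonglongrightarrow> nrm p b"
  unfolding L2_set_def by (intro tendsto_intros assms)

lemma dotp_tendsto:
  assumes "\<And>i. (\<lambda>k. a k i) \<longlonglongrightarrow> b i"
  shows "(\<lambda>k. dotp p x (a k)) \<longlonglongrightarrow> dotp p x b"
  unfolding dotp_def by (intro tendsto_intros assms)

lemma abs_coord_le_nrm: "i < p \<Longrightarrow> \<bar>u i\<bar> \<le> nrm p u"
  using member_le_L2_set[of "{..<p}" i "\<lambda>i. \<bar>u i\<bar>"] by (simp add: L2_set_def)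

text \<open>The convexity defect of the squared norm is exact, so the ridge part of the penalty
  makes the objective strongly convex however flat the loss and \<open>r0\<close> are.\<close>

lemma dotp_self_segment:
  "dotp p (segment_point t u v) (segment_point t u v)
    = (1 - t) * dotp p u u + t * dotp p v v - t * (1 - t) * (nrm p (diff_Rn u v))\<^sup>2"
  unfolding dotp_self[symmetric] dotp_def segment_point_def sum_distrib_left
    sum.distrib[symmetric] sum_subtractf[symmetric]
  by (rule sum.cong) (auto simp: algebra_simps)

text \<open>The modulus is normalised so that a term \<open>c |u|\<^sup>2\<close> in
  \<open>f\<close> accounts for \<open>f_strong\<close> with equality, and growth at the minimum has
  the same constant. Continuity is asked along coordinatewise limits because that is convergence in
  \<open>nat \<Rightarrow> real\<close>, the kind that a minimising sequence and a dense sequence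
  deliver.\<close>

locale strong_min =
  fixes p :: nat and \<Theta> :: "(nat \<Rightarrow> real) set" and f :: "(nat \<Rightarrow> real) \<Rightarrow> real" and c :: real
  assumes closed_dom: "closedin (Euclidean_space p) \<Theta>" and convex_dom: "convex_Rn \<Theta>"
    and dom_ne: "\<Theta> \<noteq> {}" and c_pos: "0 < c"
    and f_nonneg: "\<And>u. u \<in> \<Theta> \<Longrightarrow> 0 \<le> f u"
    and f_strong: "\<And>u v t. u \<in> \<Theta> \<Longrightarrow> v \<in> \<Theta> \<Longrightarrow> 0 \<le> t \<Longrightarrow> t \<le> 1 \<Longrightarrow>
      f (segment_point t u v) \<le> (1 - t) * f u + t * f v - c * (t * (1 - t) * (nrm p (diff_Rn u v))\<^sup>2)"
    and f_cont: "\<And>a b. (\<And>k. a k \<in> \<Theta>) \<Longrightarrow> b \<in> \<Theta> \<Longrightarrow> (\<And>i. (\<lambda>k. a k i) \<longlonglongrightarrow> b i) \<Longrightarrow>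
      (\<lambda>k. f (a k)) \<longlonglongrightarrow> f b"
begin

lemma dom_sub: "\<Theta> \<subseteq> Rn p"
  using closed_dom closedin_subset by blast

lemma seg_dom: "u \<in> \<Theta> \<Longrightarrow> v \<in> \<Theta> \<Longrightarrow> 0 \<le> t \<Longrightarrow> t \<le> 1 \<Longrightarrow> segment_point t u v \<in> \<Theta>"
  using convex_dom by (auto simp: convex_Rn_def)

text \<open>Testing the minimality of \<open>b\<close> at a point of the segment towards
  \<open>u\<close> and dividing by t leaves a factor 1 - t; letting t tend to 0 removes it, so no
  part of \<open>c\<close> is lost.\<close>

lemma growth:
  assumes b: "b \<in> \<Theta>" "\<And>u. u \<in> \<Theta> \<Longrightarrow> f b \<le> f u" and u: "u \<in> \<Theta>"
  shows "f b + c * (nrm p (diff_Rn u b))\<^sup>2 \<le> f u"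
proof -
  let ?d = "(nrm p (diff_Rn u b))\<^sup>2"
  have d: "nrm p (diff_Rn b u) = nrm p (diff_Rn u b)"
    by (simp add: L2_set_def power2_commute)
  have *: "c * ((1 - t) * ?d) \<le> f u - f b" if t: "0 < t" "t \<le> 1" for t
  proof -
    have "f b \<le> (1 - t) * f b + t * f u - c * (t * (1 - t) * ?d)"
      using f_strong[OF b(1) u, of t] b(2)[OF seg_dom[OF b(1) u, of t]] t d by simp
    then have "t * (c * ((1 - t) * ?d)) \<le> t * (f u - f b)" by (simp add: algebra_simps)
    then show ?thesis using t by simp
  qed
  have lim: "((\<lambda>t. c * ((1 - t) * ?d)) \<longlongrightarrow> c * ((1 - 0) * ?d)) (at_right 0)"
    by (intro tendsto_intros)
  have "c * ((1 - 0) * ?d) \<le> f u - f b"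
    by (rule tendsto_upperbound[OF lim])
      (auto simp: eventually_at_right[of 0 "1::real"] intro!: exI[of _ 1] *)
  then show ?thesis by simp
qed

text \<open>\<Theta> may be unbounded, so this is the direct method without compactness: midpoints
  cannot fall below the infimum, and strong convexity then makes a minimising sequence
  Cauchy.\<close>

lemma ex_min: "\<exists>b\<in>\<Theta>. \<forall>u\<in>\<Theta>. f b \<le> f u"
proof -
  define m where "m = (INF u\<in>\<Theta>. f u)"
  have bdd: "bdd_below (f ` \<Theta>)" using f_nonneg by (auto intro!: bdd_belowI[of _ 0])
  have m_le: "m \<le> f u" if "u \<in> \<Theta>" for u unfolding m_def by (rule cINF_lower[OF bdd that])
  have "\<exists>u\<in>\<Theta>. f u < m + 1 / Suc k" for k :: nat
    using cInf_lessD[of "f ` \<Theta>" "m + 1 / Suc k"] dom_ne by (auto simp: m_def)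
  then obtain a where a: "\<And>k. a k \<in> \<Theta>" "\<And>k::nat. f (a k) < m + 1 / Suc k" by metis
  \<comment> \<open>The weight t (1 - t) is 1/4 at the midpoint and the two excesses over
    \<open>m\<close> are halved, whence the factor 2.\<close>
  have a_close: "c * (nrm p (diff_Rn (a k) (a l)))\<^sup>2 \<le> 2 * (1 / Suc k + 1 / Suc l)" for k l
  proof -
    have "m \<le> f (segment_point (1/2) (a k) (a l))" by (intro m_le seg_dom a) auto
    then show ?thesis
      using f_strong[OF a(1)[of k] a(1)[of l], of "1/2"] a(2)[of k] a(2)[of l] by simp
  qed
  have "convergent (\<lambda>k. a k i)" for i
  proof (cases "i < p")
    case True
    have "Cauchy (\<lambda>k. a k i)"
    proof (rule metric_CauchyI)
      fix e :: real assume e: "0 < e"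
      define N where "N = nat \<lceil>4 / (c * e\<^sup>2)\<rceil>"
      have N: "4 / (c * e\<^sup>2) < Suc k" if "k \<ge> N" for k
        using that unfolding N_def by linarith
      have inv: "1 / Suc k < c * e\<^sup>2 / 4" if "k \<ge> N" for k
        using N[OF that] c_pos e by (simp add: field_simps)
      have "dist (a k i) (a l i) < e" if kl: "k \<ge> N" "l \<ge> N" for k l
      proof -
        have "\<bar>a k i - a l i\<bar>\<^sup>2 \<le> (nrm p (diff_Rn (a k) (a l)))\<^sup>2"
          using abs_coord_le_nrm[OF True, of "diff_Rn (a k) (a l)"] by (intro power_mono) auto
        then have "c * \<bar>a k i - a l i\<bar>\<^sup>2 \<le> c * (nrm p (diff_Rn (a k) (a l)))\<^sup>2" using c_pos by simp
        also have "\<dots> \<le> 2 * (1 / Suc k + 1 / Suc l)" by (rule a_close)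
        also have "\<dots> < 2 * (c * e\<^sup>2 / 4 + c * e\<^sup>2 / 4)"
          by (intro mult_strict_left_mono add_strict_mono inv kl) auto
        also have "\<dots> = c * e\<^sup>2" by simp
        finally have "\<bar>a k i - a l i\<bar>\<^sup>2 < e\<^sup>2" using c_pos by simp
        then show ?thesis using e by (simp add: dist_real_def power2_less_imp_less)
      qed
      then show "\<exists>M. \<forall>m\<ge>M. \<forall>n\<ge>M. dist (a m i) (a n i) < e" by blast
    qed
    then show ?thesis by (simp add: Cauchy_convergent_iff)
  next
    case False
    then have "a k i = 0" for k using a(1)[of k] dom_sub by (auto simp: Rn_iff)
    then show ?thesis by (simp add: convergent_const)
  qed
  then obtain b where b: "\<And>i. (\<lambda>k. a k i) \<longlonglongrightarrow> b i" unfolding convergent_def by metis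
  have bdom: "b \<in> \<Theta>"
  proof (rule closed_sequentially)
    show "closed \<Theta>" using closed_dom by (rule closedin_Euclidean_imp_closed)
    show "a \<longlonglongrightarrow> b" using b by (simp add: tendsto_coordinatewise_iff)
  qed (use a in auto)
  have "f b \<le> m"
  proof (rule LIMSEQ_le)
    show "(\<lambda>k. f (a k)) \<longlonglongrightarrow> f b" by (rule f_cont[OF a(1) bdom b])
    show "(\<lambda>k. m + 1 / Suc k) \<longlonglongrightarrow> m"
      using tendsto_add[OF tendsto_const[of m] LIMSEQ_inverse_real_of_nat]
      by (simp add: inverse_eq_divide)
    show "\<exists>N. \<forall>n\<ge>N. f (a n) \<le> m + 1 / Suc n" using a(2) less_imp_le by blast
  qed
  then show ?thesis using bdom m_le by (meson order_trans)
qed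

text \<open>\<open>arg_min_on\<close> is a choice operator and carries information only because
  \<open>ex_min\<close> provides a minimiser; the growth bound also makes it the only one.\<close>

lemma arg_min_on_dom: "arg_min_on f \<Theta> \<in> \<Theta>"
  and arg_min_on_growth: "u \<in> \<Theta> \<Longrightarrow>
    f (arg_min_on f \<Theta>) + c * (nrm p (diff_Rn u (arg_min_on f \<Theta>)))\<^sup>2 \<le> f u"
proof -
  obtain b where b: "b \<in> \<Theta>" "\<forall>u\<in>\<Theta>. f b \<le> f u" using ex_min by blast
  have *: "is_arg_min f (\<lambda>x. x \<in> \<Theta>) (arg_min_on f \<Theta>)"
    unfolding arg_min_on_def arg_min_def
    by (rule someI[of _ b]) (use b in \<open>auto simp: is_arg_min_linorder\<close>)
  then show dom: "arg_min_on f \<Theta> \<in> \<Theta>" by (simp add: is_arg_min_linorder)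
  show "f (arg_min_on f \<Theta>) + c * (nrm p (diff_Rn u (arg_min_on f \<Theta>)))\<^sup>2 \<le> f u" if "u \<in> \<Theta>"
    by (rule growth[OF dom _ that]) (use * in \<open>auto simp: is_arg_min_linorder\<close>)
qed

end

subsection \<open>Measurability of minimisers\<close>

text \<open>The minimisation over \<Theta> is to become a countable search. The sequence has to stay
  inside \<open>S\<close>, since the objective is controlled only there; so a point of
  \<open>S\<close> is picked in every basic open set that meets \<open>S\<close>.\<close>

lemma ex_dense_sequence:
  fixes S :: "'a::second_countable_topology set"
  assumes "S \<noteq> {}"
  shows "\<exists>d :: nat \<Rightarrow> 'a. range d \<subseteq> S \<and> S \<subseteq> closure (range d)"
proof -
  obtain B :: "'a set set" where B: "countable B" "topological_basis B" using ex_countable_basis by blast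
  have "\<forall>U. U \<inter> S \<noteq> {} \<longrightarrow> (\<exists>x. x \<in> U \<inter> S)" by blast
  then obtain g where g: "g U \<in> U \<inter> S" if "U \<inter> S \<noteq> {}" for U by metis
  define D where "D = g ` {U \<in> B. U \<inter> S \<noteq> {}}"
  have DS: "D \<subseteq> S" using g unfolding D_def by blast
  have cD: "countable D" unfolding D_def by (intro countable_image countable_subset[OF _ B(1)]) blast
  have dense: "S \<subseteq> closure D"
  proof
    fix x assume x: "x \<in> S"
    show "x \<in> closure D"
    proof (subst closure_iff_nhds_not_empty, intro allI impI)
      fix A V assume A: "V \<subseteq> A" "open V" "x \<in> V"
      obtain U where U: "U \<in> B" "x \<in> U" "U \<subseteq> V" using topological_basisE[OF B(2) A(2,3)] by blast
      then have US: "U \<inter> S \<noteq> {}" using x by blast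
      have "g U \<in> D" using U US unfolding D_def by blast
      moreover have "g U \<in> A" using g[OF US] U A by blast
      ultimately show "D \<inter> A \<noteq> {}" by blast
    qed
  qed
  then have "D \<noteq> {}" using assms by auto
  then have "range (from_nat_into D) = D" using cD by (rule range_from_nat_into)
  then show ?thesis using DS dense by metis
qed

text \<open>
  The minimiser is the limit of the first \<open>1/(k+1)\<close>-approximate minimisers in an enumeration of a countable
  dense subset; strong convexity forces them to converge.
\<close>

lemma borel_measurable_arg_min_on:
  fixes f :: "'a \<Rightarrow> (nat \<Rightarrow> real) \<Rightarrow> real"
  assumes sm: "\<And>\<omega>. \<omega> \<in> space N \<Longrightarrow> strong_min p \<Theta> (f \<omega>) c"
    and meas[measurable]: "\<And>b. b \<in> \<Theta> \<Longrightarrow> (\<lambda>\<omega>. f \<omega> b) \<in> borel_measurable N"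
    and ne: "\<Theta> \<noteq> {}"
  shows "(\<lambda>\<omega>. arg_min_on (f \<omega>) \<Theta>) \<in> borel_measurable N"
proof -
  obtain d :: "nat \<Rightarrow> nat \<Rightarrow> real" where d: "range d \<subseteq> \<Theta>" "\<Theta> \<subseteq> closure (range d)"
    using ex_dense_sequence[OF ne] by blast
  have dT: "d j \<in> \<Theta>" for j using d by auto
  have [measurable]: "(\<lambda>\<omega>. f \<omega> (d j)) \<in> borel_measurable N" for j by (rule meas[OF dT])
  \<comment> \<open>The comparison runs over the dense sequence and not against the minimum itself,
    so it is a countable conjunction of measurable conditions.\<close>
  define P where "P k j \<omega> \<longleftrightarrow> (\<forall>i. f \<omega> (d j) \<le> f \<omega> (d i) + 1 / Suc k)" for k j \<omega>
  have [measurable]: "Measurable.pred N (P k j)" for k j unfolding P_def by measurable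
  define e where "e k \<omega> = d (LEAST j. P k j \<omega>)" for k \<omega>
  have e_meas: "(\<lambda>\<omega>. e k \<omega> i) \<in> borel_measurable N" for k i
  proof -
    have "(\<lambda>\<omega>. LEAST j. P k j \<omega>) \<in> measurable N (count_space UNIV)" by measurable
    then show ?thesis unfolding e_def
      by (rule measurable_compose[where g = "\<lambda>j. d j i"]) simp
  qed
  have lim: "(\<lambda>k. e k \<omega> i) \<longlonglongrightarrow> arg_min_on (f \<omega>) \<Theta> i" if \<omega>: "\<omega> \<in> space N" for \<omega> i
  proof -
    interpret strong_min p \<Theta> "f \<omega>" c by (rule sm[OF \<omega>])
    let ?b = "arg_min_on (f \<omega>) \<Theta>"
    have near: "\<exists>j. f \<omega> (d j) < f \<omega> ?b + \<epsilon>" if "0 < \<epsilon>" for \<epsilon>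
    proof -
      have "?b \<in> closure (range d)" using d arg_min_on_dom by auto
      then obtain a where a: "\<And>k. a k \<in> range d" "a \<longlonglongrightarrow> ?b" unfolding closure_sequential by blast
      have "(\<lambda>k. f \<omega> (a k)) \<longlonglongrightarrow> f \<omega> ?b"
        by (rule f_cont) (use a d arg_min_on_dom in \<open>auto simp: tendsto_coordinatewise_iff\<close>)
      then have "\<forall>\<^sub>F k in sequentially. f \<omega> (a k) < f \<omega> ?b + \<epsilon>" using that by (intro order_tendstoD) auto
      then obtain k where "f \<omega> (a k) < f \<omega> ?b + \<epsilon>" by (auto simp: eventually_sequentially)
      then show ?thesis using a(1)[of k] by auto
    qed
    have le_all: "f \<omega> ?b \<le> f \<omega> u" if "u \<in> \<Theta>" for u
    proof -
      have "0 \<le> c * (nrm p (diff_Rn u ?b))\<^sup>2" using c_pos by simp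
      then show ?thesis using arg_min_on_growth[OF that] by linarith
    qed
    have close: "c * (nrm p (diff_Rn (e k \<omega>) ?b))\<^sup>2 \<le> 1 / Suc k" for k
    proof -
      obtain j where "f \<omega> (d j) < f \<omega> ?b + 1 / Suc k" using near[of "1 / Suc k"] by auto
      then have "P k j \<omega>" unfolding P_def using le_all[OF dT] by (meson add_right_mono less_imp_le order_trans)
      then have P: "P k (LEAST j. P k j \<omega>) \<omega>" by (rule LeastI)
      \<comment> \<open>The values at the \<open>d i\<close> come arbitrarily close to the minimum
        but may never attain it, so the comparison reaches \<open>?b\<close> only up to every
        \<epsilon>.\<close>
      have "f \<omega> (e k \<omega>) \<le> f \<omega> ?b + 1 / Suc k"
      proof (rule field_le_epsilon)
        fix \<epsilon> :: real assume "0 < \<epsilon>"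
        then obtain i where "f \<omega> (d i) < f \<omega> ?b + \<epsilon>" using near by blast
        moreover have "f \<omega> (e k \<omega>) \<le> f \<omega> (d i) + 1 / Suc k" using P unfolding P_def e_def by blast
        ultimately show "f \<omega> (e k \<omega>) \<le> f \<omega> ?b + 1 / Suc k + \<epsilon>" by linarith
      qed
      then show ?thesis using arg_min_on_growth[of "e k \<omega>"] dT by (simp add: e_def)
    qed
    show ?thesis
    proof (cases "i < p")
      case True
      have *: "(e k \<omega> i - ?b i)\<^sup>2 \<le> 1 / c * (1 / Suc k)" for k
      proof -
        have "\<bar>e k \<omega> i - ?b i\<bar>\<^sup>2 \<le> (nrm p (diff_Rn (e k \<omega>) ?b))\<^sup>2"
          using abs_coord_le_nrm[OF True, of "diff_Rn (e k \<omega>) ?b"] by (intro power_mono) auto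
        also have "\<dots> \<le> 1 / c * (1 / Suc k)" using close[of k] c_pos by (simp add: pos_le_divide_eq mult_ac del: of_nat_Suc)
        finally show ?thesis by simp
      qed
      have lim0: "(\<lambda>k. 1 / c * (1 / Suc k)) \<longlonglongrightarrow> 0"
        using tendsto_mult_right_zero[OF LIMSEQ_inverse_real_of_nat, of "1 / c"]
        unfolding inverse_eq_divide .
      have "(\<lambda>k. (e k \<omega> i - ?b i)\<^sup>2) \<longlonglongrightarrow> 0"
      proof (rule tendsto_sandwich[OF always_eventually always_eventually tendsto_const lim0])
        show "\<forall>k. (e k \<omega> i - ?b i)\<^sup>2 \<le> 1 / c * (1 / Suc k)" using * by blast
      qed simp
      then have "(\<lambda>k. e k \<omega> i - ?b i) \<longlonglongrightarrow> 0" by simp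
      then show ?thesis by (rule LIM_zero_cancel)
    next
      case False
      have "u i = 0" if "u \<in> \<Theta>" for u
        using False that dom_sub by (auto simp: Rn_iff)
      then have "e k \<omega> i = 0" "?b i = 0" for k
        using dT arg_min_on_dom by (auto simp: e_def)
      then show ?thesis by simp
    qed
  qed
  show ?thesis
  proof (rule measurable_coordinatewise_then_product)
    show "(\<lambda>\<omega>. arg_min_on (f \<omega>) \<Theta> i) \<in> borel_measurable N" for i
      by (rule borel_measurable_LIMSEQ_real[OF lim e_meas])
  qed
qed

text \<open>A Caratheodory function: rounding the second argument down to a grid of mesh 1/(k+1)
  leaves countably many sections, each measurable in the first argument, and continuity lets k tend
  to infinity.\<close>

lemma continuous_second_measurable:
  fixes l :: "real \<Rightarrow> real \<Rightarrow> real"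
  assumes [measurable]: "\<And>z. (\<lambda>y. l y z) \<in> borel_measurable borel"
    and cont: "\<And>y. continuous_on UNIV (l y)"
  shows "(\<lambda>(y, z). l y z) \<in> borel_measurable (borel \<Otimes>\<^sub>M borel)"
proof -
  define h :: "nat \<Rightarrow> real \<Rightarrow> real" where "h k z = of_int \<lfloor>real (Suc k) * z\<rfloor> / real (Suc k)" for k z
  have h_lim: "(\<lambda>k. h k z) \<longlonglongrightarrow> z" for z
  proof (rule tendsto_sandwich)
    show "(\<lambda>k. z - inverse (real (Suc k))) \<longlonglongrightarrow> z"
      using tendsto_diff[OF tendsto_const[of z] LIMSEQ_inverse_real_of_nat] by simp
    show "\<forall>\<^sub>F k in sequentially. z - inverse (real (Suc k)) \<le> h k z"
    proof (intro always_eventually allI)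
      fix k
      have "real (Suc k) * z - 1 \<le> of_int \<lfloor>real (Suc k) * z\<rfloor>" by linarith
      then have "(real (Suc k) * z - 1) / real (Suc k) \<le> h k z"
        unfolding h_def by (intro divide_right_mono) auto
      then show "z - inverse (real (Suc k)) \<le> h k z"
        by (simp add: diff_divide_distrib inverse_eq_divide del: of_nat_Suc)
    qed
    show "\<forall>\<^sub>F k in sequentially. h k z \<le> z"
    proof (intro always_eventually allI)
      fix k
      have "of_int \<lfloor>real (Suc k) * z\<rfloor> / real (Suc k) \<le> (real (Suc k) * z) / real (Suc k)"
        by (intro divide_right_mono of_int_floor_le) auto
      then show "h k z \<le> z" unfolding h_def by (simp del: of_nat_Suc)
    qed
  qed simp
  have meas: "(\<lambda>w. l (fst w) (h k (snd w))) \<in> borel_measurable (borel \<Otimes>\<^sub>M borel)" for k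
    unfolding h_def
  proof (rule measurable_compose_countable[where f = "\<lambda>(i::int) w. l (fst w) (of_int i / real (Suc k))"])
    show "(\<lambda>w::real \<times> real. l (fst w) (of_int i / real (Suc k))) \<in> borel_measurable (borel \<Otimes>\<^sub>M borel)" for i
      by (rule measurable_compose[OF measurable_fst assms(1)])
    show "(\<lambda>w::real \<times> real. \<lfloor>real (Suc k) * snd w\<rfloor>) \<in> measurable (borel \<Otimes>\<^sub>M borel) (count_space UNIV)"
      by (rule measurable_compose[OF _ measurable_real_floor])
        (intro borel_measurable_times borel_measurable_const measurable_snd)
  qed
  have "(\<lambda>k. l (fst w) (h k (snd w))) \<longlonglongrightarrow> l (fst w) (snd w)" for w
    by (rule continuous_on_tendsto_compose[OF cont h_lim]) auto
  then have "(\<lambda>w. l (fst w) (snd w)) \<in> borel_measurable (borel \<Otimes>\<^sub>M borel)"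
    by (intro borel_measurable_LIMSEQ_real[OF _ meas])
  then show ?thesis by (simp add: case_prod_beta')
qed

subsection \<open>Regularised empirical risk minimisation\<close>

type_synonym obs = "real \<times> (nat \<Rightarrow> real)"

lemma fst_obs_measurable: "(fst :: obs \<Rightarrow> real) \<in> borel_measurable borel"
  and snd_obs_measurable: "(snd :: obs \<Rightarrow> nat \<Rightarrow> real) \<in> borel_measurable borel"
  using measurable_fst[of "borel :: real measure" "borel :: (nat \<Rightarrow> real) measure"]
    measurable_snd[of "borel :: real measure" "borel :: (nat \<Rightarrow> real) measure"]
  by (simp_all only: borel_prod)

lemma smooth_convex_loss_facts:
  assumes "smooth_convex_loss l"
  shows smooth_convex_loss_nonneg: "0 \<le> l y z"
    and smooth_convex_loss_convex: "convex_on UNIV (l y)"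
    and smooth_convex_loss_deriv: "(l y has_real_derivative deriv (l y) z) (at z)"
    and smooth_convex_loss_continuous: "continuous_on UNIV (l y)"
    and smooth_convex_loss_measurable: "(\<lambda>(y, z). l y z) \<in> borel_measurable (borel \<Otimes>\<^sub>M borel)"
proof -
  show "0 \<le> l y z" "convex_on UNIV (l y)" using assms by (auto simp: smooth_convex_loss_def)
  have d: "(l y has_real_derivative deriv (l y) z) (at z)" for y z
  proof -
    have "l y C1_differentiable_on UNIV" using assms by (simp add: smooth_convex_loss_def)
    then obtain D where "(l y has_vector_derivative D z) (at z)"
      unfolding C1_differentiable_on_def by blast
    then have "(l y has_real_derivative D z) (at z)" by (simp add: has_real_derivative_iff_has_vector_derivative)
    then show ?thesis by (metis DERIV_imp_deriv)
  qed
  then show "(l y has_real_derivative deriv (l y) z) (at z)" .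
  have c: "continuous_on UNIV (l y)" for y
    by (intro continuous_at_imp_continuous_on ballI DERIV_isCont[OF d])
  then show "continuous_on UNIV (l y)" .
  show "(\<lambda>(y, z). l y z) \<in> borel_measurable (borel \<Otimes>\<^sub>M borel)"
    by (rule continuous_second_measurable) (use assms c in \<open>auto simp: smooth_convex_loss_def\<close>)
qed

text \<open>The derivative sits at the first point \<open>a\<close>. In the stability estimate this
  is the leave-one-out prediction, whose fit is independent of the deleted observation.\<close>

lemma smooth_convex_loss_tangent:
  assumes "smooth_convex_loss l"
  shows "l y a - l y b \<le> deriv (l y) a * (a - b)"
proof -
  have "deriv (l y) a * (b - a) \<le> l y b - l y a"
    by (rule convex_on_imp_above_tangent[of UNIV])
      (use smooth_convex_loss_facts[OF assms] in auto)
  then show ?thesis by (simp add: algebra_simps)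
qed

lemma dotp_measurable [measurable]: "(\<lambda>x. dotp p x b) \<in> borel_measurable borel"
  and dotp_measurable2 [measurable (raw)]:
    "\<lbrakk>u \<in> borel_measurable N; v \<in> borel_measurable N\<rbrakk> \<Longrightarrow> (\<lambda>\<omega>. dotp p (u \<omega>) (v \<omega>)) \<in> borel_measurable N"
proof -
  show *: "(\<lambda>\<omega>. dotp p (u \<omega>) (v \<omega>)) \<in> borel_measurable N"
    if "u \<in> borel_measurable N" "v \<in> borel_measurable N" for u v and N :: "'c measure"
    unfolding dotp_def
    by (intro borel_measurable_sum borel_measurable_times
        measurable_compose[OF that(1) measurable_product_coordinates]
        measurable_compose[OF that(2) measurable_product_coordinates])
  show "(\<lambda>x. dotp p x b) \<in> borel_measurable borel"
    unfolding dotp_def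
    by (intro borel_measurable_sum borel_measurable_times measurable_product_coordinates) auto
qed

lemma smooth_convex_loss_compose_measurable:
  assumes "smooth_convex_loss l" and "u \<in> borel_measurable N" "v \<in> borel_measurable N"
  shows "(\<lambda>\<omega>. l (u \<omega>) (v \<omega>)) \<in> borel_measurable N"
  using measurable_compose[OF measurable_Pair[OF assms(2,3)] smooth_convex_loss_measurable[OF assms(1)]]
  by simp

lemma nrm_measurable:
  assumes "u \<in> borel_measurable N'"
  shows "(\<lambda>\<omega>. nrm p (u \<omega>)) \<in> borel_measurable N'"
proof -
  have "(\<lambda>\<omega>. sqrt (dotp p (u \<omega>) (u \<omega>))) \<in> borel_measurable N'"
    using dotp_measurable2[OF assms assms] by simp
  then show ?thesis by (simp add: dotp_self L2_set_nonneg)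
qed

lemma deriv_measurable:
  assumes "smooth_convex_loss g" "u \<in> borel_measurable N'" "v \<in> borel_measurable N'"
  shows "(\<lambda>\<omega>. deriv (g (u \<omega>)) (v \<omega>)) \<in> borel_measurable N'"
proof (rule borel_measurable_LIMSEQ_real)
  let ?h = "\<lambda>i. inverse (real (Suc i))"
  show "(\<lambda>\<omega>. (g (u \<omega>) (v \<omega> + ?h i) - g (u \<omega>) (v \<omega>)) / ?h i) \<in> borel_measurable N'" for i
    by (intro borel_measurable_divide borel_measurable_diff borel_measurable_const borel_measurable_add
        smooth_convex_loss_compose_measurable[OF assms(1)] assms(2,3))
  fix \<omega>
  have "((\<lambda>h. (g (u \<omega>) (v \<omega> + h) - g (u \<omega>) (v \<omega>)) / h) \<longlongrightarrow> deriv (g (u \<omega>)) (v \<omega>)) (at 0)"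
    using smooth_convex_loss_deriv[OF assms(1), of "u \<omega>" "v \<omega>"] by (simp add: DERIV_def)
  moreover have "filterlim ?h (at 0) sequentially"
    unfolding filterlim_at using LIMSEQ_inverse_real_of_nat by (auto intro!: always_eventually)
  ultimately show "(\<lambda>i. (g (u \<omega>) (v \<omega> + ?h i) - g (u \<omega>) (v \<omega>)) / ?h i) \<longlonglongrightarrow> deriv (g (u \<omega>)) (v \<omega>)"
    by (rule filterlim_compose)
qed

lemma diff_measurable:
  assumes "u \<in> borel_measurable N'" "v \<in> borel_measurable N'"
  shows "(\<lambda>\<omega>. diff_Rn (u \<omega>) (v \<omega>)) \<in> borel_measurable N'"
  by (rule measurable_coordinatewise_then_product)
    (intro borel_measurable_diff measurable_compose[OF assms(1) measurable_product_coordinates]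
      measurable_compose[OF assms(2) measurable_product_coordinates])

locale erm =
  fixes p :: nat and \<Theta> :: "(nat \<Rightarrow> real) set" and l :: "real \<Rightarrow> real \<Rightarrow> real" and lam \<eta> :: real
    and r0 :: "(nat \<Rightarrow> real) \<Rightarrow> real"
  assumes lam_pos: "0 < lam" and eta_pos: "0 < \<eta>" and eta_less: "\<eta> < 1"
    and closed_Theta: "closedin (Euclidean_space p) \<Theta>" and convex_Theta: "convex_Rn \<Theta>"
    and Theta_ne: "\<Theta> \<noteq> {}"
    and r0_nonneg: "\<And>b. b \<in> Rn p \<Longrightarrow> 0 \<le> r0 b"
    and r0_convex: "convex_fun_Rn p r0" and r0_lipschitz: "lipschitz_fun_Rn p r0"
    and loss: "smooth_convex_loss l"
begin

definition obj :: "nat set \<Rightarrow> (nat \<Rightarrow> obs) \<Rightarrow> (nat \<Rightarrow> real) \<Rightarrow> real" where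
  "obj J z b = (\<Sum>j\<in>J. l (fst (z j)) (dotp p (snd (z j)) b)) + lam * enet_reg p \<eta> r0 b"

definition est :: "nat set \<Rightarrow> (nat \<Rightarrow> obs) \<Rightarrow> nat \<Rightarrow> real" where
  "est J z = arg_min_on (obj J z) \<Theta>"

lemma Theta_sub: "\<Theta> \<subseteq> Rn p"
  using closed_Theta closedin_subset by blast

lemma enet_nonneg: "b \<in> Rn p \<Longrightarrow> \<eta> * (nrm p b)\<^sup>2 \<le> enet_reg p \<eta> r0 b"
  using r0_nonneg[of b] eta_less by (simp add: enet_reg_def dotp_self)

lemma enet_strong:
  assumes "u \<in> Rn p" "v \<in> Rn p" "0 \<le> t" "t \<le> 1"
  shows "enet_reg p \<eta> r0 (segment_point t u v)
    \<le> (1 - t) * enet_reg p \<eta> r0 u + t * enet_reg p \<eta> r0 v - \<eta> * (t * (1 - t) * (nrm p (diff_Rn u v))\<^sup>2)"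
proof -
  have "r0 (segment_point t u v) \<le> (1 - t) * r0 u + t * r0 v"
    using r0_convex assms by (auto simp: convex_fun_Rn_def)
  then have "(1 - \<eta>) * r0 (segment_point t u v) \<le> (1 - \<eta>) * ((1 - t) * r0 u + t * r0 v)"
    using eta_less by (intro mult_left_mono) auto
  then show ?thesis unfolding enet_reg_def dotp_self_segment by (simp add: algebra_simps)
qed

lemma loss_segment:
  assumes "0 \<le> t" "t \<le> 1"
  shows "l y (dotp p x (segment_point t u v)) \<le> (1 - t) * l y (dotp p x u) + t * l y (dotp p x v)"
  unfolding dotp_segment
  using convex_onD[OF smooth_convex_loss_convex[OF loss], of t "dotp p x u" "dotp p x v" y] assms by simp

lemma obj_strong_min: "strong_min p \<Theta> (obj J z) (lam * \<eta>)"
proof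
  show "closedin (Euclidean_space p) \<Theta>" "convex_Rn \<Theta>" "\<Theta> \<noteq> {}" "0 < lam * \<eta>"
    using closed_Theta convex_Theta Theta_ne lam_pos eta_pos by auto
next
  fix u assume "u \<in> \<Theta>"
  then have "0 \<le> enet_reg p \<eta> r0 u"
    using enet_nonneg[of u] Theta_sub eta_pos by (meson mult_nonneg_nonneg less_imp_le order_trans subsetD zero_le_power2)
  then show "0 \<le> obj J z u"
    unfolding obj_def using lam_pos by (simp add: sum_nonneg smooth_convex_loss_nonneg[OF loss])
next
  fix u v t assume uv: "u \<in> \<Theta>" "v \<in> \<Theta>" and t: "0 \<le> t" "t \<le> (1::real)"
  have "(\<Sum>j\<in>J. l (fst (z j)) (dotp p (snd (z j)) (segment_point t u v)))
    \<le> (\<Sum>j\<in>J. (1 - t) * l (fst (z j)) (dotp p (snd (z j)) u) + t * l (fst (z j)) (dotp p (snd (z j)) v))"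
    by (intro sum_mono loss_segment t)
  also have "\<dots> = (1 - t) * (\<Sum>j\<in>J. l (fst (z j)) (dotp p (snd (z j)) u))
      + t * (\<Sum>j\<in>J. l (fst (z j)) (dotp p (snd (z j)) v))"
    by (simp only: sum.distrib sum_distrib_left)
  finally have "(\<Sum>j\<in>J. l (fst (z j)) (dotp p (snd (z j)) (segment_point t u v))) \<le> \<dots>" .
  moreover have "lam * enet_reg p \<eta> r0 (segment_point t u v) \<le> lam * ((1 - t) * enet_reg p \<eta> r0 u
      + t * enet_reg p \<eta> r0 v - \<eta> * (t * (1 - t) * (nrm p (diff_Rn u v))\<^sup>2))"
    using uv Theta_sub t lam_pos by (intro mult_left_mono enet_strong) auto
  ultimately show "obj J z (segment_point t u v)
    \<le> (1 - t) * obj J z u + t * obj J z v - lam * \<eta> * (t * (1 - t) * (nrm p (diff_Rn u v))\<^sup>2)"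
    unfolding obj_def by (simp add: algebra_simps)
next
  fix a b assume a: "\<And>k. a k \<in> \<Theta>" and b: "b \<in> \<Theta>" and lim: "\<And>i. (\<lambda>k. a k i) \<longlonglongrightarrow> b i"
  obtain L where L: "\<And>u v. u \<in> Rn p \<Longrightarrow> v \<in> Rn p \<Longrightarrow> \<bar>r0 u - r0 v\<bar> \<le> L * nrm p (diff_Rn u v)"
    using r0_lipschitz by (auto simp: lipschitz_fun_Rn_def)
  have "(\<lambda>k. L * nrm p (diff_Rn (a k) b)) \<longlonglongrightarrow> L * nrm p (\<lambda>i. b i - b i)"
    by (intro tendsto_mult_left nrm_tendsto tendsto_diff lim tendsto_const)
  then have z: "(\<lambda>k. L * nrm p (diff_Rn (a k) b)) \<longlonglongrightarrow> 0" by (simp add: L2_set_def)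
  have "(\<lambda>k. r0 (a k) - r0 b) \<longlonglongrightarrow> 0"
  proof (rule Lim_null_comparison[OF always_eventually z], rule allI)
    show "norm (r0 (a k) - r0 b) \<le> L * nrm p (diff_Rn (a k) b)" for k
      using L[of "a k" b] a b Theta_sub by auto
  qed
  then have r: "(\<lambda>k. r0 (a k)) \<longlonglongrightarrow> r0 b" by (rule LIM_zero_cancel)
  have "(\<lambda>k. l y (dotp p x (a k))) \<longlonglongrightarrow> l y (dotp p x b)" for y x
    by (rule continuous_on_tendsto_compose[OF smooth_convex_loss_continuous[OF loss] dotp_tendsto[OF lim]]) auto
  then show "(\<lambda>k. obj J z (a k)) \<longlonglongrightarrow> obj J z b"
    unfolding obj_def enet_reg_def dotp_self by (intro tendsto_intros r nrm_tendsto lim)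
qed

lemma est_in_Theta: "est J z \<in> \<Theta>"
  unfolding est_def by (rule strong_min.arg_min_on_dom[OF obj_strong_min])

lemma est_in_Rn: "est J z \<in> Rn p"
  using est_in_Theta Theta_sub by blast

lemma est_growth:
  "u \<in> \<Theta> \<Longrightarrow> obj J z (est J z) + lam * \<eta> * (nrm p (diff_Rn u (est J z)))\<^sup>2 \<le> obj J z u"
  unfolding est_def by (rule strong_min.arg_min_on_growth[OF obj_strong_min])

text \<open>Each fit is tested against the other and the two growth inequalities are added: the
  penalty and all common observations cancel, only the loss of observation \<open>i\<close> remains,
  and the two quadratic terms add up to the factor 2. Convexity and Cauchy-Schwarz bound that loss
  difference by a multiple of \<open>nrm p ?D\<close>, one factor of which cancels.\<close>

lemma est_stability:
  assumes "finite J" "i \<in> J"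
  shows "2 * (lam * \<eta>) * nrm p (diff_Rn (est J z) (est (J - {i}) z))
    \<le> \<bar>deriv (l (fst (z i))) (dotp p (snd (z i)) (est (J - {i}) z))\<bar> * nrm p (snd (z i))"
    (is "?c * nrm p ?D \<le> \<bar>?d\<bar> * ?x")
proof -
  let ?b = "est J z" and ?b' = "est (J - {i}) z" and ?y = "fst (z i)"
  have split: "obj J z u = l ?y (dotp p (snd (z i)) u) + obj (J - {i}) z u" for u
    unfolding obj_def using assms by (subst sum.remove[of J i]) auto
  have D: "nrm p (diff_Rn ?b' ?b) = nrm p ?D" by (simp add: L2_set_def power2_commute)
  have "?c * (nrm p ?D)\<^sup>2 \<le> l ?y (dotp p (snd (z i)) ?b') - l ?y (dotp p (snd (z i)) ?b)"
    using est_growth[OF est_in_Theta[of "J - {i}" z], of J z] est_growth[OF est_in_Theta[of J z], of "J - {i}" z]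
    unfolding split D by linarith
  also have "\<dots> \<le> ?d * (dotp p (snd (z i)) ?b' - dotp p (snd (z i)) ?b)"
    by (rule smooth_convex_loss_tangent[OF loss])
  also have "\<dots> = ?d * dotp p (snd (z i)) (diff_Rn ?b' ?b)" by (simp add: dotp_diff_right)
  also have "\<dots> \<le> \<bar>?d\<bar> * \<bar>dotp p (snd (z i)) (diff_Rn ?b' ?b)\<bar>" by (simp flip: abs_mult)
  also have "\<dots> \<le> \<bar>?d\<bar> * (?x * nrm p ?D)"
    using abs_dotp_le[of p "snd (z i)" "diff_Rn ?b' ?b"] D by (intro mult_left_mono) auto
  finally have *: "nrm p ?D * (?c * nrm p ?D) \<le> nrm p ?D * (\<bar>?d\<bar> * ?x)"
    by (simp add: power2_eq_square mult_ac)
  show ?thesis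
  proof (cases "nrm p ?D = 0")
    case True
    then show ?thesis by (simp add: L2_set_nonneg)
  next
    case False
    then have "0 < nrm p ?D" using L2_set_nonneg[of ?D "{..<p}"] by linarith
    then show ?thesis using * by (simp only: mult_le_cancel_left_pos)
  qed
qed

text \<open>With a fixed competitor \<open>b\<close> the right-hand side involves the data only
  through losses at \<open>b\<close>, so the size of the fit is bounded by quantities in which the
  fit does not occur.\<close>

lemma est_norm_bound:
  assumes "b \<in> \<Theta>"
  shows "lam * \<eta> * (nrm p (est J z))\<^sup>2
    \<le> (\<Sum>j\<in>J. l (fst (z j)) (dotp p (snd (z j)) b)) + lam * enet_reg p \<eta> r0 b"
proof -
  have "lam * (\<eta> * (nrm p (est J z))\<^sup>2) \<le> lam * enet_reg p \<eta> r0 (est J z)"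
    using lam_pos by (intro mult_left_mono enet_nonneg est_in_Rn) auto
  also have "\<dots> \<le> obj J z (est J z)"
    unfolding obj_def by (simp add: sum_nonneg smooth_convex_loss_nonneg[OF loss])
  also have "\<dots> \<le> obj J z (est J z) + lam * \<eta> * (nrm p (diff_Rn b (est J z)))\<^sup>2"
    using lam_pos eta_pos by simp
  also have "\<dots> \<le> obj J z b" by (rule est_growth[OF assms])
  finally show ?thesis by (simp add: obj_def mult.assoc)
qed

lemma est_cong: "(\<And>j. j \<in> J \<Longrightarrow> z j = z' j) \<Longrightarrow> est J z = est J z'"
  unfolding est_def obj_def by (simp cong: sum.cong)

text \<open>\<open>I\<close> may exceed \<open>J\<close>, so that fits on different subsets live on
  one product space and can be compared there.\<close>

lemma est_measurable:
  assumes "J \<subseteq> I"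
  shows "est J \<in> borel_measurable (Pi\<^sub>M I (\<lambda>_. borel))"
  unfolding est_def
proof (rule borel_measurable_arg_min_on[OF obj_strong_min _ Theta_ne])
  fix b
  show "(\<lambda>z. obj J z b) \<in> borel_measurable (Pi\<^sub>M I (\<lambda>_. borel))"
    unfolding obj_def
  proof (intro borel_measurable_add borel_measurable_sum borel_measurable_const)
    fix j assume "j \<in> J"
    then have "(\<lambda>z::nat \<Rightarrow> obs. z j) \<in> borel_measurable (Pi\<^sub>M I (\<lambda>_. borel))"
      using assms by (intro measurable_component_singleton) auto
    then have "(\<lambda>z::nat \<Rightarrow> obs. z j) \<in> measurable (Pi\<^sub>M I (\<lambda>_. borel)) (borel \<Otimes>\<^sub>M borel)"
      by (simp add: borel_prod)
    then show "(\<lambda>z. l (fst (z j)) (dotp p (snd (z j)) b)) \<in> borel_measurable (Pi\<^sub>M I (\<lambda>_. borel))"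
      by (intro smooth_convex_loss_compose_measurable[OF loss])
        (auto intro: measurable_compose[OF _ dotp_measurable] measurable_compose[OF _ measurable_fst]
          measurable_compose[OF _ measurable_snd])
  qed
qed

lemma estimator_eq_est:
  "estimator p \<Theta> l lam (enet_reg p \<eta> r0) J (\<lambda>j. fst (z j)) (\<lambda>j. snd (z j)) = est J z"
  unfolding estimator_def est_def obj_def ..

end

subsection \<open>The largest singular value bounds the quadratic form\<close>

text \<open>Tychonoff: coordinates of the sphere lie in [-1, 1] below \<open>p\<close> and in {0}
  from \<open>p\<close> on, and the sphere is closed in this product.\<close>

lemma compact_unit_sphere_Rn: "compact {u \<in> Rn p. nrm p u = 1}" (is "compact ?K")
proof -
  let ?B = "PiE UNIV (\<lambda>i. if i < p then {-1..1} else {0::real})"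
  have "compactin (product_topology (\<lambda>i::nat. euclidean :: real topology) UNIV) ?B"
    by (subst compactin_PiE) auto
  then have B: "compact ?B" by (simp add: euclidean_product_topology)
  have cont: "continuous_on UNIV (nrm p)"
    unfolding L2_set_def by (intro continuous_intros continuous_on_product_coordinates)
  have "closed (Rn p)"
    by (rule closedin_Euclidean_imp_closed[of p]) simp
  moreover have "closed {u. nrm p u = 1}"
    by (rule closed_Collect_eq[OF cont]) auto
  ultimately have "closed (Rn p \<inter> {u. nrm p u = 1})" by (rule closed_Int)
  moreover have "?K = Rn p \<inter> {u. nrm p u = 1}" by auto
  ultimately have cl: "closed ?K" by simp
  have "?K \<subseteq> ?B"
  proof
    fix u assume u: "u \<in> ?K"
    have "-1 \<le> u i \<and> u i \<le> 1" if "i < p" for i using abs_coord_le_nrm[OF that, of u] u by auto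
    then show "u \<in> ?B" using u by (auto simp: PiE_iff Rn_iff)
  qed
  then have "?K = ?B \<inter> ?K" by blast
  then show ?thesis using compact_Int_closed[OF B cl] by simp
qed

lemma quad_form_add:
  assumes S: "S \<in> carrier_mat p p" "transpose_mat S = S"
  shows "quad_form p S (\<lambda>i. v i + \<epsilon> * w i)
    = quad_form p S v + 2 * \<epsilon> * dotp p w (\<lambda>i. \<Sum>j<p. S $$ (i, j) * v j) + \<epsilon>\<^sup>2 * quad_form p S w"
proof -
  have sym: "S $$ (i, j) = S $$ (j, i)" if "i < p" "j < p" for i j
    using S that by (metis carrier_matD index_transpose_mat(1))
  have "(\<Sum>i<p. \<Sum>j<p. v i * S $$ (i, j) * w j) = (\<Sum>j<p. \<Sum>i<p. v i * S $$ (i, j) * w j)"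
    by (rule sum.swap)
  also have "\<dots> = (\<Sum>j<p. \<Sum>i<p. w j * (S $$ (j, i) * v i))"
    by (intro sum.cong) (auto simp: sym mult_ac)
  also have "\<dots> = dotp p w (\<lambda>i. \<Sum>j<p. S $$ (i, j) * v j)" by (simp add: dotp_def sum_distrib_left)
  finally have vw: "(\<Sum>i<p. \<Sum>j<p. v i * S $$ (i, j) * w j) = dotp p w (\<lambda>i. \<Sum>j<p. S $$ (i, j) * v j)" .
  have wv: "(\<Sum>i<p. \<Sum>j<p. w i * S $$ (i, j) * v j) = dotp p w (\<lambda>i. \<Sum>j<p. S $$ (i, j) * v j)"
    by (simp add: dotp_def sum_distrib_left mult_ac)
  have "quad_form p S (\<lambda>i. v i + \<epsilon> * w i) = (\<Sum>i<p. \<Sum>j<p. v i * S $$ (i, j) * v j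
      + (\<epsilon> * (v i * S $$ (i, j) * w j) + (\<epsilon> * (w i * S $$ (i, j) * v j) + \<epsilon>\<^sup>2 * (w i * S $$ (i, j) * w j))))"
    unfolding quad_form_def by (intro sum.cong refl) (simp add: algebra_simps power2_eq_square)
  also have "\<dots> = quad_form p S v + (\<epsilon> * dotp p w (\<lambda>i. \<Sum>j<p. S $$ (i, j) * v j)
      + (\<epsilon> * dotp p w (\<lambda>i. \<Sum>j<p. S $$ (i, j) * v j) + \<epsilon>\<^sup>2 * quad_form p S w))"
    by (simp only: sum.distrib vw wv quad_form_def flip: sum_distrib_left)
  finally show ?thesis by simp
qed

lemma quad_form_scale: "quad_form p S (\<lambda>i. c * u i) = c\<^sup>2 * quad_form p S u"
  by (simp add: quad_form_def sum_distrib_left power2_eq_square mult_ac)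

lemma nrm_sq_add: "(nrm p (\<lambda>i. v i + \<epsilon> * w i))\<^sup>2 = (nrm p v)\<^sup>2 + 2 * \<epsilon> * dotp p w v + \<epsilon>\<^sup>2 * (nrm p w)\<^sup>2"
  unfolding dotp_self[symmetric] dotp_def sum_distrib_left sum.distrib[symmetric]
  by (intro sum.cong refl) (simp add: algebra_simps power2_eq_square)

text \<open>
  A maximiser \<open>v\<close> of the quadratic form on the unit sphere is an eigenvector of \<open>S\<close>: otherwise
  moving along \<open>m v - S v\<close> would increase the Rayleigh quotient.
\<close>

lemma quad_form_le_sigma_max:
  assumes S: "S \<in> carrier_mat p p" "transpose_mat S = S"
    and psd: "\<And>u. u \<in> Rn p \<Longrightarrow> 0 \<le> quad_form p S u"
    and p: "0 < p" and t: "t \<in> Rn p"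
  shows "quad_form p S t \<le> sigma_max S * (nrm p t)\<^sup>2"
proof -
  let ?K = "{u \<in> Rn p. nrm p u = 1}"
  have "(\<lambda>i. if i = 0 then 1 else 0) \<in> ?K"
    using p by (auto simp: Rn_iff L2_set_def if_distrib[of "\<lambda>x. x\<^sup>2"] sum.delta cong: if_cong)
  then have ne: "?K \<noteq> {}" by blast
  have "continuous_on ?K (quad_form p S)"
    unfolding quad_form_def
    by (intro continuous_intros continuous_on_subset[OF continuous_on_product_coordinates]) auto
  then obtain v where v: "v \<in> ?K" and vmax: "\<And>u. u \<in> ?K \<Longrightarrow> quad_form p S u \<le> quad_form p S v"
    using continuous_attains_sup[OF compact_unit_sphere_Rn ne] by blast
  define m where "m = quad_form p S v"
  have m0: "0 \<le> m" unfolding m_def using psd v by blast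
  \<comment> \<open>\<open>B\<close> is a quadratic form, nonnegative on \<open>Rn p\<close>, that
    vanishes at \<open>v\<close>, so its first variation at \<open>v\<close> must vanish too; the
    direction \<open>w\<close> below is, up to a factor, its gradient.\<close>
  define B where "B u = m * (nrm p u)\<^sup>2 - quad_form p S u" for u
  have B_nonneg: "0 \<le> B u" if u: "u \<in> Rn p" for u
  proof (cases "nrm p u = 0")
    case True
    then have "u i = 0" if "i < p" for i using abs_coord_le_nrm[OF that, of u] by simp
    then show ?thesis unfolding B_def True by (simp add: quad_form_def)
  next
    case False
    define w where "w = (\<lambda>i. (1 / nrm p u) * u i)"
    have "nrm p w = 1" unfolding w_def nrm_scale using False by (simp add: L2_set_nonneg)
    then have "w \<in> ?K" using u by (auto simp: w_def Rn_iff)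
    then have "(1 / nrm p u)\<^sup>2 * quad_form p S u \<le> m"
      using vmax[of w] by (simp only: m_def w_def quad_form_scale)
    then show ?thesis using False by (simp add: B_def field_simps)
  qed
  define Sv where "Sv = (\<lambda>i. \<Sum>j<p. S $$ (i, j) * v j)"
  define w where "w = (\<lambda>i. if i < p then m * v i - Sv i else 0)"
  have w: "w \<in> Rn p" by (simp add: w_def Rn_iff)
  have "m * dotp p w v - dotp p w Sv = dotp p w w"
    unfolding dotp_def sum_distrib_left sum_subtractf[symmetric]
    by (intro sum.cong refl) (simp add: w_def algebra_simps)
  then have dw: "m * dotp p w v - dotp p w Sv = (nrm p w)\<^sup>2" by (simp only: dotp_self)
  have Bv: "B v = 0" using v by (simp add: B_def m_def)
  have expand: "B (\<lambda>i. v i + \<epsilon> * w i) = 2 * \<epsilon> * (nrm p w)\<^sup>2 + \<epsilon>\<^sup>2 * B w" for \<epsilon>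
    using Bv unfolding B_def quad_form_add[OF S] nrm_sq_add dw[symmetric] Sv_def by (simp add: algebra_simps)
  have pos: "0 \<le> 2 * \<epsilon> * (nrm p w)\<^sup>2 + \<epsilon>\<^sup>2 * B w" for \<epsilon>
    unfolding expand[symmetric] by (rule B_nonneg) (use v w in \<open>auto simp: Rn_iff\<close>)
  have w0: "nrm p w = 0"
  proof -
    let ?a = "(nrm p w)\<^sup>2" and ?c = "B w + 1"
    have c: "0 < ?c" using B_nonneg[OF w] by simp
    \<comment> \<open>This step makes the quadratic in \<epsilon> negative unless
      \<open>?a = 0\<close>. The denominator is \<open>B w + 1\<close> because \<open>B w\<close>
      may be 0.\<close>
    define \<epsilon> where "\<epsilon> = - ?a / ?c"
    have \<epsilon>: "\<epsilon> * ?c = - ?a" using c by (simp add: \<epsilon>_def)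
    have "0 \<le> ?c\<^sup>2 * (2 * \<epsilon> * ?a + \<epsilon>\<^sup>2 * B w)"
      by (intro mult_nonneg_nonneg pos) auto
    also have "\<dots> = 2 * (\<epsilon> * ?c) * ?a * ?c + (\<epsilon> * ?c)\<^sup>2 * B w"
      by (simp add: power2_eq_square algebra_simps)
    also have "\<dots> = - (?a\<^sup>2 * (B w + 2))" unfolding \<epsilon> by (simp add: algebra_simps power2_eq_square)
    finally have "?a\<^sup>2 * (B w + 2) \<le> 0" by simp
    moreover have "?a\<^sup>2 * 1 \<le> ?a\<^sup>2 * (B w + 2)" using B_nonneg[OF w] by (intro mult_left_mono) auto
    ultimately have "?a\<^sup>2 \<le> 0" by linarith
    then show ?thesis by simp
  qed
  have Sv_eq: "Sv i = m * v i" if "i < p" for i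
    using abs_coord_le_nrm[OF that, of w] w0 that by (simp add: w_def)
  let ?v = "vec p v"
  have "S *\<^sub>v ?v = m \<cdot>\<^sub>v ?v"
  proof (rule eq_vecI)
    show "(S *\<^sub>v ?v) $ i = (m \<cdot>\<^sub>v ?v) $ i" if "i < dim_vec (m \<cdot>\<^sub>v ?v)" for i
      using that S(1) Sv_eq[of i] by (simp add: scalar_prod_def Sv_def lessThan_atLeast0)
  qed (use S in simp)
  \<comment> \<open>As \<open>S\<close> is symmetric, the eigenvalue \<open>m\<close> of
    \<open>S\<close> gives the eigenvalue \<open>m\<^sup>2\<close> of \<open>S\<^sup>T S\<close>;
    nonnegativity of \<open>m\<close> then makes \<open>m\<close> itself a singular value.\<close>
  then have "(transpose_mat S * S) *\<^sub>v ?v = m\<^sup>2 \<cdot>\<^sub>v ?v"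
    using S by (simp add: assoc_mult_mat_vec[of S p p S p] mult_mat_vec[of S p p] smult_smult_assoc power2_eq_square)
  moreover have "?v \<noteq> 0\<^sub>v p"
  proof
    assume "?v = 0\<^sub>v p"
    then have "v i = 0" if "i < p" for i using that by (metis index_vec index_zero_vec(1))
    then show False using v by (simp add: L2_set_def)
  qed
  ultimately have "eigenvalue (transpose_mat S * S) (m\<^sup>2)"
    unfolding eigenvalue_def eigenvector_def using S by (intro exI[of _ ?v]) auto
  then have m_sing: "m \<in> singular_values S" using m0 by (simp add: singular_values_def)
  \<comment> \<open>\<open>sigma_max\<close> is a \<open>Max\<close>, which dominates the members of
    the set only once the set is known to be finite.\<close>
  have "finite (spectrum (transpose_mat S * S))"
    using S by (intro card_finite_spectrum(1)[of _ p]) auto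
  then have "finite (sqrt ` spectrum (transpose_mat S * S))" by (rule finite_imageI)
  moreover have "singular_values S \<subseteq> sqrt ` spectrum (transpose_mat S * S)"
  proof
    fix \<sigma> assume "\<sigma> \<in> singular_values S"
    then show "\<sigma> \<in> sqrt ` spectrum (transpose_mat S * S)"
      by (intro image_eqI[of _ _ "\<sigma>\<^sup>2"]) (auto simp: singular_values_def spectrum_def)
  qed
  ultimately have "finite (singular_values S)" by (rule finite_subset[rotated])
  then have "m \<le> sigma_max S" unfolding sigma_max_def using m_sing by (rule Max_ge)
  then have "m * (nrm p t)\<^sup>2 \<le> sigma_max S * (nrm p t)\<^sup>2" by (intro mult_right_mono) auto
  then show ?thesis using B_nonneg[OF t] by (simp add: B_def)
qed

subsection \<open>Explicit moment bounds\<close>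

text \<open>
  The moment bounds are transformed by explicit operations that do not see the probability space, so the final
  constant depends only on the parameters from which it is built. Bounding \<open>|f g|\<^sup>m \<le> f\<^bsup>2m\<^esup> + g\<^bsup>2m\<^esup>\<close> avoids
  Hoelder's inequality.
\<close>

definition bmom :: "'w measure \<Rightarrow> ('w \<Rightarrow> real) \<Rightarrow> (nat \<Rightarrow> real) \<Rightarrow> bool" where
  "bmom M f K \<longleftrightarrow> f \<in> borel_measurable M \<and>
     (\<forall>m. integrable M (\<lambda>\<omega>. \<bar>f \<omega>\<bar> ^ m) \<and> (\<integral>\<omega>. \<bar>f \<omega>\<bar> ^ m \<partial>M) \<le> K m)"

lemma bmom_measurable: "bmom M f K \<Longrightarrow> f \<in> borel_measurable M"
  and bmom_integrable: "bmom M f K \<Longrightarrow> integrable M (\<lambda>\<omega>. \<bar>f \<omega>\<bar> ^ m)"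
  and bmom_le: "bmom M f K \<Longrightarrow> (\<integral>\<omega>. \<bar>f \<omega>\<bar> ^ m \<partial>M) \<le> K m"
  by (auto simp: bmom_def)

lemma bmom_const_nonneg: "bmom M f K \<Longrightarrow> 0 \<le> K m"
  by (rule order_trans[OF _ bmom_le]) simp

lemma bmom_integrable1: "bmom M f K \<Longrightarrow> integrable M f"
  using bmom_integrable[of M f K 1] bmom_measurable[of M f K] by (simp add: integrable_abs_iff)

lemma bmom_integrable2: "bmom M f K \<Longrightarrow> integrable M (\<lambda>\<omega>. (f \<omega>)\<^sup>2)"
  using bmom_integrable[of M f K 2] by simp

lemma bmom_le2: "bmom M f K \<Longrightarrow> (\<integral>\<omega>. (f \<omega>)\<^sup>2 \<partial>M) \<le> K 2"
  using bmom_le[of M f K 2] by simp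

lemma bmom_dominated:
  assumes f: "f \<in> borel_measurable M"
    and g: "\<And>m. integrable M (g m)" "\<And>m. (\<integral>\<omega>. g m \<omega> \<partial>M) \<le> K m"
    and le: "\<And>m \<omega>. \<omega> \<in> space M \<Longrightarrow> \<bar>f \<omega>\<bar> ^ m \<le> g m \<omega>"
  shows "bmom M f K"
  unfolding bmom_def
proof (intro conjI allI f)
  fix m
  have [measurable]: "f \<in> borel_measurable M" by (rule f)
  show i: "integrable M (\<lambda>\<omega>. \<bar>f \<omega>\<bar> ^ m)"
    by (rule Bochner_Integration.integrable_bound[OF g(1)[of m]])
      (auto intro!: AE_I2 order_trans[OF le])
  have "(\<integral>\<omega>. \<bar>f \<omega>\<bar> ^ m \<partial>M) \<le> (\<integral>\<omega>. g m \<omega> \<partial>M)"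
    by (rule integral_mono[OF i g(1) le])
  then show "(\<integral>\<omega>. \<bar>f \<omega>\<bar> ^ m \<partial>M) \<le> K m" using g(2)[of m] by linarith
qed

lemma bmom_mono:
  assumes "bmom M g K" "f \<in> borel_measurable M" "\<And>\<omega>. \<omega> \<in> space M \<Longrightarrow> \<bar>f \<omega>\<bar> \<le> \<bar>g \<omega>\<bar>"
  shows "bmom M f K"
  by (rule bmom_dominated[where g = "\<lambda>m \<omega>. \<bar>g \<omega>\<bar> ^ m"])
    (use assms in \<open>auto intro: bmom_integrable bmom_le power_mono\<close>)

definition kconst :: "real \<Rightarrow> nat \<Rightarrow> real" where "kconst c m = \<bar>c\<bar> ^ m"
text \<open>The power of 2 comes from \<open>|f + g| \<le> 2 max |f| |g|\<close>.\<close>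

definition kadd :: "(nat \<Rightarrow> real) \<Rightarrow> (nat \<Rightarrow> real) \<Rightarrow> nat \<Rightarrow> real" where
  "kadd K L m = 2 ^ m * (K m + L m)"
definition kmul :: "(nat \<Rightarrow> real) \<Rightarrow> (nat \<Rightarrow> real) \<Rightarrow> nat \<Rightarrow> real" where
  "kmul K L m = K (2 * m) + L (2 * m)"
definition kscale :: "real \<Rightarrow> (nat \<Rightarrow> real) \<Rightarrow> nat \<Rightarrow> real" where
  "kscale c K m = \<bar>c\<bar> ^ m * K m"
definition kpow :: "nat \<Rightarrow> (nat \<Rightarrow> real) \<Rightarrow> nat \<Rightarrow> real" where
  "kpow N K m = K (N * m)"
text \<open>For \<open>x\<close> Gaussian with covariance at most \<open>c / p\<close> and an
  independent vector \<open>b\<close> whose norm has moments \<open>K\<close>: given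
  \<open>b\<close>, the form \<open>sqrt p x\<^sup>T b\<close> is normal with standard deviation at
  most \<open>sqrt c |b|\<close>, and averaging over \<open>b\<close> gives the product.\<close>

definition kgauss :: "real \<Rightarrow> (nat \<Rightarrow> real) \<Rightarrow> nat \<Rightarrow> real" where
  "kgauss c K m = sqrt c ^ m * (\<integral>z. \<bar>z\<bar> ^ m \<partial>std_normal_distribution) * K m"

lemma (in prob_space) bmom_const: "bmom M (\<lambda>_. c) (kconst c)"
  by (auto simp: bmom_def kconst_def prob_space)

lemma bmom_add:
  assumes "bmom M f K" "bmom M g L"
  shows "bmom M (\<lambda>\<omega>. f \<omega> + g \<omega>) (kadd K L)"
proof (rule bmom_dominated[where g = "\<lambda>m \<omega>. 2 ^ m * (\<bar>f \<omega>\<bar> ^ m + \<bar>g \<omega>\<bar> ^ m)"])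
  show "(\<lambda>\<omega>. f \<omega> + g \<omega>) \<in> borel_measurable M"
    using assms by (intro borel_measurable_add bmom_measurable)
  fix m
  show "integrable M (\<lambda>\<omega>. 2 ^ m * (\<bar>f \<omega>\<bar> ^ m + \<bar>g \<omega>\<bar> ^ m))"
    using assms by (intro integrable_mult_right Bochner_Integration.integrable_add bmom_integrable)
  show "(\<integral>\<omega>. 2 ^ m * (\<bar>f \<omega>\<bar> ^ m + \<bar>g \<omega>\<bar> ^ m) \<partial>M) \<le> kadd K L m"
    using assms bmom_le[of M f K m] bmom_le[of M g L m]
    by (simp add: kadd_def bmom_integrable)
  fix \<omega>
  have "\<bar>f \<omega> + g \<omega>\<bar> \<le> 2 * max \<bar>f \<omega>\<bar> \<bar>g \<omega>\<bar>" by linarith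
  then have "\<bar>f \<omega> + g \<omega>\<bar> ^ m \<le> (2 * max \<bar>f \<omega>\<bar> \<bar>g \<omega>\<bar>) ^ m" by (rule power_mono) simp
  also have "\<dots> \<le> 2 ^ m * (\<bar>f \<omega>\<bar> ^ m + \<bar>g \<omega>\<bar> ^ m)"
    by (auto simp: power_mult_distrib max_def)
  finally show "\<bar>f \<omega> + g \<omega>\<bar> ^ m \<le> 2 ^ m * (\<bar>f \<omega>\<bar> ^ m + \<bar>g \<omega>\<bar> ^ m)" .
qed

lemma bmom_mult:
  assumes "bmom M f K" "bmom M g L"
  shows "bmom M (\<lambda>\<omega>. f \<omega> * g \<omega>) (kmul K L)"
proof (rule bmom_dominated[where g = "\<lambda>m \<omega>. \<bar>f \<omega>\<bar> ^ (2 * m) + \<bar>g \<omega>\<bar> ^ (2 * m)"])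
  show "(\<lambda>\<omega>. f \<omega> * g \<omega>) \<in> borel_measurable M"
    using assms by (intro borel_measurable_times bmom_measurable)
  fix m
  show "integrable M (\<lambda>\<omega>. \<bar>f \<omega>\<bar> ^ (2 * m) + \<bar>g \<omega>\<bar> ^ (2 * m))"
    using assms by (intro Bochner_Integration.integrable_add bmom_integrable)
  show "(\<integral>\<omega>. \<bar>f \<omega>\<bar> ^ (2 * m) + \<bar>g \<omega>\<bar> ^ (2 * m) \<partial>M) \<le> kmul K L m"
    using assms bmom_le[of M f K "2 * m"] bmom_le[of M g L "2 * m"]
    by (subst Bochner_Integration.integral_add) (auto simp: kmul_def intro: bmom_integrable)
  fix \<omega>
  have xy: "x * y \<le> x\<^sup>2 + y\<^sup>2" for x y :: real
  proof -
    have "2 * (x * y) \<le> x\<^sup>2 + y\<^sup>2" using sum_squares_bound[of x y] by (simp add: mult.assoc)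
    then show ?thesis using zero_le_power2[of x] zero_le_power2[of y] by linarith
  qed
  show "\<bar>f \<omega> * g \<omega>\<bar> ^ m \<le> \<bar>f \<omega>\<bar> ^ (2 * m) + \<bar>g \<omega>\<bar> ^ (2 * m)"
    using xy[of "\<bar>f \<omega>\<bar> ^ m" "\<bar>g \<omega>\<bar> ^ m"]
    by (simp only: abs_mult power_mult_distrib power_even_eq)
qed

lemma bmom_scale:
  assumes "bmom M f K"
  shows "bmom M (\<lambda>\<omega>. c * f \<omega>) (kscale c K)"
  unfolding bmom_def
  using bmom_measurable[OF assms] bmom_integrable[OF assms] bmom_le[OF assms]
  by (auto simp: abs_mult power_mult_distrib kscale_def intro!: mult_left_mono)

lemma bmom_power:
  assumes "bmom M f K"
  shows "bmom M (\<lambda>\<omega>. f \<omega> ^ N) (kpow N K)"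
  unfolding bmom_def
  using bmom_measurable[OF assms] bmom_integrable[OF assms] bmom_le[OF assms]
  by (auto simp: power_abs kpow_def simp flip: power_mult)

lemma bmom_abs: "bmom M f K \<Longrightarrow> bmom M (\<lambda>\<omega>. \<bar>f \<omega>\<bar>) K"
  by (rule bmom_mono) (auto intro: borel_measurable_abs bmom_measurable)

lemma convex_on_power_nonneg: "convex_on {0::real..} (\<lambda>x. x ^ m)"
  by (cases "even m") (auto intro: convex_on_subset[OF convex_power_even] convex_power_odd)

lemma average_power_le:
  fixes a :: "'i \<Rightarrow> real"
  assumes "finite I" "I \<noteq> {}" "\<And>i. i \<in> I \<Longrightarrow> 0 \<le> a i"
  shows "((\<Sum>i\<in>I. a i) / card I) ^ m \<le> (\<Sum>i\<in>I. a i ^ m) / card I"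
proof -
  have "(\<Sum>i\<in>I. (1 / card I) *\<^sub>R a i) ^ m \<le> (\<Sum>i\<in>I. (1 / card I) * a i ^ m)"
    by (rule convex_on_sum[where C = "{0..}" and f = "\<lambda>x. x ^ m"])
      (use assms in \<open>auto intro!: convex_on_power_nonneg\<close>)
  then show ?thesis by (simp add: sum_divide_distrib)
qed

text \<open>By Jensen the power of an average is at most the average of the powers, so the bound
  does not grow with the number of summands, as it would under repeated \<open>bmom_add\<close>.
  Summing over \<open>J\<close> but dividing by the size of \<open>I\<close> lets the fits on all
  subsets share one bound.\<close>

lemma bmom_average:
  assumes I: "finite I" "I \<noteq> {}" "J \<subseteq> I" and b: "\<And>i. i \<in> I \<Longrightarrow> bmom M (f i) K"
  shows "bmom M (\<lambda>\<omega>. (\<Sum>i\<in>J. \<bar>f i \<omega>\<bar>) / card I) K"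
proof (rule bmom_dominated[where g = "\<lambda>m \<omega>. (\<Sum>i\<in>I. \<bar>f i \<omega>\<bar> ^ m) / card I"])
  show "(\<lambda>\<omega>. (\<Sum>i\<in>J. \<bar>f i \<omega>\<bar>) / card I) \<in> borel_measurable M"
    using b I by (intro borel_measurable_divide borel_measurable_sum borel_measurable_const
        borel_measurable_abs bmom_measurable[of M _ K]) auto
  fix m
  show "integrable M (\<lambda>\<omega>. (\<Sum>i\<in>I. \<bar>f i \<omega>\<bar> ^ m) / card I)"
    by (intro integrable_divide Bochner_Integration.integrable_sum bmom_integrable[OF b])
  have "(\<Sum>i\<in>I. (\<integral>\<omega>. \<bar>f i \<omega>\<bar> ^ m \<partial>M)) \<le> (\<Sum>i\<in>I. K m)"
    by (intro sum_mono bmom_le b)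
  then show "(\<integral>\<omega>. (\<Sum>i\<in>I. \<bar>f i \<omega>\<bar> ^ m) / card I \<partial>M) \<le> K m"
    using I by (simp add: bmom_integrable[OF b] divide_le_eq card_gt_0_iff mult.commute)
  fix \<omega>
  have "(\<Sum>i\<in>J. \<bar>f i \<omega>\<bar>) / card I \<le> (\<Sum>i\<in>I. \<bar>f i \<omega>\<bar>) / card I"
    using I by (intro divide_right_mono sum_mono2) auto
  then have "\<bar>(\<Sum>i\<in>J. \<bar>f i \<omega>\<bar>) / card I\<bar> ^ m \<le> ((\<Sum>i\<in>I. \<bar>f i \<omega>\<bar>) / card I) ^ m"
    by (intro power_mono) (auto simp: sum_nonneg)
  also have "\<dots> \<le> (\<Sum>i\<in>I. \<bar>f i \<omega>\<bar> ^ m) / card I" by (rule average_power_le[OF I(1,2)]) simp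
  finally show "\<bar>(\<Sum>i\<in>J. \<bar>f i \<omega>\<bar>) / card I\<bar> ^ m \<le> (\<Sum>i\<in>I. \<bar>f i \<omega>\<bar> ^ m) / card I" .
qed

text \<open>Conditioning yields bounds on nonnegative integrals, before integrability is known;
  finiteness of the bound then gives integrability.\<close>

lemma bmom_nn_integral:
  assumes f: "f \<in> borel_measurable M" and "\<And>m. 0 \<le> K m"
    and "\<And>m. (\<integral>\<^sup>+\<omega>. ennreal (\<bar>f \<omega>\<bar> ^ m) \<partial>M) \<le> ennreal (K m)"
  shows "bmom M f K"
  unfolding bmom_def
proof (intro conjI allI f)
  fix m
  have [measurable]: "f \<in> borel_measurable M" by (rule f)
  show i: "integrable M (\<lambda>\<omega>. \<bar>f \<omega>\<bar> ^ m)"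
    by (rule integrableI_bounded) (use le_less_trans[OF assms(3)[of m]] in auto)
  show "(\<integral>\<omega>. \<bar>f \<omega>\<bar> ^ m \<partial>M) \<le> K m"
    using nn_integral_eq_integral[OF i] assms(2,3)[of m] by simp
qed

subsection \<open>Independence and Gaussian linear forms\<close>

text \<open>The library's \<open>indep_var\<close> forces both variables to have the same type.\<close>

definition indep_pair :: "'w measure \<Rightarrow> 'b measure \<Rightarrow> ('w \<Rightarrow> 'b) \<Rightarrow> 'c measure \<Rightarrow> ('w \<Rightarrow> 'c) \<Rightarrow> bool" where
  "indep_pair M N1 U N2 Z \<longleftrightarrow> U \<in> measurable M N1 \<and> Z \<in> measurable M N2 \<and>
     distr M (N1 \<Otimes>\<^sub>M N2) (\<lambda>\<omega>. (U \<omega>, Z \<omega>)) = distr M N1 U \<Otimes>\<^sub>M distr M N2 Z"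

lemma indep_pairD:
  assumes "indep_pair M N1 U N2 Z"
  shows "U \<in> measurable M N1" and "Z \<in> measurable M N2"
    and "distr M (N1 \<Otimes>\<^sub>M N2) (\<lambda>\<omega>. (U \<omega>, Z \<omega>)) = distr M N1 U \<Otimes>\<^sub>M distr M N2 Z"
  using assms by (auto simp: indep_pair_def)

context prob_space
begin

lemma indep_pair_map_snd:
  assumes ind: "indep_pair M N1 U N2 Z" and g: "g \<in> measurable N2 N3"
  shows "indep_pair M N1 U N3 (\<lambda>\<omega>. g (Z \<omega>))"
proof -
  note U = indep_pairD(1)[OF ind] and Z = indep_pairD(2)[OF ind]
  have gZ: "(\<lambda>\<omega>. g (Z \<omega>)) \<in> measurable M N3" by (rule measurable_compose[OF Z g])
  interpret Z: prob_space "distr M N2 Z" by (rule prob_space_distr[OF Z])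
  have g': "g \<in> measurable (distr M N2 Z) N3" using g by simp
  interpret gZ: prob_space "distr (distr M N2 Z) N3 g" by (rule Z.prob_space_distr[OF g'])
  have comp: "distr M N3 (\<lambda>\<omega>. g (Z \<omega>)) = distr (distr M N2 Z) N3 g"
    using distr_distr[OF g Z] by (simp add: comp_def)
  have "distr M N1 U \<Otimes>\<^sub>M distr M N3 (\<lambda>\<omega>. g (Z \<omega>))
      = distr (distr M N1 U) N1 (\<lambda>u. u) \<Otimes>\<^sub>M distr (distr M N2 Z) N3 g"
    by (simp add: comp distr_id2)
  also have "\<dots> = distr (distr M N1 U \<Otimes>\<^sub>M distr M N2 Z) (N1 \<Otimes>\<^sub>M N3) (\<lambda>(u, z). (u, g z))"
    by (rule pair_measure_distr) (use g' gZ.sigma_finite_measure_axioms in auto)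
  also have "\<dots> = distr (distr M (N1 \<Otimes>\<^sub>M N2) (\<lambda>\<omega>. (U \<omega>, Z \<omega>))) (N1 \<Otimes>\<^sub>M N3) (\<lambda>(u, z). (u, g z))"
    by (simp only: indep_pairD(3)[OF ind])
  also have "\<dots> = distr M (N1 \<Otimes>\<^sub>M N3) (\<lambda>\<omega>. (U \<omega>, g (Z \<omega>)))"
    using U Z g by (subst distr_distr) (auto simp: comp_def)
  finally show ?thesis unfolding indep_pair_def using U gZ by simp
qed

lemma indep_nn_integral:
  assumes ind: "indep_pair M N1 U N2 Z" and f: "f \<in> borel_measurable (N1 \<Otimes>\<^sub>M N2)"
  shows "(\<integral>\<^sup>+\<omega>. f (U \<omega>, Z \<omega>) \<partial>M) = (\<integral>\<^sup>+\<omega>. (\<integral>\<^sup>+z. f (U \<omega>, z) \<partial>distr M N2 Z) \<partial>M)"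
proof -
  have U: "U \<in> measurable M N1" and Z: "Z \<in> measurable M N2"
    using indep_pairD[OF ind] by auto
  interpret Z: prob_space "distr M N2 Z" by (rule prob_space_distr[OF Z])
  have f': "f \<in> borel_measurable (N1 \<Otimes>\<^sub>M distr M N2 Z)"
    using f by (simp cong: measurable_cong_sets sets_pair_measure_cong)
  have "(\<integral>\<^sup>+\<omega>. f (U \<omega>, Z \<omega>) \<partial>M) = integral\<^sup>N (distr M (N1 \<Otimes>\<^sub>M N2) (\<lambda>\<omega>. (U \<omega>, Z \<omega>))) f"
    using U Z f by (subst nn_integral_distr) auto
  also have "distr M (N1 \<Otimes>\<^sub>M N2) (\<lambda>\<omega>. (U \<omega>, Z \<omega>)) = distr M N1 U \<Otimes>\<^sub>M distr M N2 Z"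
    by (rule indep_pairD(3)[OF ind])
  also have "integral\<^sup>N (distr M N1 U \<Otimes>\<^sub>M distr M N2 Z) f
      = (\<integral>\<^sup>+u. (\<integral>\<^sup>+z. f (u, z) \<partial>distr M N2 Z) \<partial>distr M N1 U)"
    using f by (intro Z.nn_integral_fst[symmetric]) (simp cong: measurable_cong_sets sets_pair_measure_cong)
  also have "\<dots> = (\<integral>\<^sup>+\<omega>. (\<integral>\<^sup>+z. f (U \<omega>, z) \<partial>distr M N2 Z) \<partial>M)"
    using Z.borel_measurable_nn_integral_fst[OF f'] by (intro nn_integral_distr[OF U]) simp
  finally show ?thesis .
qed

lemma indep_integral:
  fixes f :: "'b \<times> 'c \<Rightarrow> real"
  assumes ind: "indep_pair M N1 U N2 Z" and f: "f \<in> borel_measurable (N1 \<Otimes>\<^sub>M N2)"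
    and int: "integrable M (\<lambda>\<omega>. f (U \<omega>, Z \<omega>))"
  shows "(\<integral>\<omega>. f (U \<omega>, Z \<omega>) \<partial>M) = (\<integral>\<omega>. (\<integral>z. f (U \<omega>, z) \<partial>distr M N2 Z) \<partial>M)"
proof -
  have U: "U \<in> measurable M N1" and Z: "Z \<in> measurable M N2"
    using indep_pairD[OF ind] by auto
  interpret Z: prob_space "distr M N2 Z" by (rule prob_space_distr[OF Z])
  interpret U: prob_space "distr M N1 U" by (rule prob_space_distr[OF U])
  interpret P: pair_prob_space "distr M N1 U" "distr M N2 Z" ..
  have f': "f \<in> borel_measurable (N1 \<Otimes>\<^sub>M distr M N2 Z)"
    using f by (simp cong: measurable_cong_sets sets_pair_measure_cong)
  have eq: "distr M (N1 \<Otimes>\<^sub>M N2) (\<lambda>\<omega>. (U \<omega>, Z \<omega>)) = distr M N1 U \<Otimes>\<^sub>M distr M N2 Z"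
    by (rule indep_pairD(3)[OF ind])
  have UZ: "(\<lambda>\<omega>. (U \<omega>, Z \<omega>)) \<in> measurable M (N1 \<Otimes>\<^sub>M N2)" using U Z by (rule measurable_Pair)
  have int': "integrable (distr M N1 U \<Otimes>\<^sub>M distr M N2 Z) f"
    unfolding eq[symmetric] using int UZ f by (simp add: integrable_distr_eq)
  have "(\<integral>\<omega>. f (U \<omega>, Z \<omega>) \<partial>M) = integral\<^sup>L (distr M N1 U \<Otimes>\<^sub>M distr M N2 Z) f"
    unfolding eq[symmetric] by (rule integral_distr[OF UZ f, symmetric])
  also have "\<dots> = (\<integral>u. (\<integral>z. f (u, z) \<partial>distr M N2 Z) \<partial>distr M N1 U)"
    by (rule P.integral_fst'[OF int', symmetric])
  also have "\<dots> = (\<integral>\<omega>. (\<integral>z. f (U \<omega>, z) \<partial>distr M N2 Z) \<partial>M)"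
    using Z.borel_measurable_lebesgue_integral[of "\<lambda>u z. f (u, z)" N1] f' by (intro integral_distr[OF U]) simp
  finally show ?thesis .
qed

lemma integral_square_le:
  fixes f :: "'a \<Rightarrow> real"
  assumes "integrable M (\<lambda>\<omega>. (f \<omega>)\<^sup>2)" "f \<in> borel_measurable M"
  shows "(\<integral>\<omega>. f \<omega> \<partial>M)\<^sup>2 \<le> (\<integral>\<omega>. (f \<omega>)\<^sup>2 \<partial>M)"
proof -
  have "integrable M f" by (rule square_integrable_imp_integrable[OF assms(2,1)])
  then show ?thesis using variance_eq[of f] variance_positive[of f] assms by linarith
qed

text \<open>\<open>F (U \<omega>)\<close> is the conditional expectation given \<open>U\<close>,
  kept as an explicit function of the value of \<open>U\<close>. Jensen for each fixed
  \<open>u\<close> followed by Tonelli gives the contraction in \<open>L\<^sup>2\<close>; the last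
  claim is the averaging property.\<close>

lemma indep_conditional_mean:
  fixes f :: "'b \<times> 'c \<Rightarrow> real"
  assumes ind: "indep_pair M N1 U N2 Z" and f: "f \<in> borel_measurable (N1 \<Otimes>\<^sub>M N2)"
    and int: "integrable M (\<lambda>\<omega>. (f (U \<omega>, Z \<omega>))\<^sup>2)"
  defines "F \<equiv> \<lambda>u. \<integral>z. f (u, z) \<partial>distr M N2 Z"
  shows indep_conditional_mean_measurable: "F \<in> borel_measurable N1"
    and indep_conditional_mean_integrable: "integrable M (\<lambda>\<omega>. (F (U \<omega>))\<^sup>2)"
    and indep_conditional_mean_le: "(\<integral>\<omega>. (F (U \<omega>))\<^sup>2 \<partial>M) \<le> (\<integral>\<omega>. (f (U \<omega>, Z \<omega>))\<^sup>2 \<partial>M)"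
    and indep_conditional_mean_eq: "\<And>G. \<lbrakk>G \<in> borel_measurable N1; integrable M (\<lambda>\<omega>. G (U \<omega>) * f (U \<omega>, Z \<omega>))\<rbrakk>
        \<Longrightarrow> (\<integral>\<omega>. G (U \<omega>) * f (U \<omega>, Z \<omega>) \<partial>M) = (\<integral>\<omega>. G (U \<omega>) * F (U \<omega>) \<partial>M)"
proof -
  have U: "U \<in> measurable M N1" and Z: "Z \<in> measurable M N2"
    using indep_pairD[OF ind] by auto
  interpret Z: prob_space "distr M N2 Z" by (rule prob_space_distr[OF Z])
  have f': "f \<in> borel_measurable (N1 \<Otimes>\<^sub>M distr M N2 Z)"
    using f by (simp cong: measurable_cong_sets sets_pair_measure_cong)
  show Fm: "F \<in> borel_measurable N1"
    unfolding F_def using Z.borel_measurable_lebesgue_integral[of "\<lambda>u z. f (u, z)" N1] f' by simp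
  \<comment> \<open>Where the inner second moment is infinite, \<open>F u\<close> may be the default
    value of a divergent integral, but the inequality is then trivial.\<close>
  have jensen: "ennreal ((F u)\<^sup>2) \<le> (\<integral>\<^sup>+z. ennreal ((f (u, z))\<^sup>2) \<partial>distr M N2 Z)" if u: "u \<in> space N1" for u
  proof (cases "(\<integral>\<^sup>+z. ennreal ((f (u, z))\<^sup>2) \<partial>distr M N2 Z) = \<infinity>")
    case False
    have fu: "(\<lambda>z. f (u, z)) \<in> borel_measurable (distr M N2 Z)" by (rule measurable_Pair2[OF f' u])
    have i: "integrable (distr M N2 Z) (\<lambda>z. (f (u, z))\<^sup>2)"
    proof (rule integrableI_nonneg)
      show "(\<lambda>z. (f (u, z))\<^sup>2) \<in> borel_measurable (distr M N2 Z)" using fu by (rule borel_measurable_power)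
      show "(\<integral>\<^sup>+z. ennreal ((f (u, z))\<^sup>2) \<partial>distr M N2 Z) < \<infinity>" using False by (simp add: less_top)
    qed simp
    show ?thesis
      unfolding F_def nn_integral_eq_integral[OF i AE_I2[OF zero_le_power2]]
      by (intro ennreal_leI Z.integral_square_le[OF i fu])
  qed simp
  have fU: "(\<lambda>\<omega>. f (U \<omega>, Z \<omega>)) \<in> borel_measurable M"
    using measurable_compose[OF measurable_Pair[OF U Z] f] .
  have FU: "(\<lambda>\<omega>. F (U \<omega>)) \<in> borel_measurable M" using measurable_compose[OF U Fm] .
  have "(\<integral>\<^sup>+\<omega>. ennreal ((F (U \<omega>))\<^sup>2) \<partial>M) \<le> (\<integral>\<^sup>+\<omega>. (\<integral>\<^sup>+z. ennreal ((f (U \<omega>, z))\<^sup>2) \<partial>distr M N2 Z) \<partial>M)"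
    using measurable_space[OF U] by (intro nn_integral_mono jensen)
  also have "\<dots> = (\<integral>\<^sup>+\<omega>. ennreal ((f (U \<omega>, Z \<omega>))\<^sup>2) \<partial>M)"
    using indep_nn_integral[OF ind, of "\<lambda>x. ennreal ((f x)\<^sup>2)"] f by simp
  also have "\<dots> = ennreal (\<integral>\<omega>. (f (U \<omega>, Z \<omega>))\<^sup>2 \<partial>M)"
    by (rule nn_integral_eq_integral[OF int]) simp
  finally have le: "(\<integral>\<^sup>+\<omega>. ennreal ((F (U \<omega>))\<^sup>2) \<partial>M) \<le> ennreal (\<integral>\<omega>. (f (U \<omega>, Z \<omega>))\<^sup>2 \<partial>M)" .
  show FI: "integrable M (\<lambda>\<omega>. (F (U \<omega>))\<^sup>2)"
    by (rule integrableI_nonneg) (use FU le_less_trans[OF le] in auto)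
  show "(\<integral>\<omega>. (F (U \<omega>))\<^sup>2 \<partial>M) \<le> (\<integral>\<omega>. (f (U \<omega>, Z \<omega>))\<^sup>2 \<partial>M)"
    using le nn_integral_eq_integral[OF FI] by simp
  fix G assume G: "G \<in> borel_measurable N1" and Gi: "integrable M (\<lambda>\<omega>. G (U \<omega>) * f (U \<omega>, Z \<omega>))"
  have "(\<lambda>x. G (fst x) * f x) \<in> borel_measurable (N1 \<Otimes>\<^sub>M N2)"
    using f G by (intro borel_measurable_times measurable_compose[OF measurable_fst])
  from indep_integral[OF ind this] Gi
  show "(\<integral>\<omega>. G (U \<omega>) * f (U \<omega>, Z \<omega>) \<partial>M) = (\<integral>\<omega>. G (U \<omega>) * F (U \<omega>) \<partial>M)"
    by (simp add: F_def)
qed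

end

lemma gaussian_law_moment:
  assumes P: "gaussian_law p S P" and t: "t \<in> Rn p"
  shows "(\<integral>\<^sup>+x. ennreal (\<bar>dotp p t x\<bar> ^ m) \<partial>P)
    = ennreal (sqrt (quad_form p S t) ^ m * (\<integral>z. \<bar>z\<bar> ^ m \<partial>std_normal_distribution))"
proof -
  let ?N = std_normal_distribution and ?q = "sqrt (quad_form p S t)"
  interpret N: prob_space ?N by (rule prob_space_normal_density) simp
  have sP: "sets P = sets borel" and d: "distr P borel (dotp p t) = distr ?N borel (\<lambda>z. ?q * z)"
    and q0: "0 \<le> ?q" using P t by (auto simp: gaussian_law_def)
  have [measurable]: "dotp p t \<in> borel_measurable P"
    unfolding measurable_cong_sets[OF sP refl]
    using dotp_measurable[of p t] by (simp add: dotp_commute[of p t, abs_def])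
  have int: "integrable ?N (\<lambda>z. \<bar>z\<bar> ^ m)"
    using integrable_std_normal_moment_abs[of m] by (subst integrable_density) (auto simp: normal_density_nonneg)
  have "(\<integral>\<^sup>+x. ennreal (\<bar>dotp p t x\<bar> ^ m) \<partial>P) = (\<integral>\<^sup>+y. ennreal (\<bar>y\<bar> ^ m) \<partial>distr P borel (dotp p t))"
    by (subst nn_integral_distr) auto
  also have "\<dots> = (\<integral>\<^sup>+z. ennreal (\<bar>?q * z\<bar> ^ m) \<partial>?N)"
    unfolding d by (subst nn_integral_distr) auto
  also have "\<dots> = (\<integral>\<^sup>+z. ennreal (?q ^ m) * ennreal (\<bar>z\<bar> ^ m) \<partial>?N)"
    using q0 by (simp add: abs_mult power_mult_distrib ennreal_mult)
  also have "\<dots> = ennreal (?q ^ m) * (\<integral>\<^sup>+z. ennreal (\<bar>z\<bar> ^ m) \<partial>?N)"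
    by (rule nn_integral_cmult) simp
  also have "(\<integral>\<^sup>+z. ennreal (\<bar>z\<bar> ^ m) \<partial>?N) = ennreal (\<integral>z. \<bar>z\<bar> ^ m \<partial>?N)"
    by (rule nn_integral_eq_integral[OF int]) simp
  finally show ?thesis using q0 by (simp add: ennreal_mult)
qed

text \<open>Given \<open>U\<close> the vector \<open>b (U \<omega>)\<close> is fixed, so the linear
  form is a centred normal variable with variance at most \<open>C / p\<close> times its squared
  norm; the factor \<open>sqrt p\<close> outside cancels the \<open>p\<close>.\<close>

lemma (in prob_space) bmom_gaussian:
  assumes ind: "indep_pair M N1 U borel X" and X: "distr M borel X = P"
    and P: "gaussian_law p S P" and sig: "sigma_max S \<le> C / real p" and p: "0 < p"
    and b: "b \<in> borel_measurable N1" and bR: "\<And>u. b u \<in> Rn p"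
    and K: "bmom M (\<lambda>\<omega>. nrm p (b (U \<omega>))) K"
  shows "bmom M (\<lambda>\<omega>. sqrt (real p) * dotp p (X \<omega>) (b (U \<omega>))) (kgauss C K)"
proof (rule bmom_nn_integral)
  have U: "U \<in> measurable M N1" and Xm: "X \<in> measurable M borel"
    using indep_pairD[OF ind] by auto
  have bU: "(\<lambda>\<omega>. b (U \<omega>)) \<in> borel_measurable M" by (rule measurable_compose[OF U b])
  show "(\<lambda>\<omega>. sqrt (real p) * dotp p (X \<omega>) (b (U \<omega>))) \<in> borel_measurable M"
    by (intro borel_measurable_times borel_measurable_const dotp_measurable2 Xm bU)
  have quad: "0 \<le> quad_form p S t" "quad_form p S t \<le> C / real p * (nrm p t)\<^sup>2" if t: "t \<in> Rn p" for t
  proof -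
    show "0 \<le> quad_form p S t" using P t by (auto simp: gaussian_law_def)
    have "quad_form p S t \<le> sigma_max S * (nrm p t)\<^sup>2"
      by (rule quad_form_le_sigma_max) (use P p t in \<open>auto simp: gaussian_law_def\<close>)
    also have "\<dots> \<le> C / real p * (nrm p t)\<^sup>2" using sig by (intro mult_right_mono) auto
    finally show "quad_form p S t \<le> C / real p * (nrm p t)\<^sup>2" .
  qed
  \<comment> \<open>The sign of \<open>C\<close> is not assumed; it follows from the quadratic form
    at the first unit vector.\<close>
  have C0: "0 \<le> C"
  proof -
    let ?e = "\<lambda>i. if i = 0 then 1 else 0 :: real"
    have "0 \<le> C / real p * (nrm p ?e)\<^sup>2" using order_trans[OF quad[of ?e]] p by (auto simp: Rn_iff)
    moreover have "nrm p ?e = 1"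
      using p by (auto simp: L2_set_def if_distrib[of "\<lambda>x. x\<^sup>2"] sum.delta cong: if_cong)
    ultimately show ?thesis using p by (simp add: zero_le_divide_iff)
  qed
  fix m
  define g where "g = (\<integral>z. \<bar>z\<bar> ^ m \<partial>std_normal_distribution)"
  have g0: "0 \<le> g" unfolding g_def by (rule Bochner_Integration.integral_nonneg) simp
  have K0: "0 \<le> K m" by (rule bmom_const_nonneg[OF K])
  show "0 \<le> kgauss C K m" unfolding kgauss_def g_def[symmetric] using g0 K0 C0 by simp
  have inner: "(\<integral>\<^sup>+x. ennreal (\<bar>sqrt (real p) * dotp p x t\<bar> ^ m) \<partial>P)
      \<le> ennreal (sqrt C ^ m * g) * ennreal (\<bar>nrm p t\<bar> ^ m)" if t: "t \<in> Rn p" for t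
  proof -
    have tp: "(\<lambda>i. sqrt (real p) * t i) \<in> Rn p" using t by (simp add: Rn_iff)
    have "(\<integral>\<^sup>+x. ennreal (\<bar>sqrt (real p) * dotp p x t\<bar> ^ m) \<partial>P)
        = (\<integral>\<^sup>+x. ennreal (\<bar>dotp p (\<lambda>i. sqrt (real p) * t i) x\<bar> ^ m) \<partial>P)"
      by (simp add: dotp_commute[of p "\<lambda>i. sqrt (real p) * t i"] dotp_scale_right)
    also have "\<dots> = ennreal (sqrt (quad_form p S (\<lambda>i. sqrt (real p) * t i)) ^ m * g)"
      unfolding g_def by (rule gaussian_law_moment[OF P tp])
    also have "\<dots> \<le> ennreal ((sqrt C * nrm p t) ^ m * g)"
    proof (intro ennreal_leI mult_right_mono power_mono g0)
      have "quad_form p S (\<lambda>i. sqrt (real p) * t i) \<le> C * (nrm p t)\<^sup>2"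
        using quad(2)[OF t] p by (simp only: quad_form_scale) (simp add: field_simps)
      then have "sqrt (quad_form p S (\<lambda>i. sqrt (real p) * t i)) \<le> sqrt (C * (nrm p t)\<^sup>2)" by simp
      then show "sqrt (quad_form p S (\<lambda>i. sqrt (real p) * t i)) \<le> sqrt C * nrm p t"
        by (simp add: real_sqrt_mult L2_set_nonneg)
      show "0 \<le> sqrt (quad_form p S (\<lambda>i. sqrt (real p) * t i))" using quad(1)[OF tp] by simp
    qed
    also have "\<dots> = ennreal (sqrt C ^ m * g) * ennreal (\<bar>nrm p t\<bar> ^ m)"
      using C0 g0 by (simp add: power_mult_distrib L2_set_nonneg mult_ac flip: ennreal_mult)
    finally show ?thesis .
  qed
  have meas: "(\<lambda>(u, x). ennreal (\<bar>sqrt (real p) * dotp p x (b u)\<bar> ^ m)) \<in> borel_measurable (N1 \<Otimes>\<^sub>M borel)"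
  proof -
    have "(\<lambda>w. dotp p (snd w) (b (fst w))) \<in> borel_measurable (N1 \<Otimes>\<^sub>M borel)"
      by (intro dotp_measurable2 measurable_snd measurable_compose[OF measurable_fst b])
    then have "(\<lambda>w. ennreal (\<bar>sqrt (real p) * dotp p (snd w) (b (fst w))\<bar> ^ m)) \<in> borel_measurable (N1 \<Otimes>\<^sub>M borel)"
      by measurable
    then show ?thesis by (simp add: case_prod_beta')
  qed
  have "(\<integral>\<^sup>+\<omega>. ennreal (\<bar>sqrt (real p) * dotp p (X \<omega>) (b (U \<omega>))\<bar> ^ m) \<partial>M)
      = (\<integral>\<^sup>+\<omega>. (\<integral>\<^sup>+x. ennreal (\<bar>sqrt (real p) * dotp p x (b (U \<omega>))\<bar> ^ m) \<partial>P) \<partial>M)"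
    using indep_nn_integral[OF ind meas] by (simp add: X)
  also have "\<dots> \<le> (\<integral>\<^sup>+\<omega>. ennreal (sqrt C ^ m * g) * ennreal (\<bar>nrm p (b (U \<omega>))\<bar> ^ m) \<partial>M)"
    by (intro nn_integral_mono inner bR)
  also have "\<dots> = ennreal (sqrt C ^ m * g) * (\<integral>\<^sup>+\<omega>. ennreal (\<bar>nrm p (b (U \<omega>))\<bar> ^ m) \<partial>M)"
    using bmom_measurable[OF K] by (intro nn_integral_cmult) simp
  also have "(\<integral>\<^sup>+\<omega>. ennreal (\<bar>nrm p (b (U \<omega>))\<bar> ^ m) \<partial>M) = ennreal (\<integral>\<omega>. \<bar>nrm p (b (U \<omega>))\<bar> ^ m \<partial>M)"
    by (rule nn_integral_eq_integral[OF bmom_integrable[OF K]]) simp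
  also have "ennreal (sqrt C ^ m * g) * \<dots> \<le> ennreal (sqrt C ^ m * g) * ennreal (K m)"
    by (intro mult_left_mono ennreal_leI bmom_le[OF K]) simp
  also have "\<dots> = ennreal (kgauss C K m)"
    unfolding kgauss_def g_def[symmetric] using C0 g0 K0 by (simp add: ennreal_mult)
  finally show "(\<integral>\<^sup>+\<omega>. ennreal (\<bar>sqrt (real p) * dotp p (X \<omega>) (b (U \<omega>))\<bar> ^ m) \<partial>M) \<le> ennreal (kgauss C K m)" .
qed

section \<open>Inequalities for square-integrable functions\<close>

lemma square_sum_le: "(a + b)\<^sup>2 \<le> 2 * a\<^sup>2 + 2 * (b::real)\<^sup>2"
  using zero_le_power2[of "a - b"] by (simp add: power2_sum power2_diff)

lemma square_diff_le: "(a - b)\<^sup>2 \<le> 2 * a\<^sup>2 + 2 * (b::real)\<^sup>2"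
  using square_sum_le[of a "- b"] by simp

text \<open>Products are bounded by \<open>2ab \<le> a\<^sup>2 + b\<^sup>2\<close> instead of the
  Cauchy-Schwarz inequality for integrals; nothing is lost where the two factors obey the same
  bound, as the increments of W in \<open>W_cross_le\<close> do.\<close>

lemma
  fixes f g :: "'a \<Rightarrow> real"
  assumes "f \<in> borel_measurable M" "g \<in> borel_measurable M"
    and "integrable M (\<lambda>x. (f x)\<^sup>2)" "integrable M (\<lambda>x. (g x)\<^sup>2)"
  shows integrable_mult_L2: "integrable M (\<lambda>x. f x * g x)"
    and integrable_square_diff: "integrable M (\<lambda>x. (f x - g x)\<^sup>2)"
    and integrable_square_add: "integrable M (\<lambda>x. (f x + g x)\<^sup>2)"
    and integral_square_diff_le: "(\<integral>x. (f x - g x)\<^sup>2 \<partial>M) \<le> 2 * (\<integral>x. (f x)\<^sup>2 \<partial>M) + 2 * (\<integral>x. (g x)\<^sup>2 \<partial>M)"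
    and integral_square_add_le: "(\<integral>x. (f x + g x)\<^sup>2 \<partial>M) \<le> 2 * (\<integral>x. (f x)\<^sup>2 \<partial>M) + 2 * (\<integral>x. (g x)\<^sup>2 \<partial>M)"
    and integral_mult_le: "2 * (\<integral>x. f x * g x \<partial>M) \<le> (\<integral>x. (f x)\<^sup>2 \<partial>M) + (\<integral>x. (g x)\<^sup>2 \<partial>M)"
proof -
  let ?S = "\<lambda>x. 2 * (f x)\<^sup>2 + 2 * (g x)\<^sup>2"
  have S: "integrable M ?S" "(\<integral>x. ?S x \<partial>M) = 2 * (\<integral>x. (f x)\<^sup>2 \<partial>M) + 2 * (\<integral>x. (g x)\<^sup>2 \<partial>M)"
    using assms(3,4) by auto
  have prod: "2 * (f x * g x) \<le> (f x)\<^sup>2 + (g x)\<^sup>2" for x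
    using sum_squares_bound[of "f x" "g x"] by (simp add: mult.assoc)
  show m: "integrable M (\<lambda>x. f x * g x)"
  proof (rule Bochner_Integration.integrable_bound[OF S(1)])
    show "AE x in M. norm (f x * g x) \<le> norm (?S x)"
    proof (rule AE_I2)
      fix x
      have "2 * (\<bar>f x\<bar> * \<bar>g x\<bar>) \<le> (f x)\<^sup>2 + (g x)\<^sup>2"
        using sum_squares_bound[of "\<bar>f x\<bar>" "\<bar>g x\<bar>"] by (simp add: mult.assoc)
      moreover have "0 \<le> (f x)\<^sup>2" "0 \<le> (g x)\<^sup>2" "0 \<le> \<bar>f x\<bar> * \<bar>g x\<bar>" by simp_all
      ultimately show "norm (f x * g x) \<le> norm (?S x)" unfolding real_norm_def abs_mult by linarith
    qed
  qed (intro borel_measurable_times assms)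
  show d: "integrable M (\<lambda>x. (f x - g x)\<^sup>2)"
    by (rule Bochner_Integration.integrable_bound[OF S(1)])
      (use assms square_diff_le in \<open>auto intro!: borel_measurable_power borel_measurable_diff\<close>)
  show a: "integrable M (\<lambda>x. (f x + g x)\<^sup>2)"
    by (rule Bochner_Integration.integrable_bound[OF S(1)])
      (use assms square_sum_le in \<open>auto intro!: borel_measurable_power borel_measurable_add\<close>)
  show "(\<integral>x. (f x - g x)\<^sup>2 \<partial>M) \<le> 2 * (\<integral>x. (f x)\<^sup>2 \<partial>M) + 2 * (\<integral>x. (g x)\<^sup>2 \<partial>M)"
    unfolding S(2)[symmetric] by (rule integral_mono[OF d S(1) square_diff_le])
  show "(\<integral>x. (f x + g x)\<^sup>2 \<partial>M) \<le> 2 * (\<integral>x. (f x)\<^sup>2 \<partial>M) + 2 * (\<integral>x. (g x)\<^sup>2 \<partial>M)"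
    unfolding S(2)[symmetric] by (rule integral_mono[OF a S(1) square_sum_le])
  have "(\<integral>x. 2 * (f x * g x) \<partial>M) \<le> (\<integral>x. (f x)\<^sup>2 + (g x)\<^sup>2 \<partial>M)"
    by (rule integral_mono) (use m assms prod in auto)
  then show "2 * (\<integral>x. f x * g x \<partial>M) \<le> (\<integral>x. (f x)\<^sup>2 \<partial>M) + (\<integral>x. (g x)\<^sup>2 \<partial>M)"
    using m assms by simp
qed

subsection \<open>Leave-one-out stability in mean square\<close>

text \<open>The constants are built in a context that fixes neither n, p nor a probability space, so
  their independence of these is visible. \<open>A\<close> and \<open>N\<close> describe polynomial
  growth of losses and derivatives, \<open>KY\<close> bounds the response moments, and
  \<open>\<kappa> p\<close> bounds the penalty at a reference point.\<close>

locale rate =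
  fixes \<gamma>0 lam \<eta> C_X A \<kappa> :: real and N :: nat and KY :: "nat \<Rightarrow> real"
begin

definition k_x :: "nat \<Rightarrow> real" where "k_x = kadd (kconst 1) (kpow 2 (kgauss C_X (kconst 1)))"
definition k_grow :: "(nat \<Rightarrow> real) \<Rightarrow> nat \<Rightarrow> real" where
  "k_grow K = kscale A (kadd (kconst 1) (kadd (kpow N KY) (kpow N K)))"
text \<open>Origin: for \<open>h = |b| / sqrt p\<close> the comparison with \<open>b0\<close> gives
  \<open>h\<^sup>2\<close> at most \<open>\<kappa> / \<eta>\<close> plus
  \<open>\<gamma>0 / (lam \<eta>)\<close> times an average loss at \<open>b0\<close>, and
  \<open>h \<le> 1 + h\<^sup>2\<close> avoids a square root. The inner
  \<open>sqrt (\<kappa> / \<eta>)\<close> bounds \<open>|b0| / sqrt p\<close>.\<close>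

definition k_est :: "nat \<Rightarrow> real" where
  "k_est = kadd (kconst (1 + \<kappa> / \<eta>))
     (kscale (\<gamma>0 / (lam * \<eta>)) (k_grow (kgauss C_X (kconst (sqrt (\<kappa> / \<eta>))))))"
definition k_lin :: "nat \<Rightarrow> real" where "k_lin = kgauss C_X k_est"
definition k_phi :: "nat \<Rightarrow> real" where "k_phi = k_grow k_lin"
definition k_delta :: "nat \<Rightarrow> real" where "k_delta = kscale (1 / (2 * (lam * \<eta>))) (kmul k_phi k_x)"
definition k_diff :: "nat \<Rightarrow> real" where "k_diff = kmul (k_grow (kadd k_lin k_lin)) (kgauss C_X k_delta)"
text \<open>Twice the bound \<open>4 k_phi 2 + 4 \<gamma>0 k_diff 2\<close> for the average of the
  centred errors plus twice the bound \<open>\<gamma>0 k_diff 2\<close> for the average risk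
  change.\<close>

definition rate_const :: real where "rate_const = 8 * k_phi 2 + 10 * (\<gamma>0 * k_diff 2)"

end

text \<open>Of the response kernel only two consequences are kept: the observations have one common
  law, and its second marginal is \<open>P\<close>. Fits use subsets of {1..n}, so observation 0 is
  always fresh.\<close>

locale sample = erm p \<Theta> l lam \<eta> r0 + prob_space M + rate \<gamma>0 lam \<eta> C_X A \<kappa> N KY
  for p \<Theta> l lam \<eta> r0 and M :: "'w measure" and \<gamma>0 C_X A \<kappa> N KY +
  fixes n :: nat and Z :: "nat \<Rightarrow> 'w \<Rightarrow> obs" and P S b0 \<phi>
  assumes n_pos: "0 < n" and p_pos: "0 < p" and ratio: "real n = \<gamma>0 * real p"
    and indep: "indep_vars (\<lambda>_. borel) Z {0..n}"
    and ident: "\<And>i. i \<in> {0..n} \<Longrightarrow> distr M borel (Z i) = distr M borel (Z 0)"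
    and x_law: "\<And>i. i \<in> {0..n} \<Longrightarrow> distr M borel (\<lambda>\<omega>. snd (Z i \<omega>)) = P"
    and gaussian: "gaussian_law p S P" and sigma: "sigma_max S \<le> C_X / real p"
    and b0: "b0 \<in> \<Theta>" "enet_reg p \<eta> r0 b0 \<le> \<kappa> * real p"
    and phi: "smooth_convex_loss \<phi>"
    and loss_growth: "\<And>y z. \<bar>l y z\<bar> \<le> A * (1 + \<bar>y\<bar> ^ N + \<bar>z\<bar> ^ N)"
    and loss_deriv_growth: "\<And>y z. \<bar>deriv (l y) z\<bar> \<le> A * (1 + \<bar>y\<bar> ^ N + \<bar>z\<bar> ^ N)"
    and phi_growth: "\<And>y z. \<bar>\<phi> y z\<bar> \<le> A * (1 + \<bar>y\<bar> ^ N + \<bar>z\<bar> ^ N)"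
    and phi_deriv_growth: "\<And>y z. \<bar>deriv (\<phi> y) z\<bar> \<le> A * (1 + \<bar>y\<bar> ^ N + \<bar>z\<bar> ^ N)"
    and y_moments: "\<And>i. i \<in> {0..n} \<Longrightarrow> bmom M (\<lambda>\<omega>. fst (Z i \<omega>)) KY"
begin

definition data :: "'w \<Rightarrow> nat \<Rightarrow> obs" where "data \<omega> = (\<lambda>j. Z j \<omega>)"

definition law :: "obs measure" where "law = distr M borel (Z 0)"

text \<open>The data and the evaluation point are separate arguments, so that Fubini applies on the
  product space; \<open>V\<close> inserts an observation of the same sample for the second
  one.\<close>

definition err :: "nat set \<Rightarrow> (nat \<Rightarrow> obs) \<times> obs \<Rightarrow> real" where
  "err J w = \<phi> (fst (snd w)) (dotp p (snd (snd w)) (est J (fst w)))"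

definition V :: "nat set \<Rightarrow> nat \<Rightarrow> 'w \<Rightarrow> real" where "V J k \<omega> = err J (data \<omega>, Z k \<omega>)"

text \<open>At the data with \<open>J \<subseteq> {1..n}\<close>, this is a version of the
  conditional expectation of \<open>V J k\<close> given the observations in \<open>J\<close>, for
  every \<open>k\<close> in {0..n} outside \<open>J\<close>.\<close>

definition risk :: "nat set \<Rightarrow> (nat \<Rightarrow> obs) \<Rightarrow> real" where
  "risk J u = (\<integral>z. err J (u, z) \<partial>law)"

definition W :: "nat set \<Rightarrow> nat \<Rightarrow> 'w \<Rightarrow> real" where "W J k \<omega> = V J k \<omega> - risk J (data \<omega>)"

lemma Z_measurable: "i \<in> {0..n} \<Longrightarrow> Z i \<in> borel_measurable M"
  using indep by (auto simp: indep_vars_def)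

lemma y_measurable: "i \<in> {0..n} \<Longrightarrow> (\<lambda>\<omega>. fst (Z i \<omega>)) \<in> borel_measurable M"
  and x_measurable: "i \<in> {0..n} \<Longrightarrow> (\<lambda>\<omega>. snd (Z i \<omega>)) \<in> borel_measurable M"
  by (auto intro: measurable_compose[OF Z_measurable] fst_obs_measurable snd_obs_measurable)

lemma est_restrict: "J' \<subseteq> J \<Longrightarrow> est J' (restrict u J) = est J' u"
  by (rule est_cong) auto

lemma indep_obs:
  assumes "J \<subseteq> {0..n}" "k \<in> {0..n}" "k \<notin> J"
  shows "indep_pair M (Pi\<^sub>M J (\<lambda>_. borel)) (\<lambda>\<omega>. restrict (data \<omega>) J) borel (Z k)"
proof -
  have "indep_var (Pi\<^sub>M J (\<lambda>_. borel)) (\<lambda>\<omega>. restrict (\<lambda>i. Z i \<omega>) J)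
      (Pi\<^sub>M {k} (\<lambda>_. borel)) (\<lambda>\<omega>. restrict (\<lambda>i. Z i \<omega>) {k})"
    by (rule indep_var_restrict[OF indep]) (use assms in auto)
  then have "indep_pair M (Pi\<^sub>M J (\<lambda>_. borel)) (\<lambda>\<omega>. restrict (data \<omega>) J)
      (Pi\<^sub>M {k} (\<lambda>_. borel)) (\<lambda>\<omega>. restrict (\<lambda>i. Z i \<omega>) {k})"
    unfolding indep_pair_def data_def indep_var_distribution_eq by simp
  from indep_pair_map_snd[OF this, of "\<lambda>z. z k" borel] show ?thesis by simp
qed

lemma bmom_linear:
  assumes "J \<subseteq> {0..n}" "k \<in> {0..n}" "k \<notin> J"
    and "b \<in> borel_measurable (Pi\<^sub>M J (\<lambda>_. borel))" "\<And>u. b u \<in> Rn p"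
    and "bmom M (\<lambda>\<omega>. nrm p (b (restrict (data \<omega>) J))) K"
  shows "bmom M (\<lambda>\<omega>. sqrt (real p) * dotp p (snd (Z k \<omega>)) (b (restrict (data \<omega>) J))) (kgauss C_X K)"
  by (rule bmom_gaussian[OF indep_pair_map_snd[OF indep_obs[OF assms(1-3)] snd_obs_measurable]
        x_law[OF assms(2)] gaussian sigma p_pos assms(4)]) (fact assms)+

text \<open>Two normalisations occur: differences of fits have norm of order one and gain a factor
  \<open>sqrt p\<close>, whereas fits have norm of order \<open>sqrt p\<close> and give predictions
  of order one. This is the second case.\<close>

lemma bmom_linear_scaled:
  assumes "J \<subseteq> {0..n}" "k \<in> {0..n}" "k \<notin> J"
    and b: "b \<in> borel_measurable (Pi\<^sub>M J (\<lambda>_. borel))" "\<And>u. b u \<in> Rn p"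
    and K: "bmom M (\<lambda>\<omega>. nrm p (b (restrict (data \<omega>) J)) / sqrt (real p)) K"
  shows "bmom M (\<lambda>\<omega>. dotp p (snd (Z k \<omega>)) (b (restrict (data \<omega>) J))) (kgauss C_X K)"
proof -
  let ?c = "1 / sqrt (real p)"
  have c: "sqrt (real p) * (?c * x) = x" for x using p_pos by simp
  have "(\<lambda>u i. ?c * b u i) \<in> borel_measurable (Pi\<^sub>M J (\<lambda>_. borel))"
    by (rule measurable_coordinatewise_then_product)
      (intro borel_measurable_times borel_measurable_const measurable_compose[OF b(1) measurable_product_coordinates])
  then have "bmom M (\<lambda>\<omega>. sqrt (real p) * dotp p (snd (Z k \<omega>)) (\<lambda>i. ?c * b (restrict (data \<omega>) J) i)) (kgauss C_X K)"
  proof (rule bmom_linear[OF assms(1-3)])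
    show "(\<lambda>i. ?c * b u i) \<in> Rn p" for u using b(2)[of u] by (simp add: Rn_iff)
    show "bmom M (\<lambda>\<omega>. nrm p (\<lambda>i. ?c * b (restrict (data \<omega>) J) i)) K"
      unfolding nrm_scale using K by simp
  qed
  then show ?thesis unfolding dotp_scale_right c .
qed

lemma bmom_linear_const:
  assumes "k \<in> {0..n}" "b \<in> Rn p" "nrm p b / sqrt (real p) \<le> c"
  shows "bmom M (\<lambda>\<omega>. dotp p (snd (Z k \<omega>)) b) (kgauss C_X (kconst c))"
proof (rule bmom_linear_scaled[of "{}" k "\<lambda>_. b"])
  show "bmom M (\<lambda>\<omega>. nrm p b / sqrt (real p)) (kconst c)"
    by (rule bmom_mono[OF bmom_const[of c]]) (use assms(3) in \<open>auto simp: L2_set_nonneg\<close>)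
qed (use assms in auto)

lemma bmom_grow:
  assumes "k \<in> {0..n}" "bmom M z K" "h \<in> borel_measurable M"
    and "\<And>\<omega>. \<bar>h \<omega>\<bar> \<le> A * (1 + \<bar>fst (Z k \<omega>)\<bar> ^ N + \<bar>z \<omega>\<bar> ^ N)"
  shows "bmom M h (k_grow K)"
proof (rule bmom_mono)
  show "bmom M (\<lambda>\<omega>. A * (1 + (\<bar>fst (Z k \<omega>)\<bar> ^ N + \<bar>z \<omega>\<bar> ^ N))) (k_grow K)"
    unfolding k_grow_def
    by (intro bmom_scale bmom_add bmom_const bmom_power bmom_abs y_moments assms)
  show "\<bar>h \<omega>\<bar> \<le> \<bar>A * (1 + (\<bar>fst (Z k \<omega>)\<bar> ^ N + \<bar>z \<omega>\<bar> ^ N))\<bar>" for \<omega>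
    using assms(4)[of \<omega>] by (simp add: add.assoc)
qed fact

text \<open>\<open>|x|\<^sup>2\<close> is the average of the p squares of
  \<open>sqrt p x\<^sub>i\<close>, and each coordinate is the linear form of a unit vector, so the
  average bound is free of p. The passage to the norm uses
  \<open>|x| \<le> 1 + |x|\<^sup>2\<close>.\<close>

lemma bmom_x:
  assumes k: "k \<in> {0..n}"
  shows "bmom M (\<lambda>\<omega>. nrm p (snd (Z k \<omega>))) k_x"
proof -
  let ?e = "\<lambda>i j. if j = i then 1 else 0 :: real"
  have e: "bmom M (\<lambda>\<omega>. (sqrt (real p) * snd (Z k \<omega>) i)\<^sup>2) (kpow 2 (kgauss C_X (kconst 1)))" if i: "i < p" for i
  proof -
    have "nrm p (?e i) = 1"
      using i by (auto simp: L2_set_def if_distrib[of "\<lambda>x. x\<^sup>2"] sum.delta cong: if_cong)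
    then have "bmom M (\<lambda>\<omega>. nrm p (?e i)) (kconst 1)" using bmom_const[of 1] by simp
    moreover have "dotp p x (?e i) = x i" for x
    proof -
      have "dotp p x (?e i) = (\<Sum>j<p. if j = i then x j else 0)"
        unfolding dotp_def by (intro sum.cong) auto
      then show ?thesis using i by simp
    qed
    ultimately have "bmom M (\<lambda>\<omega>. sqrt (real p) * snd (Z k \<omega>) i) (kgauss C_X (kconst 1))"
      using bmom_linear[of "{}" k "\<lambda>_. ?e i" "kconst 1"] k i by (simp add: Rn_iff)
    then show ?thesis by (rule bmom_power)
  qed
  have "bmom M (\<lambda>\<omega>. (\<Sum>i<p. \<bar>(sqrt (real p) * snd (Z k \<omega>) i)\<^sup>2\<bar>) / card {..<p}) (kpow 2 (kgauss C_X (kconst 1)))"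
    by (rule bmom_average) (use p_pos e in auto)
  moreover have "(\<Sum>i<p. \<bar>(sqrt (real p) * x i)\<^sup>2\<bar>) / card {..<p} = (nrm p x)\<^sup>2" for x
    using p_pos by (simp add: power_mult_distrib sum_nonneg L2_set_def flip: sum_distrib_left)
  ultimately have sq: "bmom M (\<lambda>\<omega>. (nrm p (snd (Z k \<omega>)))\<^sup>2) (kpow 2 (kgauss C_X (kconst 1)))" by simp
  show ?thesis
  proof (rule bmom_mono)
    show "bmom M (\<lambda>\<omega>. 1 + (nrm p (snd (Z k \<omega>)))\<^sup>2) k_x"
      unfolding k_x_def by (intro bmom_add bmom_const sq)
    have "(\<lambda>\<omega>. sqrt ((nrm p (snd (Z k \<omega>)))\<^sup>2)) \<in> borel_measurable M"
      by (rule measurable_compose[OF bmom_measurable[OF sq]]) simp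
    then show "(\<lambda>\<omega>. nrm p (snd (Z k \<omega>))) \<in> borel_measurable M" by (simp add: L2_set_nonneg)
    fix \<omega>
    have "2 * nrm p (snd (Z k \<omega>)) \<le> 1 + (nrm p (snd (Z k \<omega>)))\<^sup>2"
      using sum_squares_bound[of 1 "nrm p (snd (Z k \<omega>))"] by simp
    then show "\<bar>nrm p (snd (Z k \<omega>))\<bar> \<le> \<bar>1 + (nrm p (snd (Z k \<omega>)))\<^sup>2\<bar>"
      using L2_set_nonneg[of "snd (Z k \<omega>)" "{..<p}"] by linarith
  qed
qed

lemma data_measurable: "J \<subseteq> {0..n} \<Longrightarrow> (\<lambda>\<omega>. restrict (data \<omega>) J) \<in> measurable M (Pi\<^sub>M J (\<lambda>_. borel))"
  unfolding data_def by (rule measurable_restrict) (auto intro: Z_measurable)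

lemma est_data_measurable:
  assumes "J \<subseteq> {0..n}"
  shows "(\<lambda>\<omega>. est J (data \<omega>)) \<in> borel_measurable M"
  using measurable_compose[OF data_measurable[OF assms] est_measurable[OF subset_refl]]
  by (simp add: est_restrict)

text \<open>The losses at \<open>b0\<close> have bounded moments because \<open>x\<^sup>T b0\<close>
  is Gaussian with bounded variance. Their sum divided by p is \<gamma>0 times a sum divided by n,
  which \<open>bmom_average\<close> bounds uniformly in \<open>J\<close>; fits without two
  observations are thus included.\<close>

lemma bmom_est:
  assumes J: "J \<subseteq> {1..n}"
  shows "bmom M (\<lambda>\<omega>. nrm p (est J (data \<omega>)) / sqrt (real p)) k_est"
proof -
  let ?L = "\<lambda>j \<omega>. l (fst (Z j \<omega>)) (dotp p (snd (Z j \<omega>)) b0)"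
  let ?K = "kgauss C_X (kconst (sqrt (\<kappa> / \<eta>)))"
  have b0R: "b0 \<in> Rn p" using b0 Theta_sub by auto
  have "\<eta> * (nrm p b0)\<^sup>2 \<le> \<kappa> * real p" using enet_nonneg[OF b0R] b0(2) by linarith
  then have "(nrm p b0 / sqrt (real p))\<^sup>2 \<le> \<kappa> / \<eta>"
    using p_pos eta_pos by (simp add: power_divide field_simps)
  then have "sqrt ((nrm p b0 / sqrt (real p))\<^sup>2) \<le> sqrt (\<kappa> / \<eta>)" by (rule real_sqrt_le_mono)
  then have "nrm p b0 / sqrt (real p) \<le> sqrt (\<kappa> / \<eta>)" by (simp add: L2_set_nonneg)
  then have lin: "bmom M (\<lambda>\<omega>. dotp p (snd (Z j \<omega>)) b0) ?K" if "j \<in> {1..n}" for j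
    using that by (intro bmom_linear_const b0R) auto
  have L: "bmom M (?L j) (k_grow ?K)" if j: "j \<in> {1..n}" for j
  proof (rule bmom_grow[OF _ lin[OF j]])
    show "?L j \<in> borel_measurable M"
      using j by (intro smooth_convex_loss_compose_measurable[OF loss] y_measurable
          measurable_compose[OF x_measurable dotp_measurable]) auto
  qed (use j loss_growth in auto)
  have avg: "bmom M (\<lambda>\<omega>. (\<Sum>j\<in>J. \<bar>?L j \<omega>\<bar>) / card {1..n}) (k_grow ?K)"
    by (rule bmom_average) (use n_pos J L in auto)
  show ?thesis
  proof (rule bmom_mono)
    show "bmom M (\<lambda>\<omega>. (1 + \<kappa> / \<eta>) + \<gamma>0 / (lam * \<eta>) * ((\<Sum>j\<in>J. \<bar>?L j \<omega>\<bar>) / card {1..n})) k_est"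
      unfolding k_est_def by (intro bmom_add bmom_const bmom_scale avg)
    show "(\<lambda>\<omega>. nrm p (est J (data \<omega>)) / sqrt (real p)) \<in> borel_measurable M"
      using J by (intro borel_measurable_divide borel_measurable_const nrm_measurable est_data_measurable) auto
    fix \<omega>
    let ?h = "nrm p (est J (data \<omega>)) / sqrt (real p)"
    have h0: "0 \<le> ?h" by (simp add: L2_set_nonneg)
    have g0: "\<gamma>0 = real n / real p" using ratio p_pos by simp
    have "lam * \<eta> * (nrm p (est J (data \<omega>)))\<^sup>2 \<le> (\<Sum>j\<in>J. ?L j \<omega>) + lam * enet_reg p \<eta> r0 b0"
      using est_norm_bound[OF b0(1), of J "data \<omega>"] by (simp add: data_def)
    also have "\<dots> \<le> (\<Sum>j\<in>J. \<bar>?L j \<omega>\<bar>) + lam * (\<kappa> * real p)"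
      using lam_pos b0(2) by (intro add_mono sum_mono mult_left_mono) auto
    finally have est: "(nrm p (est J (data \<omega>)))\<^sup>2 \<le> ((\<Sum>j\<in>J. \<bar>?L j \<omega>\<bar>) + lam * (\<kappa> * real p)) / (lam * \<eta>)"
      using lam_pos eta_pos by (simp add: pos_le_divide_eq mult_ac)
    have "?h\<^sup>2 = (nrm p (est J (data \<omega>)))\<^sup>2 / real p" by (simp add: power_divide)
    also have "\<dots> \<le> ((\<Sum>j\<in>J. \<bar>?L j \<omega>\<bar>) + lam * (\<kappa> * real p)) / (lam * \<eta>) / real p"
      by (rule divide_right_mono[OF est]) simp
    also have "\<dots> = \<kappa> / \<eta> + \<gamma>0 / (lam * \<eta>) * ((\<Sum>j\<in>J. \<bar>?L j \<omega>\<bar>) / card {1..n})"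
      unfolding g0 using lam_pos eta_pos p_pos n_pos by (simp add: field_simps)
    finally have h2: "?h\<^sup>2 \<le> \<kappa> / \<eta> + \<gamma>0 / (lam * \<eta>) * ((\<Sum>j\<in>J. \<bar>?L j \<omega>\<bar>) / card {1..n})" .
    have "2 * ?h \<le> 1 + ?h\<^sup>2" using sum_squares_bound[of 1 ?h] by simp
    then show "\<bar>?h\<bar> \<le> \<bar>(1 + \<kappa> / \<eta>) + \<gamma>0 / (lam * \<eta>) * ((\<Sum>j\<in>J. \<bar>?L j \<omega>\<bar>) / card {1..n})\<bar>"
      using h2 h0 by linarith
  qed
qed

lemma bmom_lin:
  assumes J: "J \<subseteq> {1..n}" and k: "k \<in> {0..n}" "k \<notin> J"
  shows "bmom M (\<lambda>\<omega>. dotp p (snd (Z k \<omega>)) (est J (data \<omega>))) k_lin"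
proof -
  have "J \<subseteq> {0..n}" using J by auto
  from bmom_linear_scaled[OF this k est_measurable[OF subset_refl] est_in_Rn, of k_est] bmom_est[OF J]
  show ?thesis by (simp add: est_restrict k_lin_def)
qed

lemma V_measurable:
  assumes "J \<subseteq> {0..n}" "k \<in> {0..n}"
  shows "V J k \<in> borel_measurable M"
  unfolding V_def err_def fst_conv snd_conv
  by (intro smooth_convex_loss_compose_measurable[OF phi] dotp_measurable2 y_measurable
      x_measurable est_data_measurable assms)

lemma bmom_V:
  assumes J: "J \<subseteq> {1..n}" and k: "k \<in> {0..n}" "k \<notin> J"
  shows "bmom M (V J k) k_phi"
  unfolding k_phi_def
proof (rule bmom_grow[OF k(1) bmom_lin[OF J k]])
  show "V J k \<in> borel_measurable M" using J k by (intro V_measurable) auto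
qed (simp add: V_def err_def phi_growth)

text \<open>The derivative in \<open>est_stability\<close> is taken at the fit without
  \<open>i\<close>, so its argument falls under \<open>bmom_lin\<close>. It and
  \<open>nrm p (snd (Z i \<omega>))\<close> are dependent, hence the product bound.\<close>

lemma bmom_delta:
  assumes J: "J \<subseteq> {1..n}" and i: "i \<in> J"
  shows "bmom M (\<lambda>\<omega>. nrm p (diff_Rn (est J (data \<omega>)) (est (J - {i}) (data \<omega>)))) k_delta"
proof -
  let ?d = "\<lambda>\<omega>. deriv (l (fst (Z i \<omega>))) (dotp p (snd (Z i \<omega>)) (est (J - {i}) (data \<omega>)))"
  have i0: "i \<in> {0..n}" "J \<subseteq> {0..n}" "J - {i} \<subseteq> {0..n}" "J - {i} \<subseteq> {1..n}" using i J by auto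
  have fin: "finite J" using J finite_subset by blast
  have d: "bmom M ?d k_phi"
    unfolding k_phi_def
  proof (rule bmom_grow[OF i0(1) bmom_lin[OF i0(4) i0(1)]])
    show "?d \<in> borel_measurable M"
      by (intro deriv_measurable[OF loss] y_measurable dotp_measurable2 x_measurable est_data_measurable i0)
  qed (auto simp: loss_deriv_growth)
  show ?thesis
  proof (rule bmom_mono)
    show "bmom M (\<lambda>\<omega>. 1 / (2 * (lam * \<eta>)) * (?d \<omega> * nrm p (snd (Z i \<omega>)))) k_delta"
      unfolding k_delta_def by (intro bmom_scale bmom_mult d bmom_x i0)
    show "(\<lambda>\<omega>. nrm p (diff_Rn (est J (data \<omega>)) (est (J - {i}) (data \<omega>)))) \<in> borel_measurable M"
      by (intro nrm_measurable diff_measurable est_data_measurable i0)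
    fix \<omega>
    have "2 * (lam * \<eta>) * nrm p (diff_Rn (est J (data \<omega>)) (est (J - {i}) (data \<omega>)))
        \<le> \<bar>?d \<omega>\<bar> * nrm p (snd (Z i \<omega>))"
      using est_stability[OF fin i, of "data \<omega>"] by (simp add: data_def)
    then show "\<bar>nrm p (diff_Rn (est J (data \<omega>)) (est (J - {i}) (data \<omega>)))\<bar>
        \<le> \<bar>1 / (2 * (lam * \<eta>)) * (?d \<omega> * nrm p (snd (Z i \<omega>)))\<bar>"
      using lam_pos eta_pos by (simp add: abs_mult L2_set_nonneg pos_le_divide_eq mult_ac)
  qed
qed

text \<open>Tangents at both points give the two signs, and \<open>|a| + |b|\<close> dominates
  either argument of the derivative. The outer bars around that sum give the shape that
  \<open>bmom_power\<close> and \<open>bmom_abs\<close> produce.\<close>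

lemma phi_diff:
  "\<bar>\<phi> y a - \<phi> y b\<bar> \<le> \<bar>A * (1 + \<bar>y\<bar> ^ N + \<bar>\<bar>a\<bar> + \<bar>b\<bar>\<bar> ^ N) * (a - b)\<bar>"
proof -
  let ?B = "A * (1 + \<bar>y\<bar> ^ N + \<bar>\<bar>a\<bar> + \<bar>b\<bar>\<bar> ^ N)"
  \<comment> \<open>At (1, 1) the growth bound reads \<open>0 \<le> 3 A\<close>, whatever
    \<open>N\<close> is.\<close>
  have A0: "0 \<le> A"
    using order_trans[OF abs_ge_zero phi_growth[of 1 1]] by simp
  have d: "\<bar>deriv (\<phi> y) c\<bar> \<le> ?B" if "\<bar>c\<bar> \<le> \<bar>a\<bar> + \<bar>b\<bar>" for c
    using that A0 by (intro order_trans[OF phi_deriv_growth] mult_left_mono add_left_mono power_mono) auto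
  have "\<phi> y a - \<phi> y b \<le> \<bar>deriv (\<phi> y) a\<bar> * \<bar>a - b\<bar>"
    by (rule order_trans[OF smooth_convex_loss_tangent[OF phi]]) (simp flip: abs_mult)
  also have "\<dots> \<le> ?B * \<bar>a - b\<bar>" by (intro mult_right_mono d) auto
  finally have 1: "\<phi> y a - \<phi> y b \<le> ?B * \<bar>a - b\<bar>" .
  have "\<phi> y b - \<phi> y a \<le> \<bar>deriv (\<phi> y) b\<bar> * \<bar>b - a\<bar>"
    by (rule order_trans[OF smooth_convex_loss_tangent[OF phi]]) (simp flip: abs_mult)
  also have "\<dots> \<le> ?B * \<bar>b - a\<bar>" by (intro mult_right_mono d) auto
  finally have 2: "\<phi> y b - \<phi> y a \<le> ?B * \<bar>a - b\<bar>" by (simp add: abs_minus_commute)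
  have "?B * \<bar>a - b\<bar> \<le> \<bar>?B * (a - b)\<bar>" by (simp add: abs_mult mult_right_mono)
  then show ?thesis using 1 2 by linarith
qed

text \<open>The difference of the two fits is a function of the observations in \<open>J\<close>, so
  \<open>x\<^sub>k\<close> is independent of it and \<open>bmom_linear\<close> gains the factor
  \<open>sqrt p\<close>. The local Lipschitz factor \<open>g\<close> depends on
  \<open>x\<^sub>k\<close> as well and is split off by \<open>bmom_mult\<close>.\<close>

lemma bmom_diff:
  assumes J: "J \<subseteq> {1..n}" and i: "i \<in> J" and k: "k \<in> {0..n}" "k \<notin> J"
  shows "bmom M (\<lambda>\<omega>. sqrt (real p) * (V J k \<omega> - V (J - {i}) k \<omega>)) k_diff"
proof -
  let ?a = "\<lambda>\<omega>. dotp p (snd (Z k \<omega>)) (est J (data \<omega>))"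
  let ?b = "\<lambda>\<omega>. dotp p (snd (Z k \<omega>)) (est (J - {i}) (data \<omega>))"
  have J0: "J \<subseteq> {0..n}" "J - {i} \<subseteq> {0..n}" "J - {i} \<subseteq> {1..n}" "k \<notin> J - {i}" using k J by auto
  have ab: "bmom M (\<lambda>\<omega>. \<bar>?a \<omega>\<bar> + \<bar>?b \<omega>\<bar>) (kadd k_lin k_lin)"
    by (intro bmom_add bmom_abs bmom_lin J J0 k)
  define g where "g \<omega> = A * (1 + \<bar>fst (Z k \<omega>)\<bar> ^ N + \<bar>\<bar>?a \<omega>\<bar> + \<bar>?b \<omega>\<bar>\<bar> ^ N)" for \<omega>
  have g: "bmom M g (k_grow (kadd k_lin k_lin))"
  proof -
    have "bmom M (\<lambda>\<omega>. A * (1 + (\<bar>fst (Z k \<omega>)\<bar> ^ N + \<bar>\<bar>?a \<omega>\<bar> + \<bar>?b \<omega>\<bar>\<bar> ^ N))) (k_grow (kadd k_lin k_lin))"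
      unfolding k_grow_def
      by (intro bmom_scale bmom_add[OF bmom_const] bmom_add[OF bmom_power bmom_power] bmom_abs ab y_moments k)
    then show ?thesis unfolding g_def by (simp add: add.assoc)
  qed
  have "bmom M (\<lambda>\<omega>. sqrt (real p) * dotp p (snd (Z k \<omega>))
      (diff_Rn (est J (restrict (data \<omega>) J)) (est (J - {i}) (restrict (data \<omega>) J)))) (kgauss C_X k_delta)"
  proof (rule bmom_linear[OF J0(1) k])
    show "(\<lambda>u. diff_Rn (est J u) (est (J - {i}) u)) \<in> borel_measurable (Pi\<^sub>M J (\<lambda>_. borel))"
      by (intro diff_measurable est_measurable) auto
    show "diff_Rn (est J u) (est (J - {i}) u) \<in> Rn p" for u
      using est_in_Rn[of J u] est_in_Rn[of "J - {i}" u] by (simp add: Rn_iff)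
    show "bmom M (\<lambda>\<omega>. nrm p (diff_Rn (est J (restrict (data \<omega>) J)) (est (J - {i}) (restrict (data \<omega>) J)))) k_delta"
      using bmom_delta[OF J i] by (simp add: est_restrict)
  qed
  then have d: "bmom M (\<lambda>\<omega>. sqrt (real p) * (?a \<omega> - ?b \<omega>)) (kgauss C_X k_delta)"
    by (simp add: est_restrict dotp_diff_right)
  show ?thesis
  proof (rule bmom_mono)
    show "bmom M (\<lambda>\<omega>. g \<omega> * (sqrt (real p) * (?a \<omega> - ?b \<omega>))) k_diff"
      unfolding k_diff_def by (rule bmom_mult[OF g d])
    show "(\<lambda>\<omega>. sqrt (real p) * (V J k \<omega> - V (J - {i}) k \<omega>)) \<in> borel_measurable M"
      using V_measurable[OF J0(1) k(1)] V_measurable[OF J0(2) k(1)] by simp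
    fix \<omega>
    have "\<bar>V J k \<omega> - V (J - {i}) k \<omega>\<bar> \<le> \<bar>g \<omega> * (?a \<omega> - ?b \<omega>)\<bar>"
      unfolding V_def err_def g_def fst_conv snd_conv by (rule phi_diff)
    then have "sqrt (real p) * \<bar>V J k \<omega> - V (J - {i}) k \<omega>\<bar> \<le> sqrt (real p) * \<bar>g \<omega> * (?a \<omega> - ?b \<omega>)\<bar>"
      by (rule mult_left_mono) simp
    then show "\<bar>sqrt (real p) * (V J k \<omega> - V (J - {i}) k \<omega>)\<bar> \<le> \<bar>g \<omega> * (sqrt (real p) * (?a \<omega> - ?b \<omega>))\<bar>"
      by (simp add: abs_mult mult_ac)
  qed
qed

lemma V_diff:
  assumes "J \<subseteq> {1..n}" "i \<in> J" "k \<in> {0..n}" "k \<notin> J"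
  shows V_diff_integrable: "integrable M (\<lambda>\<omega>. (V J k \<omega> - V (J - {i}) k \<omega>)\<^sup>2)"
    and V_diff_le: "(\<integral>\<omega>. (V J k \<omega> - V (J - {i}) k \<omega>)\<^sup>2 \<partial>M) \<le> \<gamma>0 * k_diff 2 / real n"
proof -
  have eq: "(sqrt (real p) * (V J k \<omega> - V (J - {i}) k \<omega>))\<^sup>2 = real p * (V J k \<omega> - V (J - {i}) k \<omega>)\<^sup>2" for \<omega>
    by (simp add: power_mult_distrib)
  note d = bmom_diff[OF assms]
  show "integrable M (\<lambda>\<omega>. (V J k \<omega> - V (J - {i}) k \<omega>)\<^sup>2)"
    using bmom_integrable2[OF d] p_pos unfolding eq by simp
  have "real p * (\<integral>\<omega>. (V J k \<omega> - V (J - {i}) k \<omega>)\<^sup>2 \<partial>M) \<le> k_diff 2"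
    using bmom_le2[OF d] unfolding eq by simp
  then have "(\<integral>\<omega>. (V J k \<omega> - V (J - {i}) k \<omega>)\<^sup>2 \<partial>M) \<le> k_diff 2 / real p"
    using p_pos by (simp add: pos_le_divide_eq mult.commute)
  also have "\<dots> = \<gamma>0 * k_diff 2 / real n"
  proof -
    have "\<gamma>0 = real n / real p" using ratio p_pos by simp
    then show ?thesis using n_pos by simp
  qed
  finally show "(\<integral>\<omega>. (V J k \<omega> - V (J - {i}) k \<omega>)\<^sup>2 \<partial>M) \<le> \<gamma>0 * k_diff 2 / real n" .
qed

section \<open>The out-of-sample risk of a fit and its stability\<close>

lemma law_eq: "k \<in> {0..n} \<Longrightarrow> distr M borel (Z k) = law"
  unfolding law_def by (rule ident)

lemma err_measurable:
  assumes "J' \<subseteq> J"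
  shows "err J' \<in> borel_measurable (Pi\<^sub>M J (\<lambda>_. borel) \<Otimes>\<^sub>M borel)"
  unfolding err_def
  by (intro smooth_convex_loss_compose_measurable[OF phi] dotp_measurable2
      measurable_compose[OF measurable_snd fst_obs_measurable]
      measurable_compose[OF measurable_snd snd_obs_measurable]
      measurable_compose[OF measurable_fst est_measurable[OF assms]])

lemma err_restrict: "J' \<subseteq> J \<Longrightarrow> err J' (restrict u J, z) = err J' (u, z)"
  by (simp add: err_def est_restrict)

lemma risk_restrict: "J' \<subseteq> J \<Longrightarrow> risk J' (restrict u J) = risk J' u"
  by (simp add: risk_def err_restrict)

text \<open>For fixed \<open>u\<close> the fit is a constant vector, so integrability holds at every
  \<open>u\<close> and risks can be subtracted pointwise, without exceptional null sets. The moment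
  bound here depends on \<open>u\<close>.\<close>

lemma err_integrable: "integrable law (\<lambda>z. err J (u, z))"
proof -
  let ?b = "est J u"
  have m: "(\<lambda>z. err J (u, z)) \<in> borel_measurable borel"
    unfolding err_def fst_conv snd_conv
    by (intro smooth_convex_loss_compose_measurable[OF phi] fst_obs_measurable
        measurable_compose[OF snd_obs_measurable dotp_measurable])
  have Z0: "Z 0 \<in> borel_measurable M" by (rule Z_measurable) simp
  have "bmom M (\<lambda>\<omega>. dotp p (snd (Z 0 \<omega>)) ?b) (kgauss C_X (kconst (nrm p ?b / sqrt (real p))))"
    by (rule bmom_linear_const) (auto simp: est_in_Rn)
  then have "bmom M (\<lambda>\<omega>. err J (u, Z 0 \<omega>)) (k_grow (kgauss C_X (kconst (nrm p ?b / sqrt (real p)))))"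
    by (rule bmom_grow[of 0, rotated]) (use measurable_compose[OF Z0 m] in \<open>auto simp: err_def phi_growth\<close>)
  then have "integrable M (\<lambda>\<omega>. err J (u, Z 0 \<omega>))" by (rule bmom_integrable1)
  then show ?thesis unfolding law_def using Z0 m by (simp add: integrable_distr_eq)
qed

lemma risk_diff_eq: "(\<integral>z. err J (u, z) - err J' (u, z) \<partial>law) = risk J u - risk J' u"
  unfolding risk_def by (rule Bochner_Integration.integral_diff[OF err_integrable err_integrable])

lemma V_restrict: "J' \<subseteq> J \<Longrightarrow> err J' (restrict (data \<omega>) J, Z k \<omega>) = V J' k \<omega>"
  by (simp add: V_def err_restrict)

text \<open>The risk is the conditional mean of \<open>V J 0\<close>, which bounds its second moment
  by that of \<open>V J 0\<close>. The larger index set \<open>J''\<close> is for test functions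
  that involve observations outside the fit.\<close>

lemma risk_facts:
  assumes J: "J \<subseteq> {1..n}"
  shows risk_data_measurable: "(\<lambda>\<omega>. risk J (data \<omega>)) \<in> borel_measurable M"
    and risk_square_integrable: "integrable M (\<lambda>\<omega>. (risk J (data \<omega>))\<^sup>2)"
    and risk_square_le: "(\<integral>\<omega>. (risk J (data \<omega>))\<^sup>2 \<partial>M) \<le> k_phi 2"
    and risk_measurable: "\<And>J''. J \<subseteq> J'' \<Longrightarrow> J'' \<subseteq> {1..n} \<Longrightarrow> risk J \<in> borel_measurable (Pi\<^sub>M J'' (\<lambda>_. borel))"
proof -
  have k0: "(0::nat) \<in> {0..n}" "0 \<notin> J''" "J'' \<subseteq> {0..n}" if "J'' \<subseteq> {1..n}" for J'' using that by auto
  note V = bmom_V[OF J k0(1,2)[OF J]]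
  have gen: "risk J \<in> borel_measurable (Pi\<^sub>M J'' (\<lambda>_. borel))"
    "integrable M (\<lambda>\<omega>. (risk J (data \<omega>))\<^sup>2)" "(\<integral>\<omega>. (risk J (data \<omega>))\<^sup>2 \<partial>M) \<le> (\<integral>\<omega>. (V J 0 \<omega>)\<^sup>2 \<partial>M)"
    if "J \<subseteq> J''" "J'' \<subseteq> {1..n}" for J''
  proof -
    note ind = indep_obs[OF k0(3)[OF that(2)] k0(1,2)[OF that(2)]]
    have int: "integrable M (\<lambda>\<omega>. (err J (restrict (data \<omega>) J'', Z 0 \<omega>))\<^sup>2)"
      unfolding V_restrict[OF that(1)] by (rule bmom_integrable2[OF V])
    note facts = indep_conditional_mean[OF ind err_measurable[OF that(1)] int]
    have R: "(\<lambda>u. \<integral>z. err J (u, z) \<partial>distr M borel (Z 0)) = risk J"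
      by (simp add: risk_def law_def fun_eq_iff)
    show "risk J \<in> borel_measurable (Pi\<^sub>M J'' (\<lambda>_. borel))" using facts(1) unfolding R .
    show "integrable M (\<lambda>\<omega>. (risk J (data \<omega>))\<^sup>2)"
      using facts(2) unfolding R[THEN fun_cong] risk_restrict[OF that(1)] .
    show "(\<integral>\<omega>. (risk J (data \<omega>))\<^sup>2 \<partial>M) \<le> (\<integral>\<omega>. (V J 0 \<omega>)\<^sup>2 \<partial>M)"
      using facts(3) unfolding R[THEN fun_cong] risk_restrict[OF that(1)] V_restrict[OF that(1)] .
  qed
  show "(\<lambda>\<omega>. risk J (data \<omega>)) \<in> borel_measurable M"
    using measurable_compose[OF data_measurable[OF k0(3)[OF J]] gen(1)[OF subset_refl J]]
    by (simp add: risk_restrict)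
  show "integrable M (\<lambda>\<omega>. (risk J (data \<omega>))\<^sup>2)" by (rule gen(2)[OF subset_refl J])
  show "(\<integral>\<omega>. (risk J (data \<omega>))\<^sup>2 \<partial>M) \<le> k_phi 2"
    using gen(3)[OF subset_refl J] bmom_le2[OF V] by linarith
  show "risk J \<in> borel_measurable (Pi\<^sub>M J'' (\<lambda>_. borel))" if "J \<subseteq> J''" "J'' \<subseteq> {1..n}" for J''
    by (rule gen(1)[OF that])
qed

text \<open>The contraction is applied to the difference of two errors at the fresh observation 0,
  so stability of the risk is inherited from \<open>V_diff\<close> with the same constant.\<close>

lemma risk_diff:
  assumes J: "J \<subseteq> {1..n}" and i: "i \<in> J"
  shows risk_diff_integrable: "integrable M (\<lambda>\<omega>. (risk J (data \<omega>) - risk (J - {i}) (data \<omega>))\<^sup>2)"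
    and risk_diff_le: "(\<integral>\<omega>. (risk J (data \<omega>) - risk (J - {i}) (data \<omega>))\<^sup>2 \<partial>M) \<le> \<gamma>0 * k_diff 2 / real n"
proof -
  have k0: "(0::nat) \<in> {0..n}" "0 \<notin> J" "J \<subseteq> {0..n}" using J by auto
  have sub: "J - {i} \<subseteq> J" by auto
  note ind = indep_obs[OF k0(3,1,2)]
  let ?f = "\<lambda>w. err J w - err (J - {i}) w"
  have m: "?f \<in> borel_measurable (Pi\<^sub>M J (\<lambda>_. borel) \<Otimes>\<^sub>M borel)"
    by (intro borel_measurable_diff err_measurable subset_refl sub)
  have int: "integrable M (\<lambda>\<omega>. (?f (restrict (data \<omega>) J, Z 0 \<omega>))\<^sup>2)"
    unfolding V_restrict[OF subset_refl] V_restrict[OF sub] by (rule V_diff_integrable[OF J i k0(1,2)])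
  note facts = indep_conditional_mean[OF ind m int]
  have R: "(\<integral>z. ?f (restrict (data \<omega>) J, z) \<partial>distr M borel (Z 0))
      = risk J (data \<omega>) - risk (J - {i}) (data \<omega>)" for \<omega>
    by (simp add: law_eq risk_diff_eq risk_restrict[OF sub] risk_restrict[OF subset_refl])
  show "integrable M (\<lambda>\<omega>. (risk J (data \<omega>) - risk (J - {i}) (data \<omega>))\<^sup>2)"
    using facts(2) unfolding R .
  show "(\<integral>\<omega>. (risk J (data \<omega>) - risk (J - {i}) (data \<omega>))\<^sup>2 \<partial>M) \<le> \<gamma>0 * k_diff 2 / real n"
    using facts(3) V_diff_le[OF J i k0(1,2)]
    unfolding R V_restrict[OF subset_refl] V_restrict[OF sub] by linarith
qed

section \<open>Centred prediction errors and their near-orthogonality\<close>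

lemma W_facts:
  assumes J: "J \<subseteq> {1..n}" and k: "k \<in> {0..n}" "k \<notin> J"
  shows W_measurable: "W J k \<in> borel_measurable M"
    and W_square_integrable: "integrable M (\<lambda>\<omega>. (W J k \<omega>)\<^sup>2)"
    and W_square_le: "(\<integral>\<omega>. (W J k \<omega>)\<^sup>2 \<partial>M) \<le> 4 * k_phi 2"
proof -
  note V = bmom_V[OF J k]
  note Vm = bmom_measurable[OF V] and Vi = bmom_integrable2[OF V]
    and Rm = risk_data_measurable[OF J] and Ri = risk_square_integrable[OF J]
  show "W J k \<in> borel_measurable M"
    unfolding W_def[abs_def] by (rule borel_measurable_diff[OF Vm Rm])
  show "integrable M (\<lambda>\<omega>. (W J k \<omega>)\<^sup>2)"
    unfolding W_def by (rule integrable_square_diff[OF Vm Rm Vi Ri])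
  show "(\<integral>\<omega>. (W J k \<omega>)\<^sup>2 \<partial>M) \<le> 4 * k_phi 2"
    unfolding W_def using integral_square_diff_le[OF Vm Rm Vi Ri] bmom_le2[OF V] risk_square_le[OF J]
    by linarith
qed

lemma W_diff:
  assumes J: "J \<subseteq> {1..n}" and i: "i \<in> J" and k: "k \<in> {0..n}" "k \<notin> J"
  shows W_diff_integrable: "integrable M (\<lambda>\<omega>. (W J k \<omega> - W (J - {i}) k \<omega>)\<^sup>2)"
    and W_diff_le: "(\<integral>\<omega>. (W J k \<omega> - W (J - {i}) k \<omega>)\<^sup>2 \<partial>M) \<le> 4 * (\<gamma>0 * k_diff 2 / real n)"
proof -
  have J': "J - {i} \<subseteq> {1..n}" "k \<notin> J - {i}" using J k by auto
  let ?v = "\<lambda>\<omega>. V J k \<omega> - V (J - {i}) k \<omega>" and ?r = "\<lambda>\<omega>. risk J (data \<omega>) - risk (J - {i}) (data \<omega>)"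
  have eq: "W J k \<omega> - W (J - {i}) k \<omega> = ?v \<omega> - ?r \<omega>" for \<omega> by (simp add: W_def)
  have vm: "?v \<in> borel_measurable M"
    by (intro borel_measurable_diff bmom_measurable[OF bmom_V] J J' k)
  have rm: "?r \<in> borel_measurable M"
    by (intro borel_measurable_diff risk_data_measurable J J')
  note vi = V_diff_integrable[OF J i k] and ri = risk_diff_integrable[OF J i]
  show "integrable M (\<lambda>\<omega>. (W J k \<omega> - W (J - {i}) k \<omega>)\<^sup>2)"
    unfolding eq by (rule integrable_square_diff[OF vm rm vi ri])
  show "(\<integral>\<omega>. (W J k \<omega> - W (J - {i}) k \<omega>)\<^sup>2 \<partial>M) \<le> 4 * (\<gamma>0 * k_diff 2 / real n)"
    unfolding eq using integral_square_diff_le[OF vm rm vi ri] V_diff_le[OF J i k] risk_diff_le[OF J i]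
    by linarith
qed

text \<open>\<open>J'\<close> is the set used for fitting; \<open>G\<close> may depend on more observations, as long as \<open>k\<close> is not among them.\<close>

lemma W_orthogonal:
  assumes J: "J' \<subseteq> J" "J \<subseteq> {1..n}" and k: "k \<in> {0..n}" "k \<notin> J"
    and G: "G \<in> borel_measurable (Pi\<^sub>M J (\<lambda>_. borel))"
      "integrable M (\<lambda>\<omega>. (G (restrict (data \<omega>) J))\<^sup>2)"
  shows "(\<integral>\<omega>. G (restrict (data \<omega>) J) * W J' k \<omega> \<partial>M) = 0"
proof -
  have sub: "J' \<subseteq> {1..n}" "k \<notin> J'" "J \<subseteq> {0..n}" using J k by auto
  note ind = indep_obs[OF sub(3) k]
  note V = bmom_V[OF sub(1) k(1) sub(2)]
  let ?G = "\<lambda>\<omega>. G (restrict (data \<omega>) J)"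
  have Gm: "?G \<in> borel_measurable M"
    by (rule measurable_compose[OF data_measurable[OF sub(3)] G(1)])
  have int: "integrable M (\<lambda>\<omega>. (err J' (restrict (data \<omega>) J, Z k \<omega>))\<^sup>2)"
    unfolding V_restrict[OF J(1)] by (rule bmom_integrable2[OF V])
  have GV: "integrable M (\<lambda>\<omega>. ?G \<omega> * V J' k \<omega>)"
    by (rule integrable_mult_L2[OF Gm bmom_measurable[OF V] G(2) bmom_integrable2[OF V]])
  have GR: "integrable M (\<lambda>\<omega>. ?G \<omega> * risk J' (data \<omega>))"
    by (rule integrable_mult_L2[OF Gm risk_data_measurable[OF sub(1)] G(2) risk_square_integrable[OF sub(1)]])
  have "(\<integral>\<omega>. ?G \<omega> * V J' k \<omega> \<partial>M) = (\<integral>\<omega>. ?G \<omega> * risk J' (data \<omega>) \<partial>M)"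
    using indep_conditional_mean_eq[OF ind err_measurable[OF J(1)] int G(1)] GV
    unfolding V_restrict[OF J(1)] law_eq[OF k(1)] risk_def[symmetric] risk_restrict[OF J(1)] by blast
  then show ?thesis using GV GR by (simp add: W_def right_diff_distrib)
qed

text \<open>The errors computed on \<open>K\<close> do not see the other index: \<open>W K i\<close>
  is a function of the observations other than \<open>j\<close>, while \<open>W Jj j\<close> and
  \<open>W K j\<close> have conditional mean zero given these. Hence \<open>W K i\<close> is
  orthogonal to both, and symmetrically \<open>W K j\<close> to \<open>W Ji i\<close>.\<close>

lemma W_cross_le:
  assumes ij: "i \<in> {1..n}" "j \<in> {1..n}" "i \<noteq> j"
  shows "(\<integral>\<omega>. W ({1..n} - {i}) i \<omega> * W ({1..n} - {j}) j \<omega> \<partial>M) \<le> 4 * (\<gamma>0 * k_diff 2 / real n)"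
proof -
  define Ji where "Ji = {1..n} - {i}"
  define Jj where "Jj = {1..n} - {j}"
  define K where "K = {1..n} - {i} - {j}"
  have sub: "Ji \<subseteq> {1..n}" "Jj \<subseteq> {1..n}" "K \<subseteq> {1..n}" "K \<subseteq> Ji" "K \<subseteq> Jj"
    and mem: "i \<in> Jj" "j \<in> Ji" "i \<notin> Ji" "j \<notin> Jj" "i \<notin> K" "j \<notin> K"
    and idx: "i \<in> {0..n}" "j \<in> {0..n}" "i \<in> {1..n}" "j \<in> {1..n}"
    and K: "Ji - {j} = K" "Jj - {i} = K"
    using ij by (auto simp: Ji_def Jj_def K_def)
  let ?a = "W Ji i" and ?b = "W Jj j" and ?a' = "W K i" and ?b' = "W K j"
  note meas = W_measurable[OF sub(1) idx(1) mem(3)] W_measurable[OF sub(2) idx(2) mem(4)]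
    W_measurable[OF sub(3) idx(1) mem(5)] W_measurable[OF sub(3) idx(2) mem(6)]
  note sq = W_square_integrable[OF sub(1) idx(1) mem(3)] W_square_integrable[OF sub(2) idx(2) mem(4)]
    W_square_integrable[OF sub(3) idx(1) mem(5)] W_square_integrable[OF sub(3) idx(2) mem(6)]
  have orth: "(\<integral>\<omega>. W K k \<omega> * W J' m \<omega> \<partial>M) = 0"
    if "K \<subseteq> J" "J \<subseteq> {1..n}" "k \<in> J" "k \<notin> K" "m \<in> {0..n}" "m \<notin> J" "J' \<subseteq> J" for J J' k m
  proof -
    \<comment> \<open>The evaluation point of \<open>W K k\<close> is read off coordinate
      \<open>k\<close> of the data; since \<open>k\<close> belongs to \<open>J\<close>, the whole
      expression is an admissible test function for \<open>W_orthogonal\<close>.\<close>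
    let ?G = "\<lambda>u. err K (u, u k) - risk K u"
    have k: "k \<in> {0..n}" using that by auto
    have "(\<lambda>u. (u, u k)) \<in> measurable (Pi\<^sub>M J (\<lambda>_. borel)) (Pi\<^sub>M J (\<lambda>_. borel) \<Otimes>\<^sub>M borel)"
      by (intro measurable_Pair measurable_ident measurable_component_singleton[OF that(3)]) simp
    from measurable_compose[OF this err_measurable[OF that(1)]]
    have G: "?G \<in> borel_measurable (Pi\<^sub>M J (\<lambda>_. borel))"
      by (intro borel_measurable_diff risk_measurable[OF sub(3) that(1,2)])
    have GW: "?G (restrict (data \<omega>) J) = W K k \<omega>" for \<omega>
      unfolding err_restrict[OF that(1)] risk_restrict[OF that(1)]
      using that(3) by (simp add: W_def V_def data_def)
    have "integrable M (\<lambda>\<omega>. (?G (restrict (data \<omega>) J))\<^sup>2)"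
      unfolding GW by (rule W_square_integrable[OF sub(3) k that(4)])
    from W_orthogonal[OF that(7,2,5,6) G this] show ?thesis unfolding GW .
  qed
  have a'b: "(\<integral>\<omega>. ?a' \<omega> * ?b \<omega> \<partial>M) = 0" and a'b': "(\<integral>\<omega>. ?a' \<omega> * ?b' \<omega> \<partial>M) = 0"
    and b'a: "(\<integral>\<omega>. ?b' \<omega> * ?a \<omega> \<partial>M) = 0"
    using orth[OF sub(5,2) mem(1,5) idx(2) mem(4)] orth[OF sub(4,1) mem(2,6) idx(1) mem(3)] sub by auto
  let ?da = "\<lambda>\<omega>. ?a \<omega> - ?a' \<omega>" and ?db = "\<lambda>\<omega>. ?b \<omega> - ?b' \<omega>"
  have dm: "?da \<in> borel_measurable M" "?db \<in> borel_measurable M" by (intro borel_measurable_diff meas)+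
  have di: "integrable M (\<lambda>\<omega>. (?da \<omega>)\<^sup>2)" "integrable M (\<lambda>\<omega>. (?db \<omega>)\<^sup>2)"
    and dle: "(\<integral>\<omega>. (?da \<omega>)\<^sup>2 \<partial>M) \<le> 4 * (\<gamma>0 * k_diff 2 / real n)"
      "(\<integral>\<omega>. (?db \<omega>)\<^sup>2 \<partial>M) \<le> 4 * (\<gamma>0 * k_diff 2 / real n)"
    using W_diff[OF sub(1) mem(2) idx(1) mem(3)] W_diff[OF sub(2) mem(1) idx(2) mem(4)] unfolding K by auto
  note ints = integrable_mult_L2[OF meas(3,2) sq(3,2)] integrable_mult_L2[OF meas(4,1) sq(4,1)]
    integrable_mult_L2[OF meas(3,4) sq(3,4)] integrable_mult_L2[OF dm di]
  \<comment> \<open>Expanding the product of the two increments expresses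
    \<open>?a \<omega> * ?b \<omega>\<close> through it and three products that integrate to
    zero.\<close>
  have "(\<integral>\<omega>. ?a \<omega> * ?b \<omega> \<partial>M)
      = (\<integral>\<omega>. ?da \<omega> * ?db \<omega> + ?a' \<omega> * ?b \<omega> + ?b' \<omega> * ?a \<omega> - ?a' \<omega> * ?b' \<omega> \<partial>M)"
    by (intro Bochner_Integration.integral_cong refl) (simp add: algebra_simps)
  also have "\<dots> = (\<integral>\<omega>. ?da \<omega> * ?db \<omega> \<partial>M)" using ints by (simp add: a'b a'b' b'a)
  also have "\<dots> \<le> 4 * (\<gamma>0 * k_diff 2 / real n)"
    using integral_mult_le[OF dm di] dle by linarith
  finally show ?thesis unfolding Ji_def Jj_def .
qed

lemma W_average:
  shows W_average_integrable: "integrable M (\<lambda>\<omega>. ((1 / real n) * (\<Sum>i\<in>{1..n}. W ({1..n} - {i}) i \<omega>))\<^sup>2)"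
    and W_average_le: "(\<integral>\<omega>. ((1 / real n) * (\<Sum>i\<in>{1..n}. W ({1..n} - {i}) i \<omega>))\<^sup>2 \<partial>M)
      \<le> (4 * k_phi 2 + 4 * (\<gamma>0 * k_diff 2)) / real n"
proof -
  let ?w = "\<lambda>i. W ({1..n} - {i}) i" and ?B = "4 * (\<gamma>0 * k_diff 2 / real n)"
  have wm: "?w i \<in> borel_measurable M" and wi: "integrable M (\<lambda>\<omega>. (?w i \<omega>)\<^sup>2)"
    and wle: "(\<integral>\<omega>. (?w i \<omega>)\<^sup>2 \<partial>M) \<le> 4 * k_phi 2" if "i \<in> {1..n}" for i
    using that by (auto intro!: W_measurable W_square_integrable W_square_le)
  have prod: "integrable M (\<lambda>\<omega>. ?w i \<omega> * ?w j \<omega>)" if "i \<in> {1..n}" "j \<in> {1..n}" for i j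
    by (rule integrable_mult_L2[OF wm wm wi wi]) (fact that)+
  have eq: "((1 / real n) * (\<Sum>i\<in>{1..n}. ?w i \<omega>))\<^sup>2
      = (1 / (real n)\<^sup>2) * (\<Sum>i\<in>{1..n}. \<Sum>j\<in>{1..n}. ?w i \<omega> * ?w j \<omega>)" for \<omega>
    by (simp only: power_mult_distrib power_one_over power2_eq_square[of "sum _ _"] sum_product)
  show "integrable M (\<lambda>\<omega>. ((1 / real n) * (\<Sum>i\<in>{1..n}. ?w i \<omega>))\<^sup>2)"
    unfolding eq by (intro integrable_mult_right Bochner_Integration.integrable_sum prod)
  \<comment> \<open>\<open>?B\<close> is nonnegative as it dominates a mean square. Adding it to the
    diagonal terms too keeps the double sum uniform.\<close>
  have B0: "0 \<le> ?B"
  proof -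
    have "0 \<le> (\<integral>\<omega>. (V {1..n} 0 \<omega> - V ({1..n} - {1}) 0 \<omega>)\<^sup>2 \<partial>M)" by simp
    also have "\<dots> \<le> \<gamma>0 * k_diff 2 / real n" by (rule V_diff_le) (use n_pos in auto)
    finally show ?thesis by simp
  qed
  have pair: "(\<integral>\<omega>. ?w i \<omega> * ?w j \<omega> \<partial>M) \<le> (if j = i then 4 * k_phi 2 else 0) + ?B"
    if "i \<in> {1..n}" "j \<in> {1..n}" for i j
    using wle[OF that(1)] W_cross_le[OF that] B0 by (auto simp: power2_eq_square)
  have "(\<integral>\<omega>. ((1 / real n) * (\<Sum>i\<in>{1..n}. ?w i \<omega>))\<^sup>2 \<partial>M)
      = (1 / (real n)\<^sup>2) * (\<integral>\<omega>. (\<Sum>i\<in>{1..n}. \<Sum>j\<in>{1..n}. ?w i \<omega> * ?w j \<omega>) \<partial>M)"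
    unfolding eq by simp
  also have "(\<integral>\<omega>. (\<Sum>i\<in>{1..n}. \<Sum>j\<in>{1..n}. ?w i \<omega> * ?w j \<omega>) \<partial>M)
      = (\<Sum>i\<in>{1..n}. \<integral>\<omega>. (\<Sum>j\<in>{1..n}. ?w i \<omega> * ?w j \<omega>) \<partial>M)"
    by (intro Bochner_Integration.integral_sum Bochner_Integration.integrable_sum prod)
  also have "\<dots> = (\<Sum>i\<in>{1..n}. \<Sum>j\<in>{1..n}. (\<integral>\<omega>. ?w i \<omega> * ?w j \<omega> \<partial>M))"
    by (intro sum.cong refl Bochner_Integration.integral_sum prod)
  also have "(1 / (real n)\<^sup>2) * \<dots>
      \<le> (1 / (real n)\<^sup>2) * (\<Sum>i\<in>{1..n}. \<Sum>j\<in>{1..n}. (if j = i then 4 * k_phi 2 else 0) + ?B)"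
    by (intro mult_left_mono sum_mono pair) auto
  also have "(\<Sum>i\<in>{1..n}. \<Sum>j\<in>{1..n}. (if j = i then 4 * k_phi 2 else 0) + ?B)
      = real n * (4 * k_phi 2 + real n * ?B)"
    by (simp add: sum.distrib sum.delta)
  also have "(1 / (real n)\<^sup>2) * \<dots> = (4 * k_phi 2 + 4 * (\<gamma>0 * k_diff 2)) / real n"
    using n_pos by (simp add: field_simps power2_eq_square)
  finally show "(\<integral>\<omega>. ((1 / real n) * (\<Sum>i\<in>{1..n}. ?w i \<omega>))\<^sup>2 \<partial>M)
      \<le> (4 * k_phi 2 + 4 * (\<gamma>0 * k_diff 2)) / real n" .
qed

text \<open>No cancellation is involved: every summand has mean square of order 1/n, and the square
  of an average is at most the average of the squares.\<close>

lemma risk_average: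
  defines "D \<equiv> \<lambda>\<omega>. (1 / real n) * (\<Sum>i\<in>{1..n}. risk ({1..n} - {i}) (data \<omega>) - risk {1..n} (data \<omega>))"
  shows risk_average_integrable: "integrable M (\<lambda>\<omega>. (D \<omega>)\<^sup>2)"
    and risk_average_le: "(\<integral>\<omega>. (D \<omega>)\<^sup>2 \<partial>M) \<le> \<gamma>0 * k_diff 2 / real n"
    and risk_average_measurable: "D \<in> borel_measurable M"
proof -
  let ?d = "\<lambda>i \<omega>. risk ({1..n} - {i}) (data \<omega>) - risk {1..n} (data \<omega>)"
  have di: "integrable M (\<lambda>\<omega>. (?d i \<omega>)\<^sup>2)" and dle: "(\<integral>\<omega>. (?d i \<omega>)\<^sup>2 \<partial>M) \<le> \<gamma>0 * k_diff 2 / real n"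
    if "i \<in> {1..n}" for i
    using risk_diff[OF subset_refl that] by (simp_all add: power2_commute)
  show Dm: "D \<in> borel_measurable M"
    unfolding D_def
    by (intro borel_measurable_times borel_measurable_const borel_measurable_sum borel_measurable_diff
        risk_data_measurable) auto
  have le: "(D \<omega>)\<^sup>2 \<le> (1 / real n) * (\<Sum>i\<in>{1..n}. (?d i \<omega>)\<^sup>2)" for \<omega>
  proof -
    have "(D \<omega>)\<^sup>2 = (1 / (real n)\<^sup>2) * (\<Sum>i\<in>{1..n}. ?d i \<omega>)\<^sup>2"
      by (simp only: D_def power_mult_distrib power_one_over)
    also have "\<dots> \<le> (1 / (real n)\<^sup>2) * ((\<Sum>i\<in>{1..n}. (?d i \<omega>)\<^sup>2) * card {1..n})"
      by (intro mult_left_mono sum_squared_le_sum_of_squares) simp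
    also have "\<dots> = (1 / real n) * (\<Sum>i\<in>{1..n}. (?d i \<omega>)\<^sup>2)"
      using n_pos by (simp add: power2_eq_square)
    finally show ?thesis .
  qed
  have si: "integrable M (\<lambda>\<omega>. (1 / real n) * (\<Sum>i\<in>{1..n}. (?d i \<omega>)\<^sup>2))"
    by (intro integrable_mult_right Bochner_Integration.integrable_sum di)
  show Di: "integrable M (\<lambda>\<omega>. (D \<omega>)\<^sup>2)"
  proof (rule Bochner_Integration.integrable_bound[OF si])
    show "(\<lambda>\<omega>. (D \<omega>)\<^sup>2) \<in> borel_measurable M" using Dm by (rule borel_measurable_power)
    show "AE \<omega> in M. norm ((D \<omega>)\<^sup>2) \<le> norm ((1 / real n) * (\<Sum>i\<in>{1..n}. (?d i \<omega>)\<^sup>2))"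
    proof (rule AE_I2)
      fix \<omega>
      have "norm ((D \<omega>)\<^sup>2) = (D \<omega>)\<^sup>2" by simp
      also have "\<dots> \<le> (1 / real n) * (\<Sum>i\<in>{1..n}. (?d i \<omega>)\<^sup>2)" by (rule le)
      also have "\<dots> \<le> norm \<dots>" unfolding real_norm_def by (rule abs_ge_self)
      finally show "norm ((D \<omega>)\<^sup>2) \<le> norm ((1 / real n) * (\<Sum>i\<in>{1..n}. (?d i \<omega>)\<^sup>2))" .
    qed
  qed
  have "(\<integral>\<omega>. (D \<omega>)\<^sup>2 \<partial>M) \<le> (\<integral>\<omega>. (1 / real n) * (\<Sum>i\<in>{1..n}. (?d i \<omega>)\<^sup>2) \<partial>M)"
    by (rule integral_mono[OF Di si le])
  also have "\<dots> = (1 / real n) * (\<Sum>i\<in>{1..n}. (\<integral>\<omega>. (?d i \<omega>)\<^sup>2 \<partial>M))"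
    using di by (simp add: Bochner_Integration.integral_sum)
  also have "\<dots> \<le> (1 / real n) * (\<Sum>i\<in>{1..n}. \<gamma>0 * k_diff 2 / real n)"
    by (intro mult_left_mono sum_mono dle) auto
  also have "\<dots> = \<gamma>0 * k_diff 2 / real n" using n_pos by simp
  finally show "(\<integral>\<omega>. (D \<omega>)\<^sup>2 \<partial>M) \<le> \<gamma>0 * k_diff 2 / real n" .
qed

section \<open>The total error and the conditional expectation\<close>

lemma leave_one_out_risk:
  defines "T \<equiv> \<lambda>\<omega>. (1 / real n) * (\<Sum>i\<in>{1..n}. V ({1..n} - {i}) i \<omega>) - risk {1..n} (data \<omega>)"
  shows leave_one_out_risk_integrable: "integrable M (\<lambda>\<omega>. (T \<omega>)\<^sup>2)"
    and leave_one_out_risk_le: "(\<integral>\<omega>. (T \<omega>)\<^sup>2 \<partial>M) \<le> rate_const / real n"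
    and leave_one_out_risk_measurable: "T \<in> borel_measurable M"
proof -
  let ?A = "\<lambda>\<omega>. (1 / real n) * (\<Sum>i\<in>{1..n}. W ({1..n} - {i}) i \<omega>)"
  let ?D = "\<lambda>\<omega>. (1 / real n) * (\<Sum>i\<in>{1..n}. risk ({1..n} - {i}) (data \<omega>) - risk {1..n} (data \<omega>))"
  have T: "T = (\<lambda>\<omega>. ?A \<omega> + ?D \<omega>)"
    using n_pos by (simp add: T_def W_def fun_eq_iff sum_subtractf diff_divide_distrib)
  have Am: "?A \<in> borel_measurable M"
    by (intro borel_measurable_times borel_measurable_const borel_measurable_sum W_measurable) auto
  note Dm = risk_average_measurable and Ai = W_average_integrable and Di = risk_average_integrable
  show "T \<in> borel_measurable M" unfolding T by (rule borel_measurable_add[OF Am Dm])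
  show "integrable M (\<lambda>\<omega>. (T \<omega>)\<^sup>2)" unfolding T by (rule integrable_square_add[OF Am Dm Ai Di])
  have "(\<integral>\<omega>. (T \<omega>)\<^sup>2 \<partial>M) \<le> 2 * ((4 * k_phi 2 + 4 * (\<gamma>0 * k_diff 2)) / real n) + 2 * (\<gamma>0 * k_diff 2 / real n)"
    unfolding T using integral_square_add_le[OF Am Dm Ai Di] W_average_le risk_average_le by linarith
  also have "\<dots> = rate_const / real n"
    using n_pos by (simp add: rate_const_def field_simps)
  finally show "(\<integral>\<omega>. (T \<omega>)\<^sup>2 \<partial>M) \<le> rate_const / real n" .
qed

text \<open>Every set of the data algebra is a preimage under the data map, so its indicator is a
  function of the data. Orthogonality of \<open>W {1..n} 0\<close> to such functions is the defining
  property of the conditional expectation.\<close>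

lemma cond_exp_new_error:
  "AE \<omega> in M. real_cond_exp M
     (vimage_algebra (space M) (\<lambda>\<omega>. restrict (data \<omega>) {1..n}) (Pi\<^sub>M {1..n} (\<lambda>_. borel))) (V {1..n} 0) \<omega>
   = risk {1..n} (data \<omega>)"
proof -
  let ?I = "{1..n}" and ?U = "\<lambda>\<omega>. restrict (data \<omega>) {1..n}" and ?N = "Pi\<^sub>M {1..n} (\<lambda>_. borel :: obs measure)"
  let ?F = "vimage_algebra (space M) ?U ?N"
  have sub: "?I \<subseteq> {0..n}" "(0::nat) \<in> {0..n}" "0 \<notin> ?I" by auto
  have U: "?U \<in> measurable M ?N" by (rule data_measurable[OF sub(1)])
  then have Usp: "?U \<in> space M \<rightarrow> space ?N" by (auto dest: measurable_space)
  have "subalgebra M ?F"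
    unfolding subalgebra_def using sets_image_in_sets[OF refl U] by simp
  then interpret F: finite_measure_subalgebra M ?F by unfold_locales
  note V = bmom_V[OF subset_refl sub(2,3)]
  have Ri: "integrable M (\<lambda>\<omega>. risk ?I (data \<omega>))"
    by (rule square_integrable_imp_integrable[OF risk_data_measurable risk_square_integrable]) auto
  show ?thesis
  proof (rule F.real_cond_exp_charact)
    show "integrable M (V ?I 0)" by (rule bmom_integrable1[OF V])
    show "integrable M (\<lambda>\<omega>. risk ?I (data \<omega>))" by (rule Ri)
    show "(\<lambda>\<omega>. risk ?I (data \<omega>)) \<in> borel_measurable ?F"
      using measurable_compose[OF measurable_vimage_algebra1[OF Usp] risk_measurable[OF subset_refl subset_refl subset_refl]]
      unfolding risk_restrict[OF subset_refl] .
    fix A assume "A \<in> sets ?F"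
    then obtain B where B: "B \<in> sets ?N" "A = ?U -` B \<inter> space M"
      unfolding sets_vimage_algebra2[OF Usp] by blast
    let ?G = "indicator B :: _ \<Rightarrow> real"
    have G: "?G \<in> borel_measurable ?N" using B(1) by simp
    have Gm: "(\<lambda>\<omega>. ?G (?U \<omega>)) \<in> borel_measurable M" by (rule measurable_compose[OF U G])
    have Gi: "integrable M (\<lambda>\<omega>. (?G (?U \<omega>))\<^sup>2)"
      by (rule integrable_const_bound[of _ 1]) (use Gm in \<open>auto simp: indicator_def intro!: borel_measurable_power\<close>)
    have W0: "(\<integral>\<omega>. ?G (?U \<omega>) * W ?I 0 \<omega> \<partial>M) = 0"
      by (rule W_orthogonal[OF subset_refl subset_refl sub(2,3) G Gi])
    have ind: "indicator A \<omega> = ?G (?U \<omega>)" if "\<omega> \<in> space M" for \<omega>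
      using that by (auto simp: B(2) indicator_def)
    have GV: "integrable M (\<lambda>\<omega>. ?G (?U \<omega>) * V ?I 0 \<omega>)"
      by (rule integrable_mult_L2[OF Gm bmom_measurable[OF V] Gi bmom_integrable2[OF V]])
    have GR: "integrable M (\<lambda>\<omega>. ?G (?U \<omega>) * risk ?I (data \<omega>))"
      by (rule integrable_mult_L2[OF Gm risk_data_measurable[OF subset_refl] Gi risk_square_integrable[OF subset_refl]])
    have "(\<integral>\<omega>. ?G (?U \<omega>) * V ?I 0 \<omega> \<partial>M) = (\<integral>\<omega>. ?G (?U \<omega>) * risk ?I (data \<omega>) \<partial>M)"
      using W0 GV GR by (simp add: W_def right_diff_distrib)
    then show "(\<integral>\<omega>\<in>A. V ?I 0 \<omega> \<partial>M) = (\<integral>\<omega>\<in>A. risk ?I (data \<omega>) \<partial>M)"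
      unfolding set_lebesgue_integral_def real_scaleR_def
      by (simp add: ind cong: Bochner_Integration.integral_cong)
  qed
qed

end

section \<open>From the hypotheses of the theorem to the locale\<close>

lemma powr_le_one_plus_power:
  assumes "0 < s" "s \<le> real N"
  shows "\<bar>x::real\<bar> powr s \<le> 1 + \<bar>x\<bar> ^ N"
proof (cases "\<bar>x\<bar> \<le> 1")
  case True
  then have "\<bar>x\<bar> powr s \<le> 1" using assms by (intro powr_le1) auto
  moreover have "0 \<le> \<bar>x\<bar> ^ N" by simp
  ultimately show ?thesis by linarith
next
  case False
  then have "\<bar>x\<bar> powr s \<le> \<bar>x\<bar> powr real N" using assms by (intro powr_mono) auto
  also have "\<dots> = \<bar>x\<bar> ^ N" using False by (intro powr_realpow) auto
  finally show ?thesis by simp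
qed

text \<open>A real exponent is replaced by an integer one so that \<open>bmom_power\<close> applies.
  Arguments of modulus below 1 cost an additive 1 for each of y and z, which the factor 3
  absorbs.\<close>

lemma powr_growth_le:
  assumes "0 < s" "s \<le> real N" "0 \<le> C"
  shows "C * (1 + \<bar>y::real\<bar> powr s + \<bar>z::real\<bar> powr s) \<le> 3 * C * (1 + \<bar>y\<bar> ^ N + \<bar>z\<bar> ^ N)"
proof -
  have "1 + a + b \<le> 3 * (1 + c + d)" if "a \<le> 1 + c" "b \<le> 1 + d" "0 \<le> c" "0 \<le> d" for a b c d :: real
    using that by argo
  from this[OF powr_le_one_plus_power[OF assms(1,2), of y] powr_le_one_plus_power[OF assms(1,2), of z]]
  have "1 + \<bar>y\<bar> powr s + \<bar>z\<bar> powr s \<le> 3 * (1 + \<bar>y\<bar> ^ N + \<bar>z\<bar> ^ N)" by simp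
  then have "C * (1 + \<bar>y\<bar> powr s + \<bar>z\<bar> powr s) \<le> C * (3 * (1 + \<bar>y\<bar> ^ N + \<bar>z\<bar> ^ N))"
    using assms(3) by (rule mult_left_mono)
  then show ?thesis by (simp only: mult_ac)
qed

text \<open>At \<open>m = 0\<close> and \<open>x = 0\<close> the two sides would differ, being 0 and
  1.\<close>

lemma abs_powr_of_nat: "0 < m \<Longrightarrow> \<bar>x::real\<bar> powr real m = \<bar>x\<bar> ^ m"
  by (cases "x = 0") (auto simp: powr_realpow)

text \<open>The response kernel has total mass one, so the second marginal of the inner law is the
  point mass at \<open>x\<close>, and binding \<open>P\<close> with point masses gives
  \<open>P\<close> back.\<close>

lemma distr_snd_kernel:
  assumes q: "q \<in> borel \<rightarrow>\<^sub>M prob_algebra borel" and P: "prob_space P" "sets P = sets borel"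
  shows "distr (P \<bind> (\<lambda>x. distr (q (dotp p x b)) (borel :: obs measure) (\<lambda>y. (y, x)))) borel snd = P"
proof -
  interpret P: prob_space P by fact
  have qd: "(\<lambda>x. q (dotp p x b)) \<in> P \<rightarrow>\<^sub>M prob_algebra borel"
    unfolding measurable_cong_sets[OF P(2) refl] by (rule measurable_compose[OF dotp_measurable q])
  have pair: "(\<lambda>(x, y). (y, x)) \<in> P \<Otimes>\<^sub>M borel \<rightarrow>\<^sub>M (borel :: obs measure)"
  proof -
    have "(\<lambda>w. (snd w, fst w)) \<in> P \<Otimes>\<^sub>M borel \<rightarrow>\<^sub>M (borel :: real measure) \<Otimes>\<^sub>M (borel :: (nat \<Rightarrow> real) measure)"
      using P(2) by (intro measurable_Pair measurable_snd) (simp add: measurable_cong_sets[OF refl P(2)[symmetric]])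
    then show ?thesis by (simp add: borel_prod case_prod_beta')
  qed
  have kernel: "(\<lambda>x. distr (q (dotp p x b)) (borel :: obs measure) (\<lambda>y. (y, x))) \<in> P \<rightarrow>\<^sub>M subprob_algebra borel"
    by (rule measurable_distr2[OF pair measurable_prob_algebraD[OF qd]])
  have "distr (distr (q (dotp p x b)) (borel :: obs measure) (\<lambda>y. (y, x))) borel snd = return borel x"
    if x: "x \<in> space P" for x
  proof -
    have "q (dotp p x b) \<in> space (prob_algebra borel)" by (rule measurable_space[OF qd x])
    then have pq: "prob_space (q (dotp p x b))" and sq: "sets (q (dotp p x b)) = sets borel"
      by (auto simp: space_prob_algebra)
    have "(\<lambda>y. (y, x)) \<in> q (dotp p x b) \<rightarrow>\<^sub>M (borel :: real measure) \<Otimes>\<^sub>M (borel :: (nat \<Rightarrow> real) measure)"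
      unfolding measurable_cong_sets[OF sq refl] by (intro measurable_Pair measurable_ident_sets refl) simp
    then have m: "(\<lambda>y. (y, x)) \<in> q (dotp p x b) \<rightarrow>\<^sub>M (borel :: obs measure)" by (simp add: borel_prod)
    have "distr (distr (q (dotp p x b)) (borel :: obs measure) (\<lambda>y. (y, x))) borel snd
        = distr (q (dotp p x b)) borel (\<lambda>_. x)"
      by (simp add: distr_distr[OF snd_obs_measurable m] comp_def)
    also have "\<dots> = return borel x" by (rule prob_space.distr_const[OF pq]) simp
    finally show ?thesis .
  qed
  then have "distr (P \<bind> (\<lambda>x. distr (q (dotp p x b)) (borel :: obs measure) (\<lambda>y. (y, x)))) borel snd
      = P \<bind> return borel"
    by (subst distr_bind[OF kernel P.not_empty snd_obs_measurable]) (intro bind_cong refl)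
  also have "\<dots> = P" by (rule bind_return''[OF P(2)])
  finally show ?thesis .
qed

text \<open>Response moments are assumed for the indices in {1..n} only; equality in law carries
  them over to the new observation 0.\<close>

lemma bmom_fst_obs:
  assumes Z: "Z \<in> borel_measurable M" "Z' \<in> borel_measurable M"
    and eq: "distr M (borel :: obs measure) Z = distr M borel Z'"
    and b: "bmom M (\<lambda>\<omega>. fst (Z \<omega>)) K"
  shows "bmom M (\<lambda>\<omega>. fst (Z' \<omega>)) K"
proof -
  note f = fst_obs_measurable
  have g: "(\<lambda>z::obs. \<bar>fst z\<bar> ^ m) \<in> borel_measurable borel" for m
    by (intro borel_measurable_power borel_measurable_abs f)
  show ?thesis
    unfolding bmom_def
  proof (intro conjI allI)
    show "(\<lambda>\<omega>. fst (Z' \<omega>)) \<in> borel_measurable M" by (rule measurable_compose[OF Z(2) f])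
    show "integrable M (\<lambda>\<omega>. \<bar>fst (Z' \<omega>)\<bar> ^ m)" for m
      using bmom_integrable[OF b, of m] integrable_distr_eq[OF Z(1) g] integrable_distr_eq[OF Z(2) g] eq by simp
    show "(\<integral>\<omega>. \<bar>fst (Z' \<omega>)\<bar> ^ m \<partial>M) \<le> K m" for m
      using bmom_le[OF b, of m] integral_distr[OF Z(1) g] integral_distr[OF Z(2) g] eq by simp
  qed
qed

theorem theorem2p1:
  fixes \<gamma>0 lam \<eta> s C_X C \<kappa> :: real and C_Y :: "real \<Rightarrow> real"
  assumes "0 < \<gamma>0" "0 < lam" "0 < \<eta>" "\<eta> < 1" "0 < s" "0 < C"
  shows "\<exists>C_v. \<forall>(n::nat) (p::nat) (M :: 'w measure) (Y :: nat \<Rightarrow> 'w \<Rightarrow> real) (X :: nat \<Rightarrow> 'w \<Rightarrow> nat \<Rightarrow> real)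
      q P \<beta>star \<Theta> S c_X r0 l \<phi>.
    0 < n \<and> 0 < p \<and> real n / real p = \<gamma>0 \<and>
    closedin (Euclidean_space p) \<Theta> \<and> convex_Rn \<Theta> \<and> \<beta>star \<in> \<Theta> \<and>
    iid_sample M n p q \<beta>star P Y X \<and>
    gaussian_law p S P \<and> 0 < c_X \<and> c_X \<le> C_X \<and>
    c_X / real p \<le> sigma_min S \<and> sigma_max S \<le> C_X / real p \<and>
    (\<forall>b\<in>Rn p. 0 \<le> r0 b) \<and> convex_fun_Rn p r0 \<and> lipschitz_fun_Rn p r0 \<and>
    (\<exists>b\<in>\<Theta>. enet_reg p \<eta> r0 b \<le> \<kappa> * real p) \<and>
    smooth_convex_loss l \<and> smooth_convex_loss \<phi> \<and>
    (\<forall>y z. Max {\<bar>l y z\<bar>, \<bar>deriv (l y) z\<bar>, \<bar>\<phi> y z\<bar>, \<bar>deriv (\<phi> y) z\<bar>}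
             \<le> C * (1 + \<bar>y\<bar> powr s + \<bar>z\<bar> powr s)) \<and>
    (\<forall>m>0. \<forall>i\<in>{1..n}. integrable M (\<lambda>\<omega>. \<bar>Y i \<omega>\<bar> powr m) \<and>
                       (\<integral>\<omega>. \<bar>Y i \<omega>\<bar> powr m \<partial>M) \<le> C_Y m)
    \<longrightarrow>
    integrable M (new_error n p \<Theta> l lam (enet_reg p \<eta> r0) \<phi> Y X) \<and>
    integrable M (\<lambda>\<omega>. (LO_est n p \<Theta> l lam (enet_reg p \<eta> r0) \<phi> Y X \<omega>
                        - OO_err M n p \<Theta> l lam (enet_reg p \<eta> r0) \<phi> Y X \<omega>)\<^sup>2) \<and>
    (\<integral>\<omega>. (LO_est n p \<Theta> l lam (enet_reg p \<eta> r0) \<phi> Y X \<omega>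
            - OO_err M n p \<Theta> l lam (enet_reg p \<eta> r0) \<phi> Y X \<omega>)\<^sup>2 \<partial>M) \<le> C_v / real n"
proof -
  define N where "N = nat \<lceil>s\<rceil>"
  have sN: "s \<le> real N" unfolding N_def by linarith
  \<comment> \<open>The hypothesis covers exponents \<open>m > 0\<close>; the moment of order 0 is
    the total mass 1.\<close>
  define KY where "KY m = (if m = 0 then 1 else C_Y (real m))" for m :: nat
  show ?thesis
  \<comment> \<open>The growth constant becomes \<open>3 * C\<close> in passing from exponent
    \<open>s\<close> to \<open>N\<close>. The witness mentions neither n, p, the probability space
    nor any of the functions, because \<open>rate\<close> fixes none of them.\<close>
  proof (intro exI[of _ "rate.rate_const \<gamma>0 lam \<eta> C_X (3 * C) \<kappa> N KY"] allI impI, elim conjE, goal_cases)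
    case H: (1 n p M Y X q P \<beta>star \<Theta> S c_X r0 l \<phi>)
    obtain b0 where b0: "b0 \<in> \<Theta>" "enet_reg p \<eta> r0 b0 \<le> \<kappa> * real p" using H(16) by blast
    let ?Z = "\<lambda>i \<omega>. (Y i \<omega>, X i \<omega>)"
    let ?law = "P \<bind> (\<lambda>x. distr (q (dotp p x \<beta>star)) borel (\<lambda>y. (y, x)))"
    have M: "prob_space M" and q: "q \<in> borel \<rightarrow>\<^sub>M prob_algebra borel"
      and ind: "prob_space.indep_vars M (\<lambda>_. borel) ?Z {0..n}"
      and Zlaw: "\<And>i. i \<in> {0..n} \<Longrightarrow> distr M borel (?Z i) = ?law"
      using H(7) by (auto simp: iid_sample_def)
    have P: "prob_space P" "sets P = sets borel" using H(8) by (auto simp: gaussian_law_def)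
    interpret prob_space M by (rule M)
    have Zm: "?Z i \<in> borel_measurable M" if "i \<in> {0..n}" for i
      using ind that unfolding indep_vars_def by blast
    have x_law: "distr M borel (\<lambda>\<omega>. snd (?Z i \<omega>)) = P" if "i \<in> {0..n}" for i
    proof -
      have "distr M borel (\<lambda>\<omega>. snd (?Z i \<omega>)) = distr (distr M borel (?Z i)) borel snd"
        by (simp only: distr_distr[OF snd_obs_measurable Zm[OF that]] comp_def)
      also have "\<dots> = P" unfolding Zlaw[OF that] by (rule distr_snd_kernel[OF q P])
      finally show ?thesis .
    qed
    have Y1: "bmom M (\<lambda>\<omega>. fst (?Z i \<omega>)) KY" if i: "i \<in> {1..n}" for i
    proof -
      have i0: "i \<in> {0..n}" using i by simp
      have "integrable M (\<lambda>\<omega>. \<bar>Y i \<omega>\<bar> ^ m) \<and> (\<integral>\<omega>. \<bar>Y i \<omega>\<bar> ^ m \<partial>M) \<le> KY m" for m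
      proof (cases "m = 0")
        case False
        then have "integrable M (\<lambda>\<omega>. \<bar>Y i \<omega>\<bar> powr real m) \<and> (\<integral>\<omega>. \<bar>Y i \<omega>\<bar> powr real m \<partial>M) \<le> C_Y (real m)"
          using H(20) i by simp
        then show ?thesis using False by (simp add: abs_powr_of_nat KY_def)
      qed (simp add: KY_def prob_space)
      then show ?thesis
        using measurable_compose[OF Zm[OF i0] fst_obs_measurable] by (simp add: bmom_def)
    qed
    have Yall: "bmom M (\<lambda>\<omega>. fst (?Z i \<omega>)) KY" if i: "i \<in> {0..n}" for i
    proof (rule bmom_fst_obs[OF Zm Zm[OF i] _ Y1])
      show "distr M borel (?Z 1) = distr M borel (?Z i)" using Zlaw[OF i] Zlaw[of 1] H(1) by simp
    qed (use H(1) in auto)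
    note grow = powr_growth_le[OF assms(5) sN less_imp_le[OF assms(6)]]
    have bounds: "\<bar>l y z\<bar> \<le> 3 * C * (1 + \<bar>y\<bar> ^ N + \<bar>z\<bar> ^ N)"
      "\<bar>deriv (l y) z\<bar> \<le> 3 * C * (1 + \<bar>y\<bar> ^ N + \<bar>z\<bar> ^ N)"
      "\<bar>\<phi> y z\<bar> \<le> 3 * C * (1 + \<bar>y\<bar> ^ N + \<bar>z\<bar> ^ N)"
      "\<bar>deriv (\<phi> y) z\<bar> \<le> 3 * C * (1 + \<bar>y\<bar> ^ N + \<bar>z\<bar> ^ N)" for y z
    proof -
      have "Max {\<bar>l y z\<bar>, \<bar>deriv (l y) z\<bar>, \<bar>\<phi> y z\<bar>, \<bar>deriv (\<phi> y) z\<bar>} \<le> 3 * C * (1 + \<bar>y\<bar> ^ N + \<bar>z\<bar> ^ N)"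
        using H(19) grow[of y z] by (meson order_trans)
      then show "\<bar>l y z\<bar> \<le> 3 * C * (1 + \<bar>y\<bar> ^ N + \<bar>z\<bar> ^ N)"
        "\<bar>deriv (l y) z\<bar> \<le> 3 * C * (1 + \<bar>y\<bar> ^ N + \<bar>z\<bar> ^ N)"
        "\<bar>\<phi> y z\<bar> \<le> 3 * C * (1 + \<bar>y\<bar> ^ N + \<bar>z\<bar> ^ N)"
        "\<bar>deriv (\<phi> y) z\<bar> \<le> 3 * C * (1 + \<bar>y\<bar> ^ N + \<bar>z\<bar> ^ N)"
        by (simp_all add: Max_le_iff)
    qed
    have ratio: "real n = \<gamma>0 * real p" using H(2,3) by (simp add: field_simps)
    interpret sample p \<Theta> l lam \<eta> r0 M \<gamma>0 C_X "3 * C" \<kappa> N KY n ?Z P S b0 \<phi>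
    proof unfold_locales
      show "0 < lam" "0 < \<eta>" "\<eta> < 1" by fact+
      show "closedin (Euclidean_space p) \<Theta>" "convex_Rn \<Theta>" "\<Theta> \<noteq> {}" using H by auto
      show "0 \<le> r0 b" if "b \<in> Rn p" for b using H(13) that by blast
      show "convex_fun_Rn p r0" "lipschitz_fun_Rn p r0" "smooth_convex_loss l" "smooth_convex_loss \<phi>" by fact+
      show "0 < n" "0 < p" "gaussian_law p S P" "sigma_max S \<le> C_X / real p" by fact+
      show "real n = \<gamma>0 * real p" by (rule ratio)
      show "b0 \<in> \<Theta>" "enet_reg p \<eta> r0 b0 \<le> \<kappa> * real p" by (rule b0)+
      show "indep_vars (\<lambda>_. borel) ?Z {0..n}" by (rule ind)
      show "distr M borel (?Z i) = distr M borel (?Z 0)" if "i \<in> {0..n}" for i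
        using Zlaw[OF that] Zlaw[of 0] by simp
    qed (use bounds x_law Yall in auto)
    have est_eq: "estimator p \<Theta> l lam (enet_reg p \<eta> r0) J (\<lambda>j. Y j \<omega>) (\<lambda>j. X j \<omega>) = est J (data \<omega>)" for J \<omega>
      using estimator_eq_est[of J "data \<omega>"] by (simp add: data_def)
    have new: "new_error n p \<Theta> l lam (enet_reg p \<eta> r0) \<phi> Y X = V {1..n} 0"
      unfolding new_error_def est_eq by (simp add: V_def err_def fun_eq_iff)
    have LO: "LO_est n p \<Theta> l lam (enet_reg p \<eta> r0) \<phi> Y X \<omega>
        = (1 / real n) * (\<Sum>i\<in>{1..n}. V ({1..n} - {i}) i \<omega>)" for \<omega>
      unfolding LO_est_def est_eq by (simp add: V_def err_def)
    have alg: "data_algebra M n Y X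
        = vimage_algebra (space M) (\<lambda>\<omega>. restrict (data \<omega>) {1..n}) (Pi\<^sub>M {1..n} (\<lambda>_. borel))"
      unfolding data_algebra_def data_def ..
    let ?T = "\<lambda>\<omega>. LO_est n p \<Theta> l lam (enet_reg p \<eta> r0) \<phi> Y X \<omega>
      - OO_err M n p \<Theta> l lam (enet_reg p \<eta> r0) \<phi> Y X \<omega>"
    let ?R = "\<lambda>\<omega>. (1 / real n) * (\<Sum>i\<in>{1..n}. V ({1..n} - {i}) i \<omega>) - risk {1..n} (data \<omega>)"
    \<comment> \<open>The conditional expectation is determined only up to null sets, so the bound
      for \<open>?R\<close> is transferred to \<open>?T\<close> almost everywhere, which requires
      both squares to be measurable.\<close>
    have AE: "AE \<omega> in M. (?R \<omega>)\<^sup>2 = (?T \<omega>)\<^sup>2"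
      using cond_exp_new_error unfolding OO_err_def new alg LO by eventually_elim simp
    have LOm: "LO_est n p \<Theta> l lam (enet_reg p \<eta> r0) \<phi> Y X \<in> borel_measurable M"
      unfolding LO[abs_def]
      by (intro borel_measurable_times borel_measurable_const borel_measurable_sum V_measurable) auto
    have OOm: "OO_err M n p \<Theta> l lam (enet_reg p \<eta> r0) \<phi> Y X \<in> borel_measurable M"
      unfolding OO_err_def by (rule borel_measurable_cond_exp2)
    have Tm: "(\<lambda>\<omega>. (?T \<omega>)\<^sup>2) \<in> borel_measurable M"
      by (intro borel_measurable_power borel_measurable_diff LOm OOm)
    have Rm: "(\<lambda>\<omega>. (?R \<omega>)\<^sup>2) \<in> borel_measurable M"
      by (intro borel_measurable_power leave_one_out_risk_measurable)
    show ?case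
    proof (intro conjI)
      show "integrable M (new_error n p \<Theta> l lam (enet_reg p \<eta> r0) \<phi> Y X)"
        unfolding new by (rule bmom_integrable1[OF bmom_V[OF subset_refl]]) auto
      show "integrable M (\<lambda>\<omega>. (?T \<omega>)\<^sup>2)"
        by (rule integrable_cong_AE_imp[OF leave_one_out_risk_integrable Tm AE])
      have "(\<integral>\<omega>. (?T \<omega>)\<^sup>2 \<partial>M) = (\<integral>\<omega>. (?R \<omega>)\<^sup>2 \<partial>M)"
        by (rule integral_cong_AE[OF Tm Rm]) (use AE in eventually_elim, simp)
      then show "(\<integral>\<omega>. (?T \<omega>)\<^sup>2 \<partial>M) \<le> rate_const / real n"
        using leave_one_out_risk_le by simp
    qed
  qed
qed

end
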